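(* Let $\ell,k$ be fixed nonnegative integers and let $\gamma$ be a fixed integer with $0<k-\ell\le\gamma$. For each integer $d\ge1$ let $C_{d,k,\ell,\gamma}$ be the best (i.e. largest) constant for the weighted Hardy-Rellich inequality $$\int_{\mathbb{T}^d}|D^k\phi|^2\,\omega^\gamma\,dx\ \ge\ C_{d,k,\ell,\gamma}\int_{\mathbb{T}^d}|D^\ell\phi|^2\,\omega^{\gamma-k+\ell}\,dx\qquad\text{for all }\phi\in\dot{C}^k(\mathbb{T}^d).$$ Then $$\lim_{d\to\infty}\frac{C_{d,k,\ell,\gamma}}{d^{k-\ell}}=2^{\ell-k}.$$
   Context: $\mathbb{T}^d=[-\pi,\pi]^d$, and functions on $\mathbb{T}^d$ are identified with functions on $\mathbb{R}^d$ that are $2\pi$-periodic in each variable: $C^k(\mathbb{T}^d)$ is the set of real-valued $\varphi\in C^k(\mathbb{R}^d)$ with $\varphi(x+2\pi e_j)=\varphi(x)$ for all $x\in\mathbb{R}^d$, $1\le j\le d$, where $\{e_j\}$ is the canonical basis. $\dot{C}^k(\mathbb{T}^d)$ is the subspace of $\varphi\in C^k(\mathbb{T}^d)$ with $\int_{\mathbb{T}^d}\varphi\,dx=0$. The weight is $\omega(x)=\sum_{j=1}^d\big(\sin\frac{x_j}{2}\big)^2$. With $\nabla$ and $\Delta=\sum_j\partial_{x_j}^2$ the usual gradient and Laplacian, $D^\ell=\Delta^{\ell/2}$ if $\ell$ is even (so $D^0\phi=\phi$) and $D^\ell=\nabla\Delta^{(\ell-1)/2}$ if $\ell$ is odd;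 $|\cdot|$ is the Euclidean norm. *)

theory Defs
  imports "HOL-Analysis.Analysis"
begin

text \<open>
  Since the dimension varies inside the statement, \<open>\<real>\<^sup>d\<close> is modelled by the extensional
  functions on \<open>{..<d}\<close>.  This is the space of the product measure
  \<^term>\<open>Pi\<^sub>M {..<d} (\<lambda>_. lborel)\<close>, and the topology that it inherits from
  \<^typ>\<open>nat \<Rightarrow> real\<close> (pointwise convergence) is the usual one.  Only the values on
  \<open>Rd d\<close> of a function \<^typ>\<open>(nat \<Rightarrow> real) \<Rightarrow> real\<close> matter below.
\<close>

definition Rd :: "nat \<Rightarrow> (nat \<Rightarrow> real) set" where
  "Rd d = (\<Pi>\<^sub>E j\<in>{..<d}. UNIV)"

definition Td :: "nat \<Rightarrow> (nat \<Rightarrow> real) set" where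
  "Td d = (\<Pi>\<^sub>E j\<in>{..<d}. {-pi..pi})"

definition torus_integral :: "nat \<Rightarrow> ((nat \<Rightarrow> real) \<Rightarrow> real) \<Rightarrow> real" where
  "torus_integral d f = (LINT x : Td d | (Pi\<^sub>M {..<d} (\<lambda>_. lborel)). f x)"

definition pderiv_at :: "nat \<Rightarrow> ((nat \<Rightarrow> real) \<Rightarrow> real) \<Rightarrow> (nat \<Rightarrow> real) \<Rightarrow> real" where
  "pderiv_at j f x = deriv (\<lambda>t. f (x(j := t))) (x j)"

fun C_k :: "nat \<Rightarrow> nat \<Rightarrow> ((nat \<Rightarrow> real) \<Rightarrow> real) \<Rightarrow> bool" where
  "C_k d 0 f \<longleftrightarrow> continuous_on (Rd d) f"
| "C_k d (Suc k) f \<longleftrightarrow> continuous_on (Rd d) f \<and>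
     (\<forall>j<d. (\<forall>x\<in>Rd d. (\<lambda>t. f (x(j := t))) differentiable (at (x j))) \<and>
            C_k d k (pderiv_at j f))"

definition C_torus :: "nat \<Rightarrow> nat \<Rightarrow> ((nat \<Rightarrow> real) \<Rightarrow> real) set" where
  "C_torus d k =
     {f. C_k d k f \<and> (\<forall>x\<in>Rd d. \<forall>j<d. f (x(j := x j + 2 * pi)) = f x)}"

definition C_torus_mean_zero :: "nat \<Rightarrow> nat \<Rightarrow> ((nat \<Rightarrow> real) \<Rightarrow> real) set" where
  "C_torus_mean_zero d k = {f \<in> C_torus d k. torus_integral d f = 0}"

definition weight :: "nat \<Rightarrow> (nat \<Rightarrow> real) \<Rightarrow> real" where
  "weight d x = (\<Sum>j<d. (sin (x j / 2))\<^sup>2)"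

definition laplacian :: "nat \<Rightarrow> ((nat \<Rightarrow> real) \<Rightarrow> real) \<Rightarrow> (nat \<Rightarrow> real) \<Rightarrow> real" where
  "laplacian d f x = (\<Sum>j<d. pderiv_at j (pderiv_at j f) x)"

definition gradient :: "nat \<Rightarrow> ((nat \<Rightarrow> real) \<Rightarrow> real) \<Rightarrow> (nat \<Rightarrow> real) \<Rightarrow> nat \<Rightarrow> real" where
  "gradient d f x = (\<lambda>j\<in>{..<d}. pderiv_at j f x)"

text \<open>
  \<open>D\<^sup>l f\<close> is scalar-valued for even \<open>l\<close> and vector-valued for odd \<open>l\<close>; only its
  Euclidean norm \<open>|D\<^sup>l f|\<close> is needed.
\<close>

definition norm_D :: "nat \<Rightarrow> nat \<Rightarrow> ((nat \<Rightarrow> real) \<Rightarrow> real) \<Rightarrow> (nat \<Rightarrow> real) \<Rightarrow> real" where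
  "norm_D d l f x =
     (if even l then \<bar>(laplacian d ^^ (l div 2)) f x\<bar>
      else L2_set (gradient d ((laplacian d ^^ ((l - 1) div 2)) f) x) {..<d})"

definition hardy_rellich :: "nat \<Rightarrow> nat \<Rightarrow> nat \<Rightarrow> int \<Rightarrow> real \<Rightarrow> bool" where
  "hardy_rellich d k l \<gamma> C \<longleftrightarrow>
     (\<forall>f\<in>C_torus_mean_zero d k.
        torus_integral d (\<lambda>x. (norm_D d k f x)\<^sup>2 * weight d x powi \<gamma>)
        \<ge> C * torus_integral d (\<lambda>x. (norm_D d l f x)\<^sup>2 * weight d x powi (\<gamma> - int k + int l)))"

definition best_const :: "nat \<Rightarrow> nat \<Rightarrow> nat \<Rightarrow> int \<Rightarrow> real" where
  "best_const d k l \<gamma> = (GREATEST C. hardy_rellich d k l \<gamma> C)"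

end

theory Submission
  imports Defs "HOL-Probability.Probability"
begin

text \<open>
  Write \<open>D = d / 2\<close>, \<open>w = \<omega> + \<delta>\<close> with a small \<open>\<delta> > 0\<close>, and \<open>E\<close> for the average over the
  torus.  The weight is a sum of \<open>d\<close> independent variables with mean \<open>1 / 2\<close>, so for large \<open>d\<close> it is
  nearly the constant \<open>D\<close>, and the unweighted inequality (Poincare, constant \<open>1\<close>) should dictate the
  answer: each derivative that is traded for a power of \<open>\<omega>\<close> costs a factor \<open>D\<close>.  The test function
  \<open>sin x\<^sub>0\<close>, which is extremal for Poincare, gives the upper bound: \<open>|D\<^sup>j \<phi>|\<^sup>2\<close> is
  \<open>sin\<^sup>2 x\<^sub>0\<close> or \<open>cos\<^sup>2 x\<^sub>0\<close> for every \<open>j\<close>, and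
  the ratio of the two integrals is asymptotic to \<open>D ^ (k - l)\<close> (\<open>norm_D_sin_moment_limit\<close>).

  For the lower bound the difficulty is the exceptional set where \<open>\<omega>\<close> is far from \<open>D\<close>, in
  particular near the zero of \<open>\<omega>\<close>: functions may concentrate there.  The remedy is the pair of facts
  \<open>\<Delta>\<omega> = D - \<omega>\<close> and \<open>|\<nabla>\<omega>|\<^sup>2 \<le> \<omega>\<close>.  The first turns \<open>E F (D - \<omega>)\<close> into
  \<open>- E \<nabla>F \<bullet> \<nabla>\<omega>\<close> (\<open>weight_divergence_formula\<close>), the second makes the
  right-hand side smaller than the terms on the left by a factor of order \<open>1 / sqrt D\<close>.  With
  \<open>F\<close> a power of \<open>w\<close> this yields all positive and negative moments of \<open>w\<close>; with
  \<open>F = \<psi>\<^sup>2 w ^ \<gamma> / w\<close> it yields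
  \<open>D E \<psi>\<^sup>2 w ^ \<gamma> / w \<le> (1 + o(1)) E \<psi>\<^sup>2 w ^ \<gamma> + o(1) E |\<nabla>\<psi>|\<^sup>2 w ^ \<gamma>\<close>.  The term
  \<open>E \<psi>\<^sup>2 w ^ \<gamma>\<close> is controlled by the Poincare inequality for \<open>w ^ (\<gamma> / 2) \<psi>\<close>.  The mean of this
  function is small because \<open>\<psi>\<close> has mean zero and \<open>w\<close> is close to \<open>D\<close> in all moments.
  This proves the Hardy inequality \<open>(1 - o(1)) D E \<psi>\<^sup>2 w ^ \<gamma> / w \<le> E |\<nabla>\<psi>|\<^sup>2 w ^ \<gamma>\<close>
  (\<open>hardy_inequality_asymptotic\<close>), uniformly in \<open>\<delta>\<close>.

  The Rellich step from \<open>\<nabla>\<psi>\<close> to \<open>\<Delta>\<psi>\<close> needs no second-order analysis: integrate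
  \<open>|\<nabla>\<psi>|\<^sup>2 w ^ \<gamma>\<close> by parts once and bound \<open>\<psi>\<close> by \<open>\<nabla>\<psi>\<close> with the Hardy inequality
  (\<open>rellich_inequality_asymptotic\<close>).  Since \<open>D\<^sup>j \<phi>\<close> is \<open>\<Delta>\<^sup>m \<phi>\<close> or \<open>\<nabla>\<Delta>\<^sup>m \<phi>\<close>, alternating the
  Hardy and the Rellich inequality \<open>k - l\<close> times and letting \<open>\<delta> \<rightarrow> 0\<close> gives the lower bound.

  The Poincare inequality with the dimension-free constant \<open>1\<close> is obtained from the one-dimensional
  Wirtinger inequality and the subadditivity of variance over independent coordinates (Efron-Stein).
\<close>

section \<open>The uniform probability measure on the torus\<close>

text \<open>
  Normalised to a probability measure, so that conditional expectations in single coordinates are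
  plain integrals and no powers of \<open>2 * pi\<close> have to be carried along.
\<close>
definition circle_measure :: "real measure" where
  "circle_measure = uniform_measure lborel {-pi..pi}"

definition torus_measure :: "nat \<Rightarrow> (nat \<Rightarrow> real) measure" where
  "torus_measure d = Pi\<^sub>M {..<d} (\<lambda>_. circle_measure)"

definition torus_mean :: "nat \<Rightarrow> ((nat \<Rightarrow> real) \<Rightarrow> real) \<Rightarrow> real" where
  "torus_mean d f = (\<integral>x. f x \<partial>torus_measure d)"

lemma prob_space_circle: "prob_space circle_measure"
  unfolding circle_measure_def by (rule prob_space_uniform_measure) auto

lemma sets_circle [simp, measurable_cong]: "sets circle_measure = sets borel"
  by (simp add: circle_measure_def)

lemma space_circle [simp]: "space circle_measure = UNIV"
  by (simp add: circle_measure_def)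

interpretation circle: prob_space circle_measure
  by (rule prob_space_circle)

interpretation torus: product_prob_space "\<lambda>_::nat. circle_measure" I for I
  by unfold_locales

lemma prob_space_torus: "prob_space (torus_measure d)"
  unfolding torus_measure_def by (rule torus.prob_space_axioms)

lemma space_torus [simp]: "space (torus_measure d) = Rd d"
  by (simp add: torus_measure_def Rd_def space_PiM)

lemma emeasure_circle:
  assumes "A \<in> sets borel"
  shows "emeasure circle_measure A = emeasure lborel ({-pi..pi} \<inter> A) / ennreal (2 * pi)"
  using assms by (simp add: circle_measure_def)

lemma Td_sets: "Td d \<in> sets (Pi\<^sub>M {..<d} (\<lambda>_. lborel))"
  unfolding Td_def by (rule sets_PiM_I_finite) auto

lemma two_pi_nonneg: "0 \<le> 2 * pi" by simp

lemma emeasure_Td: "emeasure (Pi\<^sub>M {..<d} (\<lambda>_. lborel)) (Td d) = ennreal ((2 * pi) ^ d)"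
proof -
  interpret product_sigma_finite "\<lambda>_::nat. lborel::real measure" ..
  show ?thesis
    unfolding Td_def by (subst emeasure_PiM) (auto simp: ennreal_power)
qed

lemma torus_measure_eq: "torus_measure d = uniform_measure (Pi\<^sub>M {..<d} (\<lambda>_. lborel)) (Td d)"
  unfolding torus_measure_def
proof (rule sym, rule torus.PiM_eqI)
  interpret L: product_sigma_finite "\<lambda>_::nat. lborel::real measure" ..
  show "sets (uniform_measure (Pi\<^sub>M {..<d} (\<lambda>_. lborel)) (Td d)) = sets (Pi\<^sub>M {..<d} (\<lambda>_. circle_measure))"
    by (simp cong: sets_PiM_cong)
  fix A :: "nat \<Rightarrow> real set" assume A: "\<And>i. i \<in> {..<d} \<Longrightarrow> A i \<in> sets circle_measure"
  have PA: "Pi\<^sub>E {..<d} A \<in> sets (Pi\<^sub>M {..<d} (\<lambda>_. lborel))"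
    using A by (intro sets_PiM_I_finite) auto
  have "emeasure (uniform_measure (Pi\<^sub>M {..<d} (\<lambda>_. lborel)) (Td d)) (Pi\<^sub>E {..<d} A)
      = emeasure (Pi\<^sub>M {..<d} (\<lambda>_. lborel)) (Pi\<^sub>E {..<d} (\<lambda>i. {-pi..pi} \<inter> A i)) / ennreal ((2 * pi) ^ d)"
    using PA Td_sets by (simp add: emeasure_Td) (simp add: Td_def PiE_Int)
  also have "\<dots> = (\<Prod>i<d. emeasure lborel ({-pi..pi} \<inter> A i)) / ennreal ((2 * pi) ^ d)"
    using A by (subst L.emeasure_PiM) auto
  also have "\<dots> = (\<Prod>i<d. emeasure lborel ({-pi..pi} \<inter> A i) / ennreal (2 * pi))"
    unfolding divide_ennreal_def prod.distrib prod_constant ennreal_inverse_power[symmetric]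
    by (simp only: ennreal_power card_lessThan two_pi_nonneg)
  also have "\<dots> = (\<Prod>i<d. emeasure circle_measure (A i))"
    using A by (intro prod.cong refl) (simp add: emeasure_circle)
  finally show "emeasure (uniform_measure (Pi\<^sub>M {..<d} (\<lambda>_. lborel)) (Td d)) (Pi\<^sub>E {..<d} A) = 
      (\<Prod>i<d. emeasure circle_measure (A i))" .
qed auto

lemma torus_integral_eq_mean:
  assumes [measurable]: "f \<in> borel_measurable (torus_measure d)"
  shows "torus_integral d f = (2 * pi) ^ d * torus_mean d f"
proof -
  have [measurable]: "f \<in> borel_measurable (Pi\<^sub>M {..<d} (\<lambda>_. lborel))" "Td d \<in> sets (Pi\<^sub>M {..<d} (\<lambda>_. lborel))"
    using assms Td_sets by (simp_all add: torus_measure_eq)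
  have eq: "torus_measure d = density (Pi\<^sub>M {..<d} (\<lambda>_. lborel)) (\<lambda>x. ennreal (indicator (Td d) x / (2 * pi) ^ d))"
    unfolding torus_measure_eq uniform_measure_def emeasure_Td
    by (intro arg_cong[where f="density _"] ext)
       (auto simp: divide_ennreal[symmetric] split: split_indicator)
  have "torus_mean d f = (\<integral>x. (indicator (Td d) x / (2 * pi) ^ d) *\<^sub>R f x \<partial>Pi\<^sub>M {..<d} (\<lambda>_. lborel))"
    unfolding torus_mean_def by (subst eq, subst integral_density) auto
  also have "\<dots> = (1 / (2 * pi) ^ d) * torus_integral d f"
    unfolding torus_integral_def set_lebesgue_integral_def
    by (subst integral_mult_right_zero[symmetric]) (intro Bochner_Integration.integral_cong, auto)
  finally show ?thesis by simp
qed

lemma circle_integral: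
  fixes f :: "real \<Rightarrow> real"
  assumes f: "continuous_on UNIV f"
  shows "(\<integral>t. f t \<partial>circle_measure) = integral {-pi..pi} f / (2 * pi)"
proof -
  have [measurable]: "f \<in> borel_measurable borel"
    using f by (rule borel_measurable_continuous_onI)
  have eq: "circle_measure = density lborel (\<lambda>x. ennreal (indicator {-pi..pi} x / (2 * pi)))"
    unfolding circle_measure_def uniform_measure_def
    by (intro arg_cong[where f="density _"] ext)
       (auto simp: divide_ennreal[symmetric] split: split_indicator)
  have "(\<integral>t. f t \<partial>circle_measure) = (\<integral>x. (indicator {-pi..pi} x / (2 * pi)) *\<^sub>R f x \<partial>lborel)"
    unfolding eq by (rule integral_density) auto
  also have "\<dots> = (1 / (2 * pi)) * (LINT x:{-pi..pi}|lborel. f x)"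
    unfolding set_lebesgue_integral_def
    by (subst integral_mult_right_zero[symmetric]) (intro Bochner_Integration.integral_cong, auto)
  also have "(LINT x:{-pi..pi}|lborel. f x) = integral {-pi..pi} f"
    by (intro set_borel_integral_eq_integral borel_integrable_atLeastAtMost')
       (use f continuous_on_subset in blast)
  finally show ?thesis by simp
qed

text \<open>
  The product \<open>\<sigma>\<close>-algebra over \<open>{..<d}\<close> is not the Borel \<open>\<sigma>\<close>-algebra of
  \<^typ>\<open>nat \<Rightarrow> real\<close>.  The map that overwrites the coordinates from \<open>d\<close> on by \<^term>\<open>undefined\<close> is
  continuous and is the identity on \<open>Rd d\<close>; it transports measurability from the countable product.
\<close>
lemma borel_measurable_torus:
  assumes f: "continuous_on (Rd d) f"
  shows "f \<in> borel_measurable (torus_measure d)"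
proof -
  define e :: "(nat \<Rightarrow> real) \<Rightarrow> nat \<Rightarrow> real" where "e = (\<lambda>x j. if j < d then x j else undefined)"
  have eR: "e x \<in> Rd d" for x by (auto simp: e_def Rd_def PiE_def extensional_def)
  have ce: "continuous_on UNIV e"
    unfolding e_def
  proof (rule continuous_on_coordinatewise_then_product)
    fix i show "continuous_on UNIV (\<lambda>x::nat\<Rightarrow>real. if i < d then x i else undefined)"
      by (cases "i < d") auto
  qed
  have "continuous_on UNIV (\<lambda>x. f (e x))"
    by (rule continuous_on_compose2[OF f ce]) (use eR in auto)
  then have m1: "(\<lambda>x. f (e x)) \<in> borel_measurable borel"
    by (rule borel_measurable_continuous_onI)
  have "e \<in> measurable (torus_measure d) (Pi\<^sub>M UNIV (\<lambda>_. borel))"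
    unfolding torus_measure_def
  proof (rule measurable_PiM_single')
    fix i :: nat
    show "(\<lambda>x. e x i) \<in> borel_measurable (Pi\<^sub>M {..<d} (\<lambda>_. circle_measure))"
      by (cases "i < d") (auto simp: e_def)
  qed auto
  then have m2: "e \<in> measurable (torus_measure d) borel"
    by (simp add: measurable_cong_sets[OF refl sets_PiM_equal_borel])
  have "(\<lambda>x. f (e (e x))) \<in> borel_measurable (torus_measure d)"
    by (rule measurable_compose[OF m2 m1])
  also have "?this \<longleftrightarrow> f \<in> borel_measurable (torus_measure d)"
  proof (rule measurable_cong)
    fix x assume "x \<in> space (torus_measure d)"
    then have "e x = x" by (auto simp: e_def Rd_def PiE_def extensional_def)
    then show "f (e (e x)) = f x" by simp
  qed
  finally show ?thesis .
qed

section \<open>Wirtinger's inequality on the circle\<close>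

text \<open>
  For \<open>0 < z < 1\<close> the function \<open>y = cos (sqrt z * (x - m))\<close>, with \<open>m\<close> the midpoint, solves
  \<open>y'' = - z y\<close> and is positive on the closed interval.  Jacobi's trick with \<open>q = y' / y\<close> for \<open>f - c\<close> in place of \<open>f\<close> gives
  \<open>f'\<^sup>2 - z f\<^sup>2 = (f' - q f)\<^sup>2 + (f\<^sup>2 q)'\<close>, and the last term integrates to zero by the boundary
  condition.  Letting \<open>z\<close> tend to \<open>1\<close> avoids the singularities that \<open>q\<close> has at the end points
  for \<open>z = 1\<close>.
\<close>
lemma wirtinger_dirichlet:
  fixes f f' :: "real \<Rightarrow> real"
  assumes deriv: "\<And>x. (f has_real_derivative f' x) (at x)"
    and cont: "continuous_on UNIV f'"
    and ends: "f a = c" "f (a + pi) = c"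
  shows "integral {a..a + pi} (\<lambda>x. (f x - c)\<^sup>2) \<le> integral {a..a + pi} (\<lambda>x. (f' x)\<^sup>2)"
proof (rule field_le_mult_one_interval)
  fix z :: real assume z: "0 < z" "z < 1"
  define r where "r = sqrt z"
  have r: "0 < r" "r < 1" "r * r = z" using z by (auto simp: r_def)
  define m where "m = a + pi / 2"
  define g where "g = (\<lambda>x. f x - c)"
  \<comment> \<open>\<open>- r * T\<close> is the logarithmic derivative of \<open>cos (r * (x - m))\<close>, and \<open>h\<close> is the derivative of \<open>g\<^sup>2 * (- r * T)\<close>\<close>
  define T where "T = (\<lambda>x. tan (r * (x - m)))"
  define h where "h = (\<lambda>x. 2 * g x * f' x * (- r * T x) - (g x)\<^sup>2 * (z * (1 + (T x)\<^sup>2)))"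
  have cf: "continuous_on A f" "continuous_on A f'" for A
  proof -
    show "continuous_on A f"
      by (rule DERIV_continuous_on) (rule has_field_derivative_at_within[OF deriv])
    show "continuous_on A f'"
      by (rule continuous_on_subset[OF cont]) simp
  qed
  have cg: "continuous_on A g" for A
    unfolding g_def by (intro continuous_intros cf)
  have cospos: "cos (r * (x - m)) > 0" if "x \<in> {a..a + pi}" for x
  proof (rule cos_gt_zero_pi)
    have "\<bar>x - m\<bar> \<le> pi / 2" using that unfolding m_def abs_le_iff atLeastAtMost_iff by linarith
    then have "r * \<bar>x - m\<bar> \<le> r * (pi / 2)" using r by (intro mult_left_mono) auto
    also have "\<dots> < 1 * (pi / 2)" using r by (intro mult_strict_right_mono) auto
    finally have "\<bar>r * (x - m)\<bar> < pi / 2" using r by (simp add: abs_mult)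
    then show "- (pi / 2) < r * (x - m)" "r * (x - m) < pi / 2" by linarith+
  qed
  have dg: "(g has_real_derivative f' x) (at x within A)" for x A
    using DERIV_diff[OF has_field_derivative_at_within[OF deriv[of x]] DERIV_const[of c]] by (simp add: g_def)
  have "(h has_integral ((g (a + pi))\<^sup>2 * (- r * T (a + pi)) - (g a)\<^sup>2 * (- r * T a))) {a..a + pi}"
  proof (rule fundamental_theorem_of_calculus)
    fix x assume x: "x \<in> {a..a + pi}"
    have dT: "(T has_real_derivative (r * (1 + (T x)\<^sup>2))) (at x within {a..a + pi})"
    proof -
      have "((\<lambda>x. r * (x - m)) has_real_derivative r) (at x within {a..a + pi})"
        by (auto intro!: derivative_eq_intros)
      then have "(T has_real_derivative inverse ((cos (r * (x - m)))\<^sup>2) * r) (at x within {a..a + pi})"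
        unfolding T_def using cospos[OF x] by (intro DERIV_chain2[OF DERIV_tan]) auto
      moreover have "inverse ((cos (r * (x - m)))\<^sup>2) = 1 + (T x)\<^sup>2"
        unfolding T_def using cospos[OF x] by (subst tan_sec) (auto simp: power_inverse)
      ultimately show ?thesis by (simp only: mult.commute)
    qed
    have dg2: "((\<lambda>x. (g x)\<^sup>2) has_real_derivative 2 * g x * f' x) (at x within {a..a + pi})"
      by (rule DERIV_cong[OF DERIV_power[OF dg]]) simp
    have dT2: "((\<lambda>x. - r * T x) has_real_derivative - r * (r * (1 + (T x)\<^sup>2))) (at x within {a..a + pi})"
      by (rule DERIV_cmult[OF dT])
    have "((\<lambda>x. (g x)\<^sup>2 * (- r * T x)) has_real_derivative h x) (at x within {a..a + pi})"
      by (rule DERIV_cong[OF DERIV_mult[OF dg2 dT2]])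
        (simp only: h_def r(3)[symmetric], algebra)
    then show "((\<lambda>x. (g x)\<^sup>2 * (- r * T x)) has_vector_derivative h x) (at x within {a..a + pi})"
      by (simp add: has_real_derivative_iff_has_vector_derivative)
  qed auto
  then have h0: "(h has_integral 0) {a..a + pi}"
    using ends by (simp add: g_def)
  have gi: "(\<lambda>x. (g x)\<^sup>2) integrable_on {a..a + pi}" and fi: "(\<lambda>x. (f' x)\<^sup>2) integrable_on {a..a + pi}"
    by (intro integrable_continuous_interval continuous_intros cg cf)+
  have "((\<lambda>x. z * (g x)\<^sup>2 + h x) has_integral (z * integral {a..a + pi} (\<lambda>x. (g x)\<^sup>2) + 0)) {a..a + pi}"
    by (intro has_integral_add has_integral_mult_right integrable_integral gi h0)
  moreover have "((\<lambda>x. (f' x)\<^sup>2) has_integral integral {a..a + pi} (\<lambda>x. (f' x)\<^sup>2)) {a..a + pi}"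
    by (intro integrable_integral fi)
  ultimately have "z * integral {a..a + pi} (\<lambda>x. (g x)\<^sup>2) + 0 \<le> integral {a..a + pi} (\<lambda>x. (f' x)\<^sup>2)"
  proof (rule has_integral_le)
    fix x
    have "(f' x)\<^sup>2 - (z * (g x)\<^sup>2 + h x) = (f' x + r * g x * T x)\<^sup>2"
      unfolding h_def r(3)[symmetric] by (simp add: algebra_simps power2_eq_square)
    then show "z * (g x)\<^sup>2 + h x \<le> (f' x)\<^sup>2"
      using zero_le_power2[of "f' x + r * g x * T x"] by linarith
  qed
  then show "z * integral {a..a + pi} (\<lambda>x. (f x - c)\<^sup>2) \<le> integral {a..a + pi} (\<lambda>x. (f' x)\<^sup>2)"
    by (simp add: g_def)
qed

lemma integral_periodic_shift:
  fixes g :: "real \<Rightarrow> real"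
  assumes cont: "continuous_on UNIV g" and per: "\<And>x. g (x + 2 * pi) = g x"
    and a: "-pi \<le> a" "a \<le> pi"
  shows "integral {a..a + 2 * pi} g = integral {-pi..pi} g"
proof -
  have ig: "g integrable_on {x..y}" for x y
    by (rule integrable_continuous_interval) (rule continuous_on_subset[OF cont], simp)
  have "integral {-pi..a} g + integral {a..a + 2 * pi} g = integral {-pi..a + 2 * pi} g"
    using a by (intro Henstock_Kurzweil_Integration.integral_combine ig) auto
  moreover have "integral {-pi..pi} g + integral {pi..a + 2 * pi} g = integral {-pi..a + 2 * pi} g"
    using a by (intro Henstock_Kurzweil_Integration.integral_combine ig) auto
  moreover have "integral {pi..a + 2 * pi} g = integral {-pi..a} g"
    using integral_shift_Icc_real[of "-pi" a g "2 * pi"] per by (simp add: o_def add.commute)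
  ultimately show ?thesis by simp
qed

text \<open>
  A periodic function takes equal values at two points \<open>a\<close> and \<open>a + pi\<close> at distance half a period.
  Subtracting this value, the Dirichlet inequality applies on both halves of the circle, and the
  mean is the constant whose subtraction makes the left-hand side smallest.
\<close>
lemma wirtinger_periodic:
  fixes f f' :: "real \<Rightarrow> real"
  assumes deriv: "\<And>x. (f has_real_derivative f' x) (at x)"
    and cont: "continuous_on UNIV f'"
    and per: "\<And>x. f (x + 2 * pi) = f x" "\<And>x. f' (x + 2 * pi) = f' x"
  shows "(\<integral>t. (f t)\<^sup>2 \<partial>circle_measure) - (\<integral>t. f t \<partial>circle_measure)\<^sup>2 \<le> (\<integral>t. (f' t)\<^sup>2 \<partial>circle_measure)"
proof -
  have cf: "continuous_on A f" "continuous_on A f'" for A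
  proof -
    show "continuous_on A f"
      by (rule DERIV_continuous_on) (rule has_field_derivative_at_within[OF deriv])
    show "continuous_on A f'"
      by (rule continuous_on_subset[OF cont]) simp
  qed
  \<comment> \<open>The difference \<open>f (a + pi) - f a\<close> changes its sign when \<open>a\<close> moves from \<open>-pi\<close> to \<open>0\<close>\<close>
  have "\<exists>a\<ge>-pi. a \<le> 0 \<and> f (a + pi) - f a = 0"
  proof -
    have c: "continuous_on {-pi..0} (\<lambda>a. f (a + pi) - f a)"
      by (intro continuous_intros continuous_on_compose2[OF cf(1)[of UNIV]] cf) auto
    have e: "f pi = f (-pi)" using per(1)[of "-pi"] by simp
    show ?thesis
    proof (cases "f (-pi) \<ge> f 0")
      case True
      then show ?thesis using IVT'[of "\<lambda>a. f (a + pi) - f a" "-pi" 0 0] c e by auto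
    next
      case False
      then show ?thesis using IVT2'[of "\<lambda>a. f (a + pi) - f a" 0 0 "-pi"] c e by auto
    qed
  qed
  then obtain a where a: "-pi \<le> a" "a \<le> 0" "f (a + pi) = f a" by auto
  define c where "c = f a"
  have c2: "f (a + pi + pi) = c" using per(1)[of a] by (simp add: c_def add.assoc)
  have i1: "(\<lambda>x. (f x - c)\<^sup>2) integrable_on {x..y}" and i2: "(\<lambda>x. (f' x)\<^sup>2) integrable_on {x..y}"
    and i3: "f integrable_on {x..y}" and i4: "(\<lambda>x. (f x)\<^sup>2) integrable_on {x..y}" for x y
    by (intro integrable_continuous_interval continuous_intros cf)+
  have "integral {-pi..pi} (\<lambda>x. (f x - c)\<^sup>2) = integral {a..a + 2 * pi} (\<lambda>x. (f x - c)\<^sup>2)"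
    using a by (intro integral_periodic_shift[symmetric] continuous_intros cf) (auto simp: per)
  also have "\<dots> = integral {a..a + pi} (\<lambda>x. (f x - c)\<^sup>2) + integral {a + pi..a + pi + pi} (\<lambda>x. (f x - c)\<^sup>2)"
    by (subst Henstock_Kurzweil_Integration.integral_combine) (auto simp: i1 algebra_simps)
  also have "\<dots> \<le> integral {a..a + pi} (\<lambda>x. (f' x)\<^sup>2) + integral {a + pi..a + pi + pi} (\<lambda>x. (f' x)\<^sup>2)"
    using a c2 by (intro add_mono wirtinger_dirichlet deriv cont) (auto simp: c_def)
  also have "\<dots> = integral {a..a + 2 * pi} (\<lambda>x. (f' x)\<^sup>2)"
    by (subst Henstock_Kurzweil_Integration.integral_combine) (auto simp: i2 algebra_simps)
  also have "\<dots> = integral {-pi..pi} (\<lambda>x. (f' x)\<^sup>2)"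
    using a by (intro integral_periodic_shift continuous_intros cf) (auto simp: per)
  finally have le: "integral {-pi..pi} (\<lambda>x. (f x - c)\<^sup>2) \<le> integral {-pi..pi} (\<lambda>x. (f' x)\<^sup>2)" .
  define F where "F = integral {-pi..pi} f"
  have "((\<lambda>x. (f x)\<^sup>2 - 2 * c * f x + c\<^sup>2) has_integral 
      (integral {-pi..pi} (\<lambda>x. (f x)\<^sup>2) - 2 * c * F + (pi - (-pi)) *\<^sub>R c\<^sup>2)) {-pi..pi}"
    unfolding F_def
    by (intro has_integral_add has_integral_diff has_integral_mult_right integrable_integral i3 i4 
        has_integral_const_real[where a="-pi" and b=pi, THEN has_integral_eq_rhs]) simp
  then have "integral {-pi..pi} (\<lambda>x. (f x)\<^sup>2 - 2 * c * f x + c\<^sup>2) = 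
      integral {-pi..pi} (\<lambda>x. (f x)\<^sup>2) - 2 * c * F + 2 * pi * c\<^sup>2"
    by (simp add: integral_unique)
  moreover have "(\<lambda>x. (f x)\<^sup>2 - 2 * c * f x + c\<^sup>2) = (\<lambda>x. (f x - c)\<^sup>2)"
    by (auto simp: power2_eq_square algebra_simps)
  ultimately have eq: "integral {-pi..pi} (\<lambda>x. (f x - c)\<^sup>2) = integral {-pi..pi} (\<lambda>x. (f x)\<^sup>2) - 2 * c * F + 2 * pi * c\<^sup>2"
    by simp
  have sq: "0 \<le> (F / (2 * pi) - c)\<^sup>2" by simp
  have "integral {-pi..pi} (\<lambda>x. (f x)\<^sup>2) / (2 * pi) - (F / (2 * pi))\<^sup>2 
      \<le> integral {-pi..pi} (\<lambda>x. (f x)\<^sup>2) / (2 * pi) - (F / (2 * pi))\<^sup>2 + (F / (2 * pi) - c)\<^sup>2" by simp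
  also have "\<dots> = integral {-pi..pi} (\<lambda>x. (f x - c)\<^sup>2) / (2 * pi)"
    unfolding eq by (simp add: field_simps power2_eq_square)
  also have "\<dots> \<le> integral {-pi..pi} (\<lambda>x. (f' x)\<^sup>2) / (2 * pi)"
    using le by (intro divide_right_mono) auto
  finally show ?thesis
    by (simp add: circle_integral F_def cf continuous_on_power)
qed

section \<open>The Efron-Stein inequality for product measures\<close>

lemma (in prob_space) integrable_bounded:
  fixes f :: "'a \<Rightarrow> real"
  assumes "f \<in> borel_measurable M" "\<And>x. x \<in> space M \<Longrightarrow> \<bar>f x\<bar> \<le> K"
  shows "integrable M f"
  by (rule integrable_const_bound[where B=K]) (use assms in auto)

lemma (in prob_space) abs_mean_le:
  fixes f :: "'a \<Rightarrow> real"
  assumes "f \<in> borel_measurable M" "\<And>x. x \<in> space M \<Longrightarrow> \<bar>f x\<bar> \<le> K"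
  shows "\<bar>\<integral>x. f x \<partial>M\<bar> \<le> K"
proof -
  have i: "integrable M f" by (rule integrable_bounded[OF assms])
  have "(\<integral>x. f x \<partial>M) \<le> (\<integral>x. K \<partial>M)"
    using assms by (intro integral_mono i) (auto dest!: abs_le_D1)
  moreover have "(\<integral>x. - K \<partial>M) \<le> (\<integral>x. f x \<partial>M)"
  proof (intro integral_mono i)
    fix x assume "x \<in> space M"
    then show "- K \<le> f x" using assms(2)[of x] by linarith
  qed auto
  ultimately show ?thesis by (simp add: prob_space)
qed

lemma square_le_bound: "\<bar>x::real\<bar> \<le> K \<Longrightarrow> \<bar>x\<^sup>2\<bar> \<le> K\<^sup>2"
  by (metis abs_ge_zero abs_power2 power2_abs power_mono)

lemma (in prob_space) variance_eq_bounded: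
  fixes f :: "'a \<Rightarrow> real"
  assumes [measurable]: "f \<in> borel_measurable M" and b: "\<And>x. x \<in> space M \<Longrightarrow> \<bar>f x\<bar> \<le> K"
  shows "(\<integral>x. (f x - (\<integral>x. f x \<partial>M))\<^sup>2 \<partial>M) = (\<integral>x. (f x)\<^sup>2 \<partial>M) - (\<integral>x. f x \<partial>M)\<^sup>2"
proof (rule variance_eq)
  show "integrable M f" by (rule integrable_bounded[OF assms])
  show "integrable M (\<lambda>x. (f x)\<^sup>2)"
    by (rule integrable_bounded[where K="K\<^sup>2"]) (measurable, rule square_le_bound[OF b])
qed

lemma (in prob_space) square_mean_le:
  fixes f :: "'a \<Rightarrow> real"
  assumes "f \<in> borel_measurable M" "\<And>x. x \<in> space M \<Longrightarrow> \<bar>f x\<bar> \<le> K"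
  shows "(\<integral>x. f x \<partial>M)\<^sup>2 \<le> (\<integral>x. (f x)\<^sup>2 \<partial>M)"
proof -
  have "0 \<le> (\<integral>x. (f x - (\<integral>x. f x \<partial>M))\<^sup>2 \<partial>M)" by simp
  then show ?thesis using variance_eq_bounded[OF assms] by simp
qed

text \<open>
  Jensen's inequality for the convex functional variance: averaging over an independent parameter
  \<open>x\<close> does not increase the variance in \<open>t\<close>.  Centre \<open>U\<close> in \<open>t\<close> and use that the square of a mean
  is at most the mean of the square.
\<close>
lemma variance_of_mean_le:
  fixes U :: "'a \<Rightarrow> 'b \<Rightarrow> real"
  assumes "prob_space P" "prob_space Q"
    and [measurable]: "(\<lambda>(x, t). U x t) \<in> borel_measurable (P \<Otimes>\<^sub>M Q)"
    and b: "\<And>x t. x \<in> space P \<Longrightarrow> t \<in> space Q \<Longrightarrow> \<bar>U x t\<bar> \<le> K"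
  shows "(\<integral>t. (\<integral>x. U x t \<partial>P)\<^sup>2 \<partial>Q) - (\<integral>t. (\<integral>x. U x t \<partial>P) \<partial>Q)\<^sup>2
    \<le> (\<integral>x. (\<integral>t. (U x t)\<^sup>2 \<partial>Q) - (\<integral>t. U x t \<partial>Q)\<^sup>2 \<partial>P)"
proof -
  interpret P: prob_space P by fact
  interpret Q: prob_space Q by fact
  interpret PQ: pair_prob_space P Q ..
  have m1: "(\<lambda>t. U x t) \<in> borel_measurable Q" if "x \<in> space P" for x
    using measurable_compose[OF measurable_Pair1'[OF that] assms(3)] by simp
  have m2: "(\<lambda>x. U x t) \<in> borel_measurable P" if "t \<in> space Q" for t
    using measurable_compose[OF measurable_Pair2'[OF that] assms(3)] by simp
  define n where "n = (\<lambda>x. \<integral>t. U x t \<partial>Q)"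
  define m where "m = (\<lambda>t. \<integral>x. U x t \<partial>P)"
  have [measurable]: "n \<in> borel_measurable P" unfolding n_def by measurable
  have [measurable]: "m \<in> borel_measurable Q" unfolding m_def
    by (rule Q.borel_measurable_lebesgue_integral | rule P.borel_measurable_lebesgue_integral) measurable
  have bn: "\<bar>n x\<bar> \<le> K" if "x \<in> space P" for x
    unfolding n_def using that by (intro Q.abs_mean_le m1 b) auto
  have bm: "\<bar>m t\<bar> \<le> K" if "t \<in> space Q" for t
    unfolding m_def using that by (intro P.abs_mean_le m2 b) auto
  have iU: "integrable (P \<Otimes>\<^sub>M Q) (\<lambda>(x, t). U x t)"
    by (rule PQ.integrable_bounded[where K=K]) (auto simp: space_pair_measure b)
  have N: "(\<integral>t. m t \<partial>Q) = (\<integral>x. n x \<partial>P)"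
    unfolding m_def n_def by (rule PQ.Fubini_integral[OF iU])
  \<comment> \<open>Centring in \<open>t\<close> makes the two variances mere integrals of squares\<close>
  define W where "W = (\<lambda>x t. U x t - n x)"
  have mW [measurable]: "(\<lambda>(x, t). W x t) \<in> borel_measurable (P \<Otimes>\<^sub>M Q)"
    unfolding W_def by measurable
  have bW: "\<bar>W x t\<bar> \<le> 2 * K" if "x \<in> space P" "t \<in> space Q" for x t
    unfolding W_def using b[OF that] bn[OF that(1)] by linarith
  have iW2: "integrable (P \<Otimes>\<^sub>M Q) (\<lambda>(x, t). (W x t)\<^sup>2)"
    by (rule PQ.integrable_bounded[where K="(2 * K)\<^sup>2"])
      (auto simp only: space_pair_measure mem_Times_iff case_prod_beta intro!: square_le_bound bW, measurable)
  have mW2: "(\<lambda>x. W x t) \<in> borel_measurable P" if "t \<in> space Q" for t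
    using m2[OF that] unfolding W_def by measurable
  have intW: "(\<integral>x. W x t \<partial>P) = m t - (\<integral>x. n x \<partial>P)" if "t \<in> space Q" for t
    unfolding W_def m_def using that bn
    by (intro Bochner_Integration.integral_diff P.integrable_bounded[where K=K] m2 b) auto
  have "(\<integral>t. (m t)\<^sup>2 \<partial>Q) - (\<integral>t. m t \<partial>Q)\<^sup>2 = (\<integral>t. (m t - (\<integral>t. m t \<partial>Q))\<^sup>2 \<partial>Q)"
    by (rule Q.variance_eq_bounded[symmetric, where K=K]) (auto intro: bm)
  also have "\<dots> = (\<integral>t. (\<integral>x. W x t \<partial>P)\<^sup>2 \<partial>Q)"
    by (intro Bochner_Integration.integral_cong refl) (simp add: intW N)
  also have "\<dots> \<le> (\<integral>t. (\<integral>x. (W x t)\<^sup>2 \<partial>P) \<partial>Q)"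
  proof (rule integral_mono)
    show "integrable Q (\<lambda>t. (\<integral>x. W x t \<partial>P)\<^sup>2)"
    proof (rule Q.integrable_bounded[where K="(2 * K)\<^sup>2"])
      have "(\<lambda>t. m t - (\<integral>x. n x \<partial>P)) \<in> borel_measurable Q" by measurable
      then have "(\<lambda>t. \<integral>x. W x t \<partial>P) \<in> borel_measurable Q"
        by (subst measurable_cong[OF intW])
      then show "(\<lambda>t. (\<integral>x. W x t \<partial>P)\<^sup>2) \<in> borel_measurable Q" by measurable
    qed (intro square_le_bound P.abs_mean_le mW2 bW)
    show "integrable Q (\<lambda>t. \<integral>x. (W x t)\<^sup>2 \<partial>P)"
      using PQ.integrable_snd[OF iW2] by simp
    show "(\<integral>x. W x t \<partial>P)\<^sup>2 \<le> (\<integral>x. (W x t)\<^sup>2 \<partial>P)" if "t \<in> space Q" for t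
      using that by (intro P.square_mean_le[where K="2 * K"] mW2 bW)
  qed
  also have "\<dots> = (\<integral>x. (\<integral>t. (W x t)\<^sup>2 \<partial>Q) \<partial>P)"
    by (rule PQ.Fubini_integral[OF iW2])
  also have "\<dots> = (\<integral>x. (\<integral>t. (U x t)\<^sup>2 \<partial>Q) - (n x)\<^sup>2 \<partial>P)"
    unfolding W_def n_def
    by (intro Bochner_Integration.integral_cong refl Q.variance_eq_bounded[where K=K] m1 b)
  finally show ?thesis by (simp add: m_def n_def)
qed

definition coord_variance :: "'a measure \<Rightarrow> nat \<Rightarrow> ((nat \<Rightarrow> 'a) \<Rightarrow> real) \<Rightarrow> (nat \<Rightarrow> 'a) \<Rightarrow> real" where
  "coord_variance M j u x = (\<integral>s. (u (x(j := s)))\<^sup>2 \<partial>M) - (\<integral>s. u (x(j := s)) \<partial>M)\<^sup>2"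

lemma space_PiM_upd:
  "x \<in> space (Pi\<^sub>M I (\<lambda>_. M)) \<Longrightarrow> s \<in> space M \<Longrightarrow> x(j := s) \<in> space (Pi\<^sub>M (insert j I) (\<lambda>_. M))"
  by (auto simp: space_PiM PiE_def extensional_def)

lemma measurable_upd:
  assumes u: "u \<in> borel_measurable (Pi\<^sub>M (insert j I) (\<lambda>_. M))"
  shows "(\<lambda>(x, s). u (x(j := s))) \<in> borel_measurable (Pi\<^sub>M I (\<lambda>_. M) \<Otimes>\<^sub>M M)"
proof -
  have "(\<lambda>z. (fst z)(j := snd z)) \<in> measurable (Pi\<^sub>M I (\<lambda>_. M) \<Otimes>\<^sub>M M) (Pi\<^sub>M (insert j I) (\<lambda>_. M))"
    by (rule measurable_fun_upd[where J=I]) auto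
  from measurable_compose[OF this u] show ?thesis by (simp add: case_prod_beta')
qed

lemma (in prob_space) coord_variance_measurable_bounded:
  assumes j: "j \<in> I" and u: "u \<in> borel_measurable (Pi\<^sub>M I (\<lambda>_. M))"
    and b: "\<And>x. x \<in> space (Pi\<^sub>M I (\<lambda>_. M)) \<Longrightarrow> \<bar>u x\<bar> \<le> K"
  shows "coord_variance M j u \<in> borel_measurable (Pi\<^sub>M I (\<lambda>_. M))"
    and "x \<in> space (Pi\<^sub>M I (\<lambda>_. M)) \<Longrightarrow> \<bar>coord_variance M j u x\<bar> \<le> 2 * K\<^sup>2"
proof -
  have ij: "insert j I = I" using j by auto
  have [measurable]: "(\<lambda>(x, s). u (x(j := s))) \<in> borel_measurable (Pi\<^sub>M I (\<lambda>_. M) \<Otimes>\<^sub>M M)"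
    by (rule measurable_upd) (simp add: ij u)
  show "coord_variance M j u \<in> borel_measurable (Pi\<^sub>M I (\<lambda>_. M))"
    unfolding coord_variance_def by measurable
  assume x: "x \<in> space (Pi\<^sub>M I (\<lambda>_. M))"
  have bx: "\<bar>u (x(j := s))\<bar> \<le> K" if "s \<in> space M" for s
    using space_PiM_upd[OF x that, of j] b by (simp add: ij)
  have m: "(\<lambda>s. u (x(j := s))) \<in> borel_measurable M"
    using measurable_compose[OF measurable_Pair1'[OF x, of M] measurable_upd[of u j I M]] u by (simp add: ij)
  have "\<bar>\<integral>s. (u (x(j := s)))\<^sup>2 \<partial>M\<bar> \<le> K\<^sup>2"
    using m by (intro abs_mean_le square_le_bound bx) auto
  moreover have "\<bar>(\<integral>s. u (x(j := s)) \<partial>M)\<^sup>2\<bar> \<le> K\<^sup>2"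
    using m by (intro square_le_bound abs_mean_le bx) auto
  ultimately show "\<bar>coord_variance M j u x\<bar> \<le> 2 * K\<^sup>2"
    unfolding coord_variance_def by linarith
qed

text \<open>
  Induction on the coordinates.  Fixing a new coordinate \<open>t\<close> and applying the induction hypothesis in
  the others leaves the variance of the function \<open>t \<mapsto> E u(\<cdot>, t)\<close>, which is at most the average
  variance of \<open>u\<close> in the new coordinate.
\<close>
lemma (in prob_space) efron_stein:
  fixes I :: "nat set"
  assumes "finite I" and "u \<in> borel_measurable (Pi\<^sub>M I (\<lambda>_. M))"
    and "\<And>x. x \<in> space (Pi\<^sub>M I (\<lambda>_. M)) \<Longrightarrow> \<bar>u x\<bar> \<le> K"
  shows "(\<integral>x. (u x)\<^sup>2 \<partial>Pi\<^sub>M I (\<lambda>_. M)) - (\<integral>x. u x \<partial>Pi\<^sub>M I (\<lambda>_. M))\<^sup>2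
    \<le> (\<Sum>j\<in>I. \<integral>x. coord_variance M j u x \<partial>Pi\<^sub>M I (\<lambda>_. M))"
  using assms
proof (induction I arbitrary: u rule: finite_induct)
  case empty
  interpret product_sigma_finite "\<lambda>_::nat. M" ..
  show ?case by (simp add: PiM_empty lebesgue_integral_count_space_finite)
next
  case (insert i J)
  interpret product_sigma_finite "\<lambda>_::nat. M" ..
  let ?P = "Pi\<^sub>M J (\<lambda>_::nat. M)" and ?Q = "Pi\<^sub>M (insert i J) (\<lambda>_::nat. M)"
  interpret P: prob_space ?P by (rule prob_space_PiM) unfold_locales
  interpret Q: prob_space ?Q by (rule prob_space_PiM) unfold_locales
  interpret PM: pair_prob_space ?P M ..
  note u = insert.prems(1) and b = insert.prems(2)
  have bU: "\<bar>u (x(i := t))\<bar> \<le> K" if "x \<in> space ?P" "t \<in> space M" for x t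
    using b space_PiM_upd[OF that, of i] by auto
  have fubini: "(\<integral>x. g x \<partial>?Q) = (\<integral>x. (\<integral>t. g (x(i := t)) \<partial>M) \<partial>?P)"
    and fubini': "(\<integral>x. (\<integral>t. g (x(i := t)) \<partial>M) \<partial>?P) = (\<integral>t. (\<integral>x. g (x(i := t)) \<partial>?P) \<partial>M)"
    and fubini_int: "integrable M (\<lambda>t. \<integral>x. g (x(i := t)) \<partial>?P)"
    if g: "g \<in> borel_measurable ?Q" and bg: "\<And>x. x \<in> space ?Q \<Longrightarrow> \<bar>g x\<bar> \<le> L" for g :: "(nat \<Rightarrow> 'a) \<Rightarrow> real" and L
  proof -
    show "(\<integral>x. g x \<partial>?Q) = (\<integral>x. (\<integral>t. g (x(i := t)) \<partial>M) \<partial>?P)"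
      using Q.integrable_bounded[OF g bg] insert.hyps by (intro product_integral_insert) auto
    have i: "integrable (?P \<Otimes>\<^sub>M M) (\<lambda>(x, t). g (x(i := t)))"
      by (rule PM.integrable_bounded[OF measurable_upd[OF g], where K=L])
        (auto simp: space_pair_measure intro!: bg space_PiM_upd)
    from PM.Fubini_integral[OF i]
    show "(\<integral>x. (\<integral>t. g (x(i := t)) \<partial>M) \<partial>?P) = (\<integral>t. (\<integral>x. g (x(i := t)) \<partial>?P) \<partial>M)" by simp
    from PM.integrable_snd[OF i]
    show "integrable M (\<lambda>t. \<integral>x. g (x(i := t)) \<partial>?P)" by simp
  qed
  define v where "v = (\<lambda>t x. u (x(i := t)))"
  have mv: "v t \<in> borel_measurable ?P" if "t \<in> space M" for t
    using measurable_compose[OF measurable_Pair2'[OF that, of ?P] measurable_upd[OF u]]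
    unfolding v_def case_prod_conv .
  have u2: "(\<lambda>x. (u x)\<^sup>2) \<in> borel_measurable ?Q" using u by measurable
  have bu2: "\<bar>(u x)\<^sup>2\<bar> \<le> K\<^sup>2" if "x \<in> space ?Q" for x by (rule square_le_bound[OF b[OF that]])
  have IH: "(\<integral>x. (v t x)\<^sup>2 \<partial>?P) - (\<integral>x. v t x \<partial>?P)\<^sup>2 \<le> (\<Sum>j\<in>J. \<integral>x. coord_variance M j (v t) x \<partial>?P)"
    if "t \<in> space M" for t
    using that by (intro insert.IH mv) (auto simp: v_def bU)
  have cv: "coord_variance M j (v t) x = coord_variance M j u (x(i := t))" if "j \<in> J" for j t x
  proof -
    have "j \<noteq> i" using that insert.hyps by auto
    then show ?thesis by (simp add: coord_variance_def v_def fun_upd_twist)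
  qed
  have cvi: "coord_variance M i u (x(i := t)) = coord_variance M i u x" for x t
    by (simp add: coord_variance_def)
  have cm: "coord_variance M j u \<in> borel_measurable ?Q" 
    and cb: "x \<in> space ?Q \<Longrightarrow> \<bar>coord_variance M j u x\<bar> \<le> 2 * K\<^sup>2" if "j \<in> insert i J" for j x
    using coord_variance_measurable_bounded[OF that u b] by auto
  have im2: "integrable M (\<lambda>t. (\<integral>x. v t x \<partial>?P)\<^sup>2)"
  proof (rule integrable_bounded)
    have "(\<lambda>t. \<integral>x. v t x \<partial>?P) \<in> borel_measurable M"
      unfolding v_def by (rule borel_measurable_integrable[OF fubini_int[OF u b]])
    then show "(\<lambda>t. (\<integral>x. v t x \<partial>?P)\<^sup>2) \<in> borel_measurable M" by measurable
    show "\<bar>(\<integral>x. v t x \<partial>?P)\<^sup>2\<bar> \<le> K\<^sup>2" if "t \<in> space M" for t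
      using that by (intro square_le_bound P.abs_mean_le mv) (auto simp: v_def bU)
  qed
  have iv2: "integrable M (\<lambda>t. \<integral>x. (v t x)\<^sup>2 \<partial>?P)"
    unfolding v_def by (rule fubini_int[OF u2 bu2])
  have icv: "integrable M (\<lambda>t. \<integral>x. coord_variance M j (v t) x \<partial>?P)" if "j \<in> J" for j
    unfolding cv[OF that] by (rule fubini_int[OF cm cb]) (use that in auto)
  have "(\<integral>x. (u x)\<^sup>2 \<partial>?Q) = (\<integral>t. (\<integral>x. (v t x)\<^sup>2 \<partial>?P) \<partial>M)"
    unfolding v_def by (rule trans[OF fubini[OF u2 bu2] fubini'[OF u2 bu2]])
  then have "(\<integral>x. (u x)\<^sup>2 \<partial>?Q) - (\<integral>t. (\<integral>x. v t x \<partial>?P)\<^sup>2 \<partial>M)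
      = (\<integral>t. (\<integral>x. (v t x)\<^sup>2 \<partial>?P) - (\<integral>x. v t x \<partial>?P)\<^sup>2 \<partial>M)"
    using iv2 im2 by simp
  also have "\<dots> \<le> (\<integral>t. (\<Sum>j\<in>J. \<integral>x. coord_variance M j (v t) x \<partial>?P) \<partial>M)"
    by (intro integral_mono IH Bochner_Integration.integrable_sum Bochner_Integration.integrable_diff iv2 im2 icv)
  also have "\<dots> = (\<Sum>j\<in>J. \<integral>t. (\<integral>x. coord_variance M j (v t) x \<partial>?P) \<partial>M)"
    by (intro Bochner_Integration.integral_sum icv)
  also have "\<dots> = (\<Sum>j\<in>J. \<integral>x. coord_variance M j u x \<partial>?Q)"
  proof (rule sum.cong[OF refl])
    fix j assume j: "j \<in> J"
    then have ji: "j \<in> insert i J" by simp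
    show "(\<integral>t. (\<integral>x. coord_variance M j (v t) x \<partial>?P) \<partial>M) = (\<integral>x. coord_variance M j u x \<partial>?Q)"
      unfolding cv[OF j] by (rule trans[OF fubini[OF cm[OF ji] cb[OF ji]] fubini'[OF cm[OF ji] cb[OF ji]], symmetric])
  qed
  finally have 1: "(\<integral>x. (u x)\<^sup>2 \<partial>?Q) - (\<integral>t. (\<integral>x. v t x \<partial>?P)\<^sup>2 \<partial>M) \<le> (\<Sum>j\<in>J. \<integral>x. coord_variance M j u x \<partial>?Q)" .
  have "(\<integral>t. (\<integral>x. v t x \<partial>?P)\<^sup>2 \<partial>M) - (\<integral>t. (\<integral>x. v t x \<partial>?P) \<partial>M)\<^sup>2
      \<le> (\<integral>x. (\<integral>t. (v t x)\<^sup>2 \<partial>M) - (\<integral>t. v t x \<partial>M)\<^sup>2 \<partial>?P)"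
    unfolding v_def
    by (rule variance_of_mean_le[OF P.prob_space_axioms prob_space_axioms measurable_upd[OF u] bU]) auto
  also have "\<dots> = (\<integral>x. coord_variance M i u x \<partial>?P)"
    by (simp only: coord_variance_def v_def)
  also have "\<dots> = (\<integral>x. coord_variance M i u x \<partial>?Q)"
    using fubini[OF cm[OF insertI1] cb[OF insertI1]] by (simp add: cvi prob_space)
  also have "(\<integral>t. (\<integral>x. v t x \<partial>?P) \<partial>M) = (\<integral>x. u x \<partial>?Q)"
    unfolding v_def by (rule trans[OF fubini[OF u b] fubini'[OF u b], symmetric])
  finally have 2: "(\<integral>t. (\<integral>x. v t x \<partial>?P)\<^sup>2 \<partial>M) - (\<integral>x. u x \<partial>?Q)\<^sup>2 \<le> (\<integral>x. coord_variance M i u x \<partial>?Q)" .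
  show ?case using 1 2 insert.hyps by simp
qed

section \<open>Continuous periodic functions and the Poincare inequality\<close>

lemma Rd_upd [simp]: "x \<in> Rd d \<Longrightarrow> j < d \<Longrightarrow> x(j := t) \<in> Rd d"
  by (auto simp: Rd_def PiE_def extensional_def)

lemma C_torus_0_iff:
  "f \<in> C_torus d 0 \<longleftrightarrow> continuous_on (Rd d) f \<and> (\<forall>x\<in>Rd d. \<forall>j<d. f (x(j := x j + 2 * pi)) = f x)"
  by (simp add: C_torus_def)

lemma C_torus_0_comp:
  assumes f: "f \<in> C_torus d 0" and g: "continuous_on A g" and sub: "\<And>x. x \<in> Rd d \<Longrightarrow> f x \<in> A"
  shows "(\<lambda>x. g (f x)) \<in> C_torus d 0"
  using f continuous_on_compose2[OF g, of "Rd d" f] sub by (auto simp: C_torus_0_iff)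

lemma C_torus_0_const [simp, intro!]: "(\<lambda>x. c) \<in> C_torus d 0"
  by (simp add: C_torus_0_iff)

lemma C_torus_0_add: "f \<in> C_torus d 0 \<Longrightarrow> g \<in> C_torus d 0 \<Longrightarrow> (\<lambda>x. f x + g x) \<in> C_torus d 0"
  by (auto simp: C_torus_0_iff intro!: continuous_intros)

lemma C_torus_0_diff: "f \<in> C_torus d 0 \<Longrightarrow> g \<in> C_torus d 0 \<Longrightarrow> (\<lambda>x. f x - g x) \<in> C_torus d 0"
  by (auto simp: C_torus_0_iff intro!: continuous_intros)

lemma C_torus_0_minus: "f \<in> C_torus d 0 \<Longrightarrow> (\<lambda>x. - f x) \<in> C_torus d 0"
  by (auto simp: C_torus_0_iff intro!: continuous_intros)

lemma C_torus_0_mult: "f \<in> C_torus d 0 \<Longrightarrow> g \<in> C_torus d 0 \<Longrightarrow> (\<lambda>x. f x * g x) \<in> C_torus d 0"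
  by (auto simp: C_torus_0_iff intro!: continuous_intros)

lemma C_torus_0_power: "f \<in> C_torus d 0 \<Longrightarrow> (\<lambda>x. f x ^ n) \<in> C_torus d 0"
  by (auto simp: C_torus_0_iff intro!: continuous_intros)

lemma C_torus_0_divide:
  "f \<in> C_torus d 0 \<Longrightarrow> g \<in> C_torus d 0 \<Longrightarrow> (\<And>x. x \<in> Rd d \<Longrightarrow> g x \<noteq> 0) \<Longrightarrow> (\<lambda>x. f x / g x) \<in> C_torus d 0"
  by (auto simp: C_torus_0_iff intro!: continuous_intros)

lemma C_torus_0_abs: "f \<in> C_torus d 0 \<Longrightarrow> (\<lambda>x. \<bar>f x\<bar>) \<in> C_torus d 0"
  by (auto simp: C_torus_0_iff intro!: continuous_intros)

lemma C_torus_0_sqrt: "f \<in> C_torus d 0 \<Longrightarrow> (\<lambda>x. sqrt (f x)) \<in> C_torus d 0"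
  by (auto simp: C_torus_0_iff intro!: continuous_intros)

lemma C_torus_0_sum: "(\<And>i. i \<in> I \<Longrightarrow> f i \<in> C_torus d 0) \<Longrightarrow> (\<lambda>x. \<Sum>i\<in>I. f i x) \<in> C_torus d 0"
  by (auto simp: C_torus_0_iff intro!: continuous_intros)

lemma continuous_on_coordinate: "continuous_on A (\<lambda>x::nat \<Rightarrow> real. x i)"
  by (rule continuous_on_subset[OF continuous_on_product_coordinates]) simp

lemma C_torus_0_coordinate:
  fixes g :: "real \<Rightarrow> real"
  assumes "continuous_on UNIV g" "\<And>t. g (t + 2 * pi) = g t"
  shows "(\<lambda>x. g (x i)) \<in> C_torus d 0"
  using continuous_on_compose2[OF assms(1) continuous_on_coordinate] assms(2)
  by (auto simp: C_torus_0_iff)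

lemma weight_eq_cos: "weight d x = (\<Sum>j<d. (1 - cos (x j)) / 2)"
  unfolding weight_def
proof (intro sum.cong refl)
  fix j show "(sin (x j / 2))\<^sup>2 = (1 - cos (x j)) / 2"
    using cos_double_sin[of "x j / 2"] by simp
qed

lemma C_torus_0_weight: "weight d \<in> C_torus d 0"
proof -
  have "(\<lambda>x. \<Sum>j<d. (1 - cos (x j)) / 2) \<in> C_torus d 0"
    by (intro C_torus_0_sum C_torus_0_coordinate continuous_intros) auto
  then show ?thesis by (simp add: weight_eq_cos[abs_def])
qed

lemma periodic_int_shift:
  assumes per: "\<And>t. (g :: real \<Rightarrow> real) (t + 2 * pi) = g t"
  shows "g (t + 2 * pi * of_int n) = g t"
proof (induction n rule: int_induct[where k=0])
  case (step1 i)
  show ?case using per[of "t + 2 * pi * of_int i"] step1 by (simp add: algebra_simps)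
next
  case (step2 i)
  show ?case using per[of "t + 2 * pi * of_int (i - 1)"] step2 by (simp add: algebra_simps)
qed simp

lemma C_torus_0_slice:
  assumes f: "f \<in> C_torus d 0" and x: "x \<in> Rd d" and j: "j < d"
  shows "continuous_on UNIV (\<lambda>t. f (x(j := t)))" and "f (x(j := t + 2 * pi)) = f (x(j := t))"
proof -
  have c: "continuous_on UNIV (\<lambda>t::real. x(j := t))"
  proof (rule continuous_on_coordinatewise_then_product)
    fix i show "continuous_on UNIV (\<lambda>t. (x(j := t)) i)" by (cases "i = j") auto
  qed
  show "continuous_on UNIV (\<lambda>t. f (x(j := t)))"
    by (rule continuous_on_compose2[OF _ c, of "Rd d"]) (use f x j in \<open>auto simp: C_torus_0_iff\<close>)
  have "f ((x(j := t))(j := (x(j := t)) j + 2 * pi)) = f (x(j := t))"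
    using f x j Rd_upd[OF x j, of t] unfolding C_torus_0_iff by blast
  then show "f (x(j := t + 2 * pi)) = f (x(j := t))" by simp
qed

text \<open>
  Periodicity is assumed one coordinate at a time, hence the coordinates are moved into
  \<open>{-pi..pi}\<close> one after the other.
\<close>
lemma C_torus_0_reduce:
  assumes f: "f \<in> C_torus d 0" and x: "x \<in> Rd d"
  shows "\<exists>y\<in>Td d. f y = f x"
proof -
  have "\<exists>y\<in>Rd d. (\<forall>j<m. y j \<in> {-pi..pi}) \<and> f y = f x" if "m \<le> d" for m
    using that
  proof (induction m)
    case 0
    then show ?case using x by auto
  next
    case (Suc m)
    then obtain y where y: "y \<in> Rd d" "\<forall>j<m. y j \<in> {-pi..pi}" "f y = f x" by auto
    define n where "n = - \<lfloor>(y m + pi) / (2 * pi)\<rfloor>"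
    define s where "s = y m + 2 * pi * of_int n"
    have "of_int (- n) \<le> (y m + pi) / (2 * pi)" "(y m + pi) / (2 * pi) < of_int (- n) + 1"
      unfolding n_def by auto
    then have s: "s \<in> {-pi..pi}"
      by (auto simp: s_def field_simps)
    have "f (y(m := s)) = f (y(m := y m))"
      unfolding s_def using C_torus_0_slice(2)[OF f y(1)] Suc.prems
      by (intro periodic_int_shift[of "\<lambda>t. f (y(m := t))"]) auto
    then have "f (y(m := s)) = f x" using y(3) by simp
    moreover have "\<forall>j<Suc m. (y(m := s)) j \<in> {-pi..pi}"
      using y(2) s by (auto simp: less_Suc_eq)
    moreover have "y(m := s) \<in> Rd d" using y(1) Suc.prems by simp
    ultimately show ?case by blast
  qed
  from this[of d] obtain y where "y \<in> Rd d" "\<forall>j<d. y j \<in> {-pi..pi}" "f y = f x" by auto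
  then show ?thesis by (intro bexI[of _ y]) (auto simp: Td_def Rd_def PiE_def)
qed

lemma compact_Td: "compact (Td d)"
proof -
  have eq: "Td d = Pi\<^sub>E UNIV (\<lambda>j. if j < d then {-pi..pi} else {undefined})"
    unfolding Td_def PiE_def Pi_def extensional_def by (auto split: if_splits)
  have "compactin (product_topology (\<lambda>_. euclidean) UNIV) (Pi\<^sub>E UNIV (\<lambda>j::nat. if j < d then {-pi..pi::real} else {undefined}))"
    unfolding compactin_PiE by auto
  then show ?thesis
    unfolding eq euclidean_product_topology by simp
qed

lemma C_torus_0_bounded:
  assumes f: "f \<in> C_torus d 0"
  shows "\<exists>K. \<forall>x\<in>Rd d. \<bar>f x\<bar> \<le> K"
proof -
  have "Td d \<subseteq> Rd d" by (auto simp: Td_def Rd_def PiE_def)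
  then have "compact (f ` Td d)"
    using f by (intro compact_continuous_image compact_Td) (auto simp: C_torus_0_iff intro: continuous_on_subset)
  then obtain K where "\<And>z. z \<in> f ` Td d \<Longrightarrow> norm z \<le> K"
    by (meson bounded_iff compact_imp_bounded)
  then show ?thesis using C_torus_0_reduce[OF f] by (metis imageI real_norm_def)
qed

interpretation torus_d: prob_space "torus_measure d" for d
  by (rule prob_space_torus)

lemma C_torus_0_measurable: "f \<in> C_torus d 0 \<Longrightarrow> f \<in> borel_measurable (torus_measure d)"
  by (intro borel_measurable_torus) (simp add: C_torus_0_iff)

lemma C_torus_0_integrable:
  assumes "f \<in> C_torus d 0" shows "integrable (torus_measure d) f"
proof -
  obtain K where "\<And>x. x \<in> Rd d \<Longrightarrow> \<bar>f x\<bar> \<le> K" using C_torus_0_bounded[OF assms] by blast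
  then show ?thesis by (intro torus_d.integrable_bounded C_torus_0_measurable assms) auto
qed

lemma borel_measurable_circle:
  "continuous_on UNIV f \<Longrightarrow> f \<in> borel_measurable circle_measure"
  using borel_measurable_continuous_onI measurable_cong_sets[OF sets_circle refl] by blast

lemma torus_mean_const [simp]: "torus_mean d (\<lambda>x. c) = c"
  using torus_d.prob_space[of d] by (simp add: torus_mean_def)

lemma torus_mean_add:
  "f \<in> C_torus d 0 \<Longrightarrow> g \<in> C_torus d 0 \<Longrightarrow> torus_mean d (\<lambda>x. f x + g x) = torus_mean d f + torus_mean d g"
  unfolding torus_mean_def by (intro Bochner_Integration.integral_add C_torus_0_integrable)

lemma torus_mean_diff:
  "f \<in> C_torus d 0 \<Longrightarrow> g \<in> C_torus d 0 \<Longrightarrow> torus_mean d (\<lambda>x. f x - g x) = torus_mean d f - torus_mean d g"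
  unfolding torus_mean_def by (intro Bochner_Integration.integral_diff C_torus_0_integrable)

lemma torus_mean_minus: "torus_mean d (\<lambda>x. - f x) = - torus_mean d f"
  by (simp add: torus_mean_def)

lemma torus_mean_cmult: "torus_mean d (\<lambda>x. c * f x) = c * torus_mean d f"
  by (simp add: torus_mean_def)

lemma torus_mean_divide: "torus_mean d (\<lambda>x. f x / c) = torus_mean d f / c"
  by (simp add: torus_mean_def)

lemma torus_mean_sum:
  "(\<And>i. i \<in> I \<Longrightarrow> f i \<in> C_torus d 0) \<Longrightarrow> torus_mean d (\<lambda>x. \<Sum>i\<in>I. f i x) = (\<Sum>i\<in>I. torus_mean d (f i))"
  unfolding torus_mean_def by (intro Bochner_Integration.integral_sum C_torus_0_integrable)

lemma torus_mean_cong: "(\<And>x. x \<in> Rd d \<Longrightarrow> f x = g x) \<Longrightarrow> torus_mean d f = torus_mean d g"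
  unfolding torus_mean_def by (intro Bochner_Integration.integral_cong) auto

lemma torus_mean_mono:
  "f \<in> C_torus d 0 \<Longrightarrow> g \<in> C_torus d 0 \<Longrightarrow> (\<And>x. x \<in> Rd d \<Longrightarrow> f x \<le> g x) \<Longrightarrow> torus_mean d f \<le> torus_mean d g"
  unfolding torus_mean_def by (intro integral_mono C_torus_0_integrable) auto

lemma torus_mean_nonneg: "(\<And>x. x \<in> Rd d \<Longrightarrow> 0 \<le> f x) \<Longrightarrow> 0 \<le> torus_mean d f"
  unfolding torus_mean_def by (intro Bochner_Integration.integral_nonneg) auto

lemma torus_mean_Cauchy_Schwarz:
  assumes f: "f \<in> C_torus d 0" and g: "g \<in> C_torus d 0"
  shows "(torus_mean d (\<lambda>x. f x * g x))\<^sup>2 \<le> torus_mean d (\<lambda>x. (f x)\<^sup>2) * torus_mean d (\<lambda>x. (g x)\<^sup>2)"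
proof -
  define a b c where "a = torus_mean d (\<lambda>x. (f x)\<^sup>2)" and "b = torus_mean d (\<lambda>x. f x * g x)"
    and "c = torus_mean d (\<lambda>x. (g x)\<^sup>2)"
  have q: "0 \<le> s\<^sup>2 * a - 2 * s * t * b + t\<^sup>2 * c" for s t
  proof -
    have "0 \<le> torus_mean d (\<lambda>x. (s * f x - t * g x)\<^sup>2)" by (rule torus_mean_nonneg) simp
    also have "(\<lambda>x. (s * f x - t * g x)\<^sup>2) = (\<lambda>x. s\<^sup>2 * (f x)\<^sup>2 - (2 * s * t) * (f x * g x) + t\<^sup>2 * (g x)\<^sup>2)"
      by (simp add: fun_eq_iff power2_eq_square algebra_simps)
    also have "torus_mean d \<dots> = s\<^sup>2 * a - 2 * s * t * b + t\<^sup>2 * c"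
      using f g by (simp add: torus_mean_add torus_mean_diff torus_mean_cmult a_def b_def c_def
          C_torus_0_mult C_torus_0_diff C_torus_0_power)
    finally show ?thesis .
  qed
  have a0: "0 \<le> a" and c0: "0 \<le> c" unfolding a_def c_def by (auto intro: torus_mean_nonneg)
  show ?thesis
  proof (cases "c = 0")
    case True
    have "b = 0"
    proof (rule ccontr)
      assume b: "b \<noteq> 0"
      from q[of 1 "(a + 1) / (2 * b)"] True b show False by simp
    qed
    then show ?thesis using True by (simp add: b_def c_def)
  next
    case False
    have "0 \<le> c * (c * a - b\<^sup>2)"
      using q[of c b] by (simp add: power2_eq_square algebra_simps)
    then have "0 \<le> c * a - b\<^sup>2" using False c0 by (simp add: zero_le_mult_iff)
    then show ?thesis by (simp add: a_def b_def c_def mult.commute)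
  qed
qed

text \<open>
  Averaging over one coordinate beforehand does not change the mean.  This reduces integration by
  parts and the Poincare inequality to statements on the circle.
\<close>
lemma torus_mean_resample:
  assumes f: "f \<in> C_torus d 0" and j: "j < d"
  shows "torus_mean d f = torus_mean d (\<lambda>x. \<integral>s. f (x(j := s)) \<partial>circle_measure)"
proof -
  obtain K where K: "\<And>x. x \<in> Rd d \<Longrightarrow> \<bar>f x\<bar> \<le> K" using C_torus_0_bounded[OF f] by blast
  let ?I = "{..<d} - {j}"
  have ins: "insert j ?I = {..<d}" using j by auto
  have mf: "f \<in> borel_measurable (Pi\<^sub>M (insert j {..<d}) (\<lambda>_. circle_measure))"
    using C_torus_0_measurable[OF f] j by (simp add: torus_measure_def insert_absorb)
  define g where "g = (\<lambda>x. \<integral>s. f (x(j := s)) \<partial>circle_measure)"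
  have mg: "g \<in> borel_measurable (torus_measure d)"
    using circle.borel_measurable_lebesgue_integral[OF measurable_upd[OF mf]]
    by (simp add: g_def torus_measure_def)
  have ig: "integrable (torus_measure d) g"
  proof (rule torus_d.integrable_bounded[OF mg])
    fix x assume "x \<in> space (torus_measure d)"
    then have x: "x \<in> Rd d" by simp
    show "\<bar>g x\<bar> \<le> K" unfolding g_def
      by (rule circle.abs_mean_le)
        (rule borel_measurable_circle[OF C_torus_0_slice(1)[OF f x j]], rule K[OF Rd_upd[OF x j]])
  qed
  have eq: "integral\<^sup>L (torus_measure d) h = (\<integral>x. (\<integral>s. h (x(j := s)) \<partial>circle_measure) \<partial>Pi\<^sub>M ?I (\<lambda>_. circle_measure))"
    if "integrable (torus_measure d) h" for h :: "_ \<Rightarrow> real"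
    using torus.product_integral_insert[of ?I j h] that by (simp add: ins torus_measure_def insert_absorb j)
  have "torus_mean d g = (\<integral>x. (\<integral>s. g (x(j := s)) \<partial>circle_measure) \<partial>Pi\<^sub>M ?I (\<lambda>_. circle_measure))"
    unfolding torus_mean_def by (rule eq[OF ig])
  also have "\<dots> = (\<integral>x. (\<integral>s. f (x(j := s)) \<partial>circle_measure) \<partial>Pi\<^sub>M ?I (\<lambda>_. circle_measure))"
    using circle.prob_space by (simp add: g_def)
  also have "\<dots> = torus_mean d f"
    unfolding torus_mean_def by (rule eq[OF C_torus_0_integrable[OF f], symmetric])
  finally show ?thesis by (simp add: g_def)
qed

text \<open>
  The partial derivatives \<open>f' j\<close> are an argument rather than \<open>pderiv_at j f\<close>, so that the
  derivatives of compound expressions are available in explicit form.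
\<close>
definition torus_diff :: "nat \<Rightarrow> ((nat \<Rightarrow> real) \<Rightarrow> real) \<Rightarrow> (nat \<Rightarrow> (nat \<Rightarrow> real) \<Rightarrow> real) \<Rightarrow> bool" where
  "torus_diff d f f' \<longleftrightarrow> f \<in> C_torus d 0 \<and> (\<forall>j<d. f' j \<in> C_torus d 0 \<and>
     (\<forall>x\<in>Rd d. ((\<lambda>t. f (x(j := t))) has_real_derivative f' j x) (at (x j))))"

lemma torus_diff_C0: "torus_diff d f f' \<Longrightarrow> f \<in> C_torus d 0"
  and torus_diff_C0': "torus_diff d f f' \<Longrightarrow> j < d \<Longrightarrow> f' j \<in> C_torus d 0"
  by (auto simp: torus_diff_def)

lemma torus_diff_slice:
  assumes "torus_diff d f f'" "x \<in> Rd d" "j < d"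
  shows "((\<lambda>t. f (x(j := t))) has_real_derivative f' j (x(j := s))) (at s)"
proof -
  have "((\<lambda>t. f ((x(j := s))(j := t))) has_real_derivative f' j (x(j := s))) (at ((x(j := s)) j))"
    using assms Rd_upd[OF assms(2,3), of s] unfolding torus_diff_def by blast
  then show ?thesis by simp
qed

text \<open>
  Integration by parts on the torus, applied below to products: there are no boundary terms.
\<close>
lemma torus_mean_derivative:
  assumes f: "torus_diff d f f'" and j: "j < d"
  shows "torus_mean d (f' j) = 0"
proof -
  have "torus_mean d (f' j) = torus_mean d (\<lambda>x. \<integral>s. f' j (x(j := s)) \<partial>circle_measure)"
    by (rule torus_mean_resample[OF torus_diff_C0'[OF f j] j])
  also have "\<dots> = torus_mean d (\<lambda>x. 0)"
  proof (rule torus_mean_cong)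
    fix x assume x: "x \<in> Rd d"
    have "((\<lambda>s. f' j (x(j := s))) has_integral f (x(j := pi)) - f (x(j := -pi))) {-pi..pi}"
    proof (rule fundamental_theorem_of_calculus)
      fix s show "((\<lambda>s. f (x(j := s))) has_vector_derivative f' j (x(j := s))) (at s within {-pi..pi})"
        using has_field_derivative_at_within[OF torus_diff_slice[OF f x j, of s]]
        by (simp add: has_real_derivative_iff_has_vector_derivative)
    qed auto
    moreover have "f (x(j := pi)) = f (x(j := -pi))"
      using C_torus_0_slice(2)[OF torus_diff_C0[OF f] x j, of "-pi"] by simp
    ultimately show "(\<integral>s. f' j (x(j := s)) \<partial>circle_measure) = 0"
      using C_torus_0_slice(1)[OF torus_diff_C0'[OF f j] x j]
      by (simp add: circle_integral integral_unique)
  qed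
  finally show ?thesis by simp
qed

text \<open>
  Variance is subadditive over the coordinates, and the variance in each coordinate is bounded
  by Wirtinger's inequality.  The constant \<open>1\<close> does not depend on the dimension; it is the source of
  the sharp constant of the theorem.
\<close>
proposition torus_poincare:
  assumes f: "torus_diff d f f'"
  shows "torus_mean d (\<lambda>x. (f x)\<^sup>2) - (torus_mean d f)\<^sup>2 \<le> (\<Sum>j<d. torus_mean d (\<lambda>x. (f' j x)\<^sup>2))"
proof -
  note f0 = torus_diff_C0[OF f]
  obtain K where K: "\<And>x. x \<in> Rd d \<Longrightarrow> \<bar>f x\<bar> \<le> K" using C_torus_0_bounded[OF f0] by blast
  have sp: "space (Pi\<^sub>M {..<d} (\<lambda>_. circle_measure)) = Rd d"
    using space_torus by (simp add: torus_measure_def)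
  have mf: "f \<in> borel_measurable (Pi\<^sub>M {..<d} (\<lambda>_. circle_measure))"
    using C_torus_0_measurable[OF f0] by (simp add: torus_measure_def)
  have "torus_mean d (\<lambda>x. (f x)\<^sup>2) - (torus_mean d f)\<^sup>2 \<le> (\<Sum>j<d. torus_mean d (coord_variance circle_measure j f))"
    using circle.efron_stein[OF _ mf, of K] K
    by (simp add: torus_mean_def torus_measure_def sp)
  also have "\<dots> \<le> (\<Sum>j<d. torus_mean d (\<lambda>x. (f' j x)\<^sup>2))"
  proof (rule sum_mono)
    fix j assume "j \<in> {..<d}"
    then have j: "j < d" by simp
    note fj = torus_diff_C0'[OF f j]
    obtain L where L: "\<And>x. x \<in> Rd d \<Longrightarrow> \<bar>(f' j x)\<^sup>2\<bar> \<le> L"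
      using C_torus_0_bounded[OF C_torus_0_power[OF fj, of 2]] by blast
    have m: "(\<lambda>x. (f' j x)\<^sup>2) \<in> borel_measurable (Pi\<^sub>M (insert j {..<d}) (\<lambda>_. circle_measure))"
      using C_torus_0_measurable[OF C_torus_0_power[OF fj]] j by (simp add: torus_measure_def insert_absorb)
    have "torus_mean d (coord_variance circle_measure j f) 
        \<le> torus_mean d (\<lambda>x. \<integral>s. (f' j (x(j := s)))\<^sup>2 \<partial>circle_measure)"
      unfolding torus_mean_def
    proof (rule integral_mono)
      show "integrable (torus_measure d) (coord_variance circle_measure j f)"
        using circle.coord_variance_measurable_bounded[OF _ mf, of j K] j K
        by (intro torus_d.integrable_bounded[where K="2 * K\<^sup>2"]) (auto simp: torus_measure_def sp)
      show "integrable (torus_measure d) (\<lambda>x. \<integral>s. (f' j (x(j := s)))\<^sup>2 \<partial>circle_measure)"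
      proof (rule torus_d.integrable_bounded)
        show "(\<lambda>x. \<integral>s. (f' j (x(j := s)))\<^sup>2 \<partial>circle_measure) \<in> borel_measurable (torus_measure d)"
          using circle.borel_measurable_lebesgue_integral[OF measurable_upd[OF m]]
          by (simp add: torus_measure_def)
        fix x assume "x \<in> space (torus_measure d)"
        then have x: "x \<in> Rd d" by simp
        show "\<bar>\<integral>s. (f' j (x(j := s)))\<^sup>2 \<partial>circle_measure\<bar> \<le> L"
          by (rule circle.abs_mean_le)
            (rule borel_measurable_circle[OF C_torus_0_slice(1)[OF C_torus_0_power[OF fj] x j]],
              rule L[OF Rd_upd[OF x j]])
      qed
      fix x assume "x \<in> space (torus_measure d)"
      then have x: "x \<in> Rd d" by simp
      show "coord_variance circle_measure j f x \<le> (\<integral>s. (f' j (x(j := s)))\<^sup>2 \<partial>circle_measure)"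
        unfolding coord_variance_def
        by (rule wirtinger_periodic[OF torus_diff_slice[OF f x j] C_torus_0_slice(1)[OF fj x j]
              C_torus_0_slice(2)[OF f0 x j] C_torus_0_slice(2)[OF fj x j]])
    qed
    also have "\<dots> = torus_mean d (\<lambda>x. (f' j x)\<^sup>2)"
      by (rule torus_mean_resample[OF C_torus_0_power[OF fj] j, symmetric])
    finally show "torus_mean d (coord_variance circle_measure j f) \<le> torus_mean d (\<lambda>x. (f' j x)\<^sup>2)" .
  qed
  finally show ?thesis .
qed

section \<open>Calculus of differentiable periodic functions\<close>

lemma C_torus_0_cong:
  assumes "\<And>x. x \<in> Rd d \<Longrightarrow> f x = g x"
  shows "f \<in> C_torus d 0 \<longleftrightarrow> g \<in> C_torus d 0"
proof -
  have "continuous_on (Rd d) f \<longleftrightarrow> continuous_on (Rd d) g"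
    using assms by (intro continuous_on_cong) auto
  moreover have "(\<forall>x\<in>Rd d. \<forall>j<d. f (x(j := x j + 2 * pi)) = f x) \<longleftrightarrow> (\<forall>x\<in>Rd d. \<forall>j<d. g (x(j := x j + 2 * pi)) = g x)"
    using assms Rd_upd by metis
  ultimately show ?thesis by (simp add: C_torus_0_iff)
qed

lemma torus_diff_const: "torus_diff d (\<lambda>x. c) (\<lambda>j x. 0)"
  by (simp add: torus_diff_def)

lemma torus_diff_add:
  assumes "torus_diff d f f'" "torus_diff d g g'"
  shows "torus_diff d (\<lambda>x. f x + g x) (\<lambda>j x. f' j x + g' j x)"
  using assms unfolding torus_diff_def by (auto intro!: C_torus_0_add DERIV_add)

lemma torus_diff_mult:
  assumes "torus_diff d f f'" "torus_diff d g g'"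
  shows "torus_diff d (\<lambda>x. f x * g x) (\<lambda>j x. f' j x * g x + f x * g' j x)"
  unfolding torus_diff_def
proof (intro conjI allI impI ballI)
  show "(\<lambda>x. f x * g x) \<in> C_torus d 0"
    using assms by (intro C_torus_0_mult torus_diff_C0)
  fix j assume j: "j < d"
  show "(\<lambda>x. f' j x * g x + f x * g' j x) \<in> C_torus d 0"
    using assms j by (intro C_torus_0_add C_torus_0_mult torus_diff_C0[OF assms(1)] torus_diff_C0[OF assms(2)]
        torus_diff_C0'[OF assms(1)] torus_diff_C0'[OF assms(2)])
  fix x assume x: "x \<in> Rd d"
  have "((\<lambda>t. f (x(j := t))) has_real_derivative f' j x) (at (x j))"
    and "((\<lambda>t. g (x(j := t))) has_real_derivative g' j x) (at (x j))"
    using assms x j by (auto simp: torus_diff_def)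
  from DERIV_mult[OF this]
  show "((\<lambda>t. f (x(j := t)) * g (x(j := t))) has_real_derivative f' j x * g x + f x * g' j x) (at (x j))"
    by (simp add: mult.commute)
qed

lemma torus_diff_cong:
  assumes "torus_diff d f f'" "\<And>x. x \<in> Rd d \<Longrightarrow> f x = g x" "\<And>j x. j < d \<Longrightarrow> x \<in> Rd d \<Longrightarrow> f' j x = g' j x"
  shows "torus_diff d g g'"
  unfolding torus_diff_def
proof (intro conjI allI impI ballI)
  show "g \<in> C_torus d 0"
    using torus_diff_C0[OF assms(1)] C_torus_0_cong[of d f g] assms(2) by auto
  fix j assume j: "j < d"
  show "g' j \<in> C_torus d 0"
    using torus_diff_C0'[OF assms(1) j] C_torus_0_cong[of d "f' j" "g' j"] assms(3)[OF j] by auto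
  fix x assume x: "x \<in> Rd d"
  show "((\<lambda>t. g (x(j := t))) has_real_derivative g' j x) (at (x j))"
    using assms x j by (auto simp: torus_diff_def)
qed

lemma torus_diff_sum:
  assumes "finite I" "\<And>i. i \<in> I \<Longrightarrow> torus_diff d (f i) (f' i)"
  shows "torus_diff d (\<lambda>x. \<Sum>i\<in>I. f i x) (\<lambda>j x. \<Sum>i\<in>I. f' i j x)"
  using assms
proof (induction I rule: finite_induct)
  case empty
  then show ?case by (simp add: torus_diff_const)
next
  case (insert i I)
  then show ?case using torus_diff_add[of d "f i" "f' i" "\<lambda>x. \<Sum>i\<in>I. f i x" "\<lambda>j x. \<Sum>i\<in>I. f' i j x"] by simp
qed

lemma torus_diff_comp:
  assumes f: "torus_diff d f f'"
    and g: "\<And>x. x \<in> Rd d \<Longrightarrow> (g has_real_derivative g' (f x)) (at (f x))"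
    and g': "(\<lambda>x. g' (f x)) \<in> C_torus d 0"
  shows "torus_diff d (\<lambda>x. g (f x)) (\<lambda>j x. g' (f x) * f' j x)"
  unfolding torus_diff_def
proof (intro conjI allI impI ballI)
  have "continuous_on (f ` Rd d) g"
  proof (rule continuous_at_imp_continuous_on, rule ballI)
    fix y assume "y \<in> f ` Rd d"
    then show "isCont g y" using g DERIV_isCont by blast
  qed
  then show "(\<lambda>x. g (f x)) \<in> C_torus d 0"
    by (rule C_torus_0_comp[OF torus_diff_C0[OF f]]) auto
  fix j assume j: "j < d"
  show "(\<lambda>x. g' (f x) * f' j x) \<in> C_torus d 0"
    by (intro C_torus_0_mult g' torus_diff_C0'[OF f j])
  fix x assume x: "x \<in> Rd d"
  have "((\<lambda>t. f (x(j := t))) has_real_derivative f' j x) (at (x j))"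
    using f x j by (auto simp: torus_diff_def)
  from DERIV_chain2[OF _ this, of g "g' (f x)"] g[OF x]
  show "((\<lambda>t. g (f (x(j := t)))) has_real_derivative g' (f x) * f' j x) (at (x j))"
    by simp
qed

lemma torus_diff_coordinate:
  assumes g: "\<And>t. (g has_real_derivative g' t) (at t)" and c: "continuous_on UNIV g'"
    and per: "\<And>t. g (t + 2 * pi) = g t" "\<And>t. g' (t + 2 * pi) = g' t"
  shows "torus_diff d (\<lambda>x. g (x i)) (\<lambda>j x. if j = i then g' (x i) else 0)"
  unfolding torus_diff_def
proof (intro conjI allI impI ballI)
  have "continuous_on UNIV g"
    by (rule DERIV_continuous_on) (rule has_field_derivative_at_within[OF g])
  then show "(\<lambda>x. g (x i)) \<in> C_torus d 0" using per by (intro C_torus_0_coordinate)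
  fix j assume j: "j < d"
  show "(\<lambda>x. if j = i then g' (x i) else 0) \<in> C_torus d 0"
    by (cases "j = i") (simp_all add: C_torus_0_coordinate c per)
  fix x assume x: "x \<in> Rd d"
  show "((\<lambda>t. g ((x(j := t)) i)) has_real_derivative (if j = i then g' (x i) else 0)) (at (x j))"
    using g[of "x i"] by (cases "j = i") simp_all
qed

lemma torus_diff_weight: "torus_diff d (\<lambda>x. weight d x + \<delta>) (\<lambda>j x. sin (x j) / 2)"
proof -
  have 1: "torus_diff d (\<lambda>x. (1 - cos (x i)) / 2) (\<lambda>j x. if j = i then sin (x i) / 2 else 0)" for i
    by (rule torus_diff_coordinate[where g="\<lambda>t. (1 - cos t) / 2" and g'="\<lambda>t. sin t / 2"])
       (auto intro!: derivative_eq_intros continuous_intros)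
  have eq: "(\<Sum>i<d. if j = i then sin (x i) / 2 else 0) = sin (x j) / 2" if "j < d" for j and x :: "nat \<Rightarrow> real"
    by (subst sum.delta') (use that in auto)
  show ?thesis
  proof (rule torus_diff_cong[OF torus_diff_add[OF torus_diff_sum[of "{..<d}", OF _ 1] torus_diff_const[of d \<delta>]]])
    fix j and x :: "nat \<Rightarrow> real" assume "j < d"
    from eq[OF this, of x]
    show "(\<Sum>i<d. if j = i then sin (x i) / 2 else 0) + 0 = sin (x j) / 2"
      unfolding add_0_right .
  qed (simp_all add: weight_eq_cos)
qed

lemma weight_nonneg [simp]: "0 \<le> weight d x"
  by (simp add: weight_def sum_nonneg)

lemma weight_le: "weight d x \<le> real d"
proof -
  have "weight d x \<le> (\<Sum>j<d. 1)"
    unfolding weight_def by (intro sum_mono) (simp add: abs_square_le_1)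
  then show ?thesis by simp
qed

lemma grad_weight_sq_le: "(\<Sum>j<d. (sin (x j) / 2)\<^sup>2) \<le> weight d x"
  unfolding weight_def
proof (rule sum_mono)
  fix j
  have "(sin (x j) / 2)\<^sup>2 = (sin (x j / 2))\<^sup>2 * (cos (x j / 2))\<^sup>2"
    using sin_double[of "x j / 2"] by (simp add: power_mult_distrib)
  also have "\<dots> \<le> (sin (x j / 2))\<^sup>2 * 1"
    by (intro mult_left_mono) (auto simp: abs_square_le_1)
  finally show "(sin (x j) / 2)\<^sup>2 \<le> (sin (x j / 2))\<^sup>2" by simp
qed

lemma C_torus_0_sin: "(\<lambda>x. sin (x j)) \<in> C_torus d 0"
  by (rule C_torus_0_coordinate) (auto intro: continuous_intros)

text \<open>
  The gradient of the weight has the components \<open>sin x\<^sub>j / 2\<close> and its Laplacian is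
  \<open>\<Sum>j. cos x\<^sub>j / 2 = d / 2 - \<omega>\<close>; the formula is the divergence theorem for \<open>F \<nabla>\<omega>\<close>.
\<close>
lemma weight_divergence_formula:
  assumes F: "torus_diff d F F'"
  shows "torus_mean d (\<lambda>x. F x * (real d / 2 - weight d x)) = - torus_mean d (\<lambda>x. \<Sum>j<d. F' j x * (sin (x j) / 2))"
proof -
  have s: "torus_diff d (\<lambda>x. sin (x j) / 2) (\<lambda>i x. if i = j then cos (x j) / 2 else 0)" for j
    by (rule torus_diff_coordinate[where g="\<lambda>t. sin t / 2" and g'="\<lambda>t. cos t / 2"])
       (auto intro!: derivative_eq_intros continuous_intros)
  have c1: "(\<lambda>x. F' j x * (sin (x j) / 2)) \<in> C_torus d 0" if "j < d" for j
    using that torus_diff_C0[OF s] by (intro C_torus_0_mult torus_diff_C0'[OF F])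
  have c2: "(\<lambda>x. F x * (cos (x j) / 2)) \<in> C_torus d 0" if "j < d" for j
    using torus_diff_C0'[OF s[of j], of j] that by (intro C_torus_0_mult torus_diff_C0[OF F]) simp
  have "torus_mean d (\<lambda>x. F x * (cos (x j) / 2)) = - torus_mean d (\<lambda>x. F' j x * (sin (x j) / 2))" if j: "j < d" for j
    using torus_mean_derivative[OF torus_diff_mult[OF F s[of j]] j] torus_mean_add[OF c1[OF j] c2[OF j]] by simp
  then have "(\<Sum>j<d. torus_mean d (\<lambda>x. F x * (cos (x j) / 2))) = - (\<Sum>j<d. torus_mean d (\<lambda>x. F' j x * (sin (x j) / 2)))"
    by (simp add: sum_negf)
  then have "torus_mean d (\<lambda>x. \<Sum>j<d. F x * (cos (x j) / 2)) = - torus_mean d (\<lambda>x. \<Sum>j<d. F' j x * (sin (x j) / 2))"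
    using c1 c2 by (subst (1 2) torus_mean_sum) auto
  also have "(\<lambda>x. \<Sum>j<d. F x * (cos (x j) / 2)) = (\<lambda>x. F x * (real d / 2 - weight d x))"
    by (simp add: weight_eq_cos sum_distrib_left[symmetric] diff_divide_distrib sum_subtractf sum_divide_distrib[symmetric] fun_eq_iff)
  finally show ?thesis .
qed

lemma C_k_cong:
  assumes "\<And>x. x \<in> Rd d \<Longrightarrow> f x = g x" "C_k d k f"
  shows "C_k d k g"
  using assms
proof (induction k arbitrary: f g)
  case 0
  then show ?case using continuous_on_cong[of "Rd d" "Rd d" f g] by simp
next
  case (Suc k)
  have c: "continuous_on (Rd d) g"
    using Suc.prems continuous_on_cong[of "Rd d" "Rd d" f g] by simp
  have sl: "(\<lambda>t. f (x(j := t))) = (\<lambda>t. g (x(j := t)))" if "x \<in> Rd d" "j < d" for x j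
    by (intro ext Suc.prems(1) Rd_upd that)
  have "C_k d k (pderiv_at j g)" if j: "j < d" for j
  proof (rule Suc.IH)
    show "pderiv_at j f x = pderiv_at j g x" if "x \<in> Rd d" for x
      unfolding pderiv_at_def sl[OF that j] ..
    show "C_k d k (pderiv_at j f)" using Suc.prems j by simp
  qed
  moreover have "(\<lambda>t. g (x(j := t))) differentiable (at (x j))" if "x \<in> Rd d" "j < d" for x j
    using Suc.prems(2) that sl[OF that] by simp metis
  ultimately show ?case using c by simp
qed

lemma C_k_SucD: "C_k d (Suc k) f \<Longrightarrow> C_k d k f"
  by (induction k arbitrary: f) auto

lemma has_derivative_pderiv_at:
  assumes "C_k d (Suc k) f" "x \<in> Rd d" "j < d"
  shows "((\<lambda>t. f (x(j := t))) has_real_derivative pderiv_at j f x) (at (x j))"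
  unfolding pderiv_at_def using assms
  by (simp add: DERIV_deriv_iff_real_differentiable)

lemma C_k_lincomb: "C_k d k f \<Longrightarrow> C_k d k g \<Longrightarrow> C_k d k (\<lambda>x. a * f x + b * g x)"
proof (induction k arbitrary: f g)
  case 0
  then show ?case by (auto intro!: continuous_intros)
next
  case (Suc k)
  have D: "((\<lambda>t. a * f (x(j := t)) + b * g (x(j := t))) has_real_derivative
      a * pderiv_at j f x + b * pderiv_at j g x) (at (x j))" if "x \<in> Rd d" "j < d" for x j
    using Suc.prems that by (intro DERIV_add DERIV_cmult has_derivative_pderiv_at)
  have "C_k d k (pderiv_at j (\<lambda>x. a * f x + b * g x))" if j: "j < d" for j
  proof (rule C_k_cong)
    show "C_k d k (\<lambda>x. a * pderiv_at j f x + b * pderiv_at j g x)"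
      using Suc.prems j by (intro Suc.IH) auto
    show "a * pderiv_at j f x + b * pderiv_at j g x = pderiv_at j (\<lambda>x. a * f x + b * g x) x" if "x \<in> Rd d" for x
      unfolding pderiv_at_def[of j "\<lambda>x. a * f x + b * g x"] using DERIV_imp_deriv[OF D[OF that j]] by simp
  qed
  moreover have "continuous_on (Rd d) (\<lambda>x. a * f x + b * g x)"
    using Suc.prems by (auto intro!: continuous_intros)
  moreover have "(\<lambda>t. a * f (x(j := t)) + b * g (x(j := t))) differentiable (at (x j))" if "x \<in> Rd d" "j < d" for x j
    using D[OF that] real_differentiable_def by blast
  ultimately show ?case by simp
qed

lemma C_k_const: "C_k d k (\<lambda>x. c)"
proof (induction k arbitrary: c)
  case (Suc k)
  have "pderiv_at j (\<lambda>x. c) = (\<lambda>x. 0)" for j by (simp add: pderiv_at_def fun_eq_iff)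
  then show ?case using Suc by simp
qed simp

lemma C_k_sum: "finite I \<Longrightarrow> (\<And>i. i \<in> I \<Longrightarrow> C_k d k (f i)) \<Longrightarrow> C_k d k (\<lambda>x. \<Sum>i\<in>I. f i x)"
proof (induction I rule: finite_induct)
  case empty
  then show ?case by (simp add: C_k_const)
next
  case (insert i I)
  then show ?case using C_k_lincomb[of d k "f i" "\<lambda>x. \<Sum>i\<in>I. f i x" 1 1] by simp
qed

text \<open>
  The periodicity in the direction of differentiation itself follows from the uniqueness of the
  derivative of a shifted function.
\<close>
lemma C_torus_pderiv:
  assumes f: "f \<in> C_torus d (Suc k)" and j: "j < d"
  shows "pderiv_at j f \<in> C_torus d k"
proof -
  have C: "C_k d (Suc k) f" and per: "\<And>x i. x \<in> Rd d \<Longrightarrow> i < d \<Longrightarrow> f (x(i := x i + 2 * pi)) = f x"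
    using f by (auto simp: C_torus_def)
  have "pderiv_at j f (x(i := x i + 2 * pi)) = pderiv_at j f x" if x: "x \<in> Rd d" and i: "i < d" for x i
  proof (cases "i = j")
    case False
    have "f (x(i := x i + 2 * pi, j := t)) = f (x(j := t))" for t
      using per[OF Rd_upd[OF x j] i, of t] False by (simp add: fun_upd_twist)
    then show ?thesis using False by (simp add: pderiv_at_def)
  next
    case True
    have eq: "f (x(j := t + 2 * pi)) = f (x(j := t))" for t
      using per[OF Rd_upd[OF x j] j, of t] by simp
    let ?y = "x(j := x j + 2 * pi)"
    have "((\<lambda>t. f (?y(j := t))) has_real_derivative pderiv_at j f ?y) (at (?y j))"
      by (rule has_derivative_pderiv_at[OF C Rd_upd[OF x j] j])
    then have "((\<lambda>t. f (x(j := t))) has_real_derivative pderiv_at j f ?y) (at (x j + 2 * pi))"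
      by simp
    then have "((\<lambda>t. f (x(j := t + 2 * pi))) has_real_derivative pderiv_at j f ?y) (at (x j))"
      by (simp add: DERIV_shift)
    then have "((\<lambda>t. f (x(j := t))) has_real_derivative pderiv_at j f ?y) (at (x j))"
      by (simp only: eq)
    from DERIV_unique[OF this has_derivative_pderiv_at[OF C x j]] True show ?thesis by simp
  qed
  then show ?thesis using C j by (simp add: C_torus_def)
qed

lemma C_torus_SucD: "f \<in> C_torus d (Suc k) \<Longrightarrow> f \<in> C_torus d k"
  using C_k_SucD by (auto simp: C_torus_def)

lemma C_torus_mono:
  assumes "f \<in> C_torus d k" "m \<le> k" shows "f \<in> C_torus d m"
  using assms(2,1) by (induction k rule: dec_induct) (auto dest: C_torus_SucD)

lemma C_torus_torus_diff:
  assumes f: "f \<in> C_torus d (Suc k)"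
  shows "torus_diff d f (\<lambda>j. pderiv_at j f)"
  unfolding torus_diff_def
proof (intro conjI allI impI ballI)
  show "f \<in> C_torus d 0" by (rule C_torus_mono[OF f]) simp
  fix j assume j: "j < d"
  show "pderiv_at j f \<in> C_torus d 0" by (rule C_torus_mono[OF C_torus_pderiv[OF f j]]) simp
  fix x assume x: "x \<in> Rd d"
  show "((\<lambda>t. f (x(j := t))) has_real_derivative pderiv_at j f x) (at (x j))"
    using f by (intro has_derivative_pderiv_at[OF _ x j]) (auto simp: C_torus_def)
qed

lemma C_torus_laplacian:
  assumes f: "f \<in> C_torus d (Suc (Suc k))"
  shows "laplacian d f \<in> C_torus d k"
proof -
  have m: "pderiv_at j (pderiv_at j f) \<in> C_torus d k" if "j < d" for j
    by (intro C_torus_pderiv f that)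
  have "C_k d k (\<lambda>x. \<Sum>j<d. pderiv_at j (pderiv_at j f) x)"
    using m by (intro C_k_sum) (auto simp: C_torus_def)
  then show ?thesis using m by (simp add: C_torus_def laplacian_def[abs_def])
qed

lemma torus_mean_laplacian:
  assumes f: "f \<in> C_torus d (Suc (Suc k))"
  shows "torus_mean d (laplacian d f) = 0"
proof -
  have td: "torus_diff d (pderiv_at j f) (\<lambda>i. pderiv_at i (pderiv_at j f))" if "j < d" for j
    by (rule C_torus_torus_diff[OF C_torus_pderiv[OF f that]])
  have "torus_mean d (laplacian d f) = (\<Sum>j<d. torus_mean d (pderiv_at j (pderiv_at j f)))"
    unfolding laplacian_def[abs_def] by (intro torus_mean_sum torus_diff_C0'[OF td]) auto
  also have "\<dots> = 0"
    by (intro sum.neutral ballI torus_mean_derivative[OF td]) auto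
  finally show ?thesis .
qed

section \<open>Concentration of the weight\<close>

lemmas C0_intros = C_torus_0_add C_torus_0_diff C_torus_0_minus C_torus_0_mult C_torus_0_power
  C_torus_0_sum C_torus_0_weight C_torus_0_sin C_torus_0_const C_torus_0_abs

lemma shifted_weight_pos: "0 < \<delta> \<Longrightarrow> 0 < weight d x + \<delta>"
  using weight_nonneg[of d x] by linarith

lemma sin_half_C0: "(\<lambda>x. sin (x j) / 2) \<in> C_torus d 0"
  using C_torus_0_mult[OF C_torus_0_const[of "1/2"] C_torus_0_sin] by simp

lemma torus_diff_fun_weight:
  assumes "0 < \<delta>" and g: "\<And>t. t > 0 \<Longrightarrow> (g has_real_derivative g' t) (at t)"
    and c: "continuous_on {0<..} g'"
  shows "torus_diff d (\<lambda>x. g (weight d x + \<delta>)) (\<lambda>j x. g' (weight d x + \<delta>) * (sin (x j) / 2))"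
  using shifted_weight_pos[OF assms(1)]
  by (intro torus_diff_comp[OF torus_diff_weight] g C_torus_0_comp[OF _ c] C0_intros) auto

lemma weight_fun_divergence:
  assumes "0 < \<delta>" and g: "\<And>t. t > 0 \<Longrightarrow> (g has_real_derivative g' t) (at t)"
    and c: "continuous_on {0<..} g'"
  shows "torus_mean d (\<lambda>x. g (weight d x + \<delta>) * (real d / 2 - weight d x)) =
     - torus_mean d (\<lambda>x. g' (weight d x + \<delta>) * (\<Sum>j<d. (sin (x j) / 2)\<^sup>2))"
proof -
  have td: "torus_diff d (\<lambda>x. g (weight d x + \<delta>)) (\<lambda>j x. g' (weight d x + \<delta>) * (sin (x j) / 2))"
    by (rule torus_diff_fun_weight[OF assms])
  show ?thesis
    unfolding weight_divergence_formula[OF td]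
    by (simp only: sum_distrib_left power2_eq_square mult.assoc)
qed

lemma torus_mean_weight: "torus_mean d (weight d) = real d / 2"
proof -
  have "torus_mean d (\<lambda>x. 1 * (real d / 2 - weight d x)) = - torus_mean d (\<lambda>x. 0 * (\<Sum>j<d. (sin (x j) / 2)\<^sup>2))"
    by (rule weight_fun_divergence[where g="\<lambda>_. 1" and g'="\<lambda>_. 0" and \<delta>=1]) auto
  then show ?thesis by (simp add: torus_mean_diff C_torus_0_weight)
qed

text \<open>
  With \<open>F = w ^ m\<close> the divergence formula expresses the moment of order \<open>m + 1\<close> by the one of order
  \<open>m\<close>; the error term is at most \<open>m E w ^ m\<close> because \<open>|\<nabla>\<omega>|\<^sup>2 \<le> \<omega>\<close>.
\<close>
lemma weight_moment_le:
  assumes \<delta>: "0 < \<delta>" "\<delta> \<le> 1"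
  shows "torus_mean d (\<lambda>x. (weight d x + \<delta>) ^ m) \<le> (real d / 2 + 1 + real m) ^ m"
proof (induction m)
  case (Suc m)
  let ?w = "\<lambda>x. weight d x + \<delta>" and ?D = "real d / 2"
  have mem: "(\<lambda>x. ?w x ^ n) \<in> C_torus d 0" for n by (intro C0_intros)
  have memG: "(\<lambda>x. (\<Sum>j<d. (sin (x j) / 2)\<^sup>2)) \<in> C_torus d 0"
    by (intro C0_intros sin_half_C0)
  have "torus_mean d (\<lambda>x. ?w x ^ m * (?D - weight d x)) =
      - torus_mean d (\<lambda>x. (real m * ?w x ^ (m - 1)) * (\<Sum>j<d. (sin (x j) / 2)\<^sup>2))"
    by (rule weight_fun_divergence[where g="\<lambda>t. t ^ m" and g'="\<lambda>t. real m * t ^ (m - 1)", OF \<delta>(1)])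
       (use DERIV_pow[of m] in \<open>auto intro!: continuous_intros\<close>)
  also have "(\<lambda>x. ?w x ^ m * (?D - weight d x)) = (\<lambda>x. (?D + \<delta>) * ?w x ^ m - ?w x ^ Suc m)"
    by (auto simp: fun_eq_iff algebra_simps)
  finally have "torus_mean d (\<lambda>x. ?w x ^ Suc m) = (?D + \<delta>) * torus_mean d (\<lambda>x. ?w x ^ m) +
      torus_mean d (\<lambda>x. (real m * ?w x ^ (m - 1)) * (\<Sum>j<d. (sin (x j) / 2)\<^sup>2))"
    using mem[of m] mem[of "Suc m"] by (simp add: torus_mean_diff torus_mean_cmult C0_intros del: power_Suc)
  also have "torus_mean d (\<lambda>x. (real m * ?w x ^ (m - 1)) * (\<Sum>j<d. (sin (x j) / 2)\<^sup>2))
      \<le> torus_mean d (\<lambda>x. real m * ?w x ^ m)"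
  proof (rule torus_mean_mono)
    fix x
    show "(real m * ?w x ^ (m - 1)) * (\<Sum>j<d. (sin (x j) / 2)\<^sup>2) \<le> real m * ?w x ^ m"
    proof (cases m)
      case (Suc n)
      have "?w x ^ n * (\<Sum>j<d. (sin (x j) / 2)\<^sup>2) \<le> ?w x ^ n * ?w x"
        using grad_weight_sq_le[of x d] \<delta> by (intro mult_left_mono) auto
      then show ?thesis using Suc by (simp add: mult.assoc mult_left_mono mult.commute)
    qed simp
  qed (intro C0_intros mem memG)+
  finally have "torus_mean d (\<lambda>x. ?w x ^ Suc m) \<le> (?D + \<delta> + real m) * torus_mean d (\<lambda>x. ?w x ^ m)"
    by (simp add: torus_mean_cmult algebra_simps)
  also have "\<dots> \<le> (?D + 1 + real (Suc m)) * (?D + 1 + real m) ^ m"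
    using \<delta> Suc by (intro mult_mono torus_mean_nonneg) auto
  also have "\<dots> \<le> (?D + 1 + real (Suc m)) * (?D + 1 + real (Suc m)) ^ m"
    by (intro mult_left_mono power_mono) auto
  finally show ?case by simp
qed simp

text \<open>
  The same recursion for \<open>F = 1 / w ^ (m + 1)\<close>.  The bound is uniform in \<open>\<delta>\<close>: in dimension
  \<open>d > 2 m\<close> the zero of the weight is too thin a set to make the negative moment large.
\<close>
lemma weight_negative_moment_le:
  assumes \<delta>: "0 < \<delta>" and m: "real m < real d / 2"
  shows "torus_mean d (\<lambda>x. 1 / (weight d x + \<delta>) ^ m) \<le> 1 / (real d / 2 - real m) ^ m"
  using m
proof (induction m)
  case (Suc m)
  let ?w = "\<lambda>x. weight d x + \<delta>" and ?D = "real d / 2"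
  have wp: "?w x > 0" for x by (rule shifted_weight_pos[OF \<delta>])
  have mem: "(\<lambda>x. c / ?w x ^ n) \<in> C_torus d 0" for n c
    using wp by (intro C_torus_0_divide C0_intros) (auto simp: less_imp_neq[symmetric])
  have memG: "(\<lambda>x. (\<Sum>j<d. (sin (x j) / 2)\<^sup>2)) \<in> C_torus d 0"
    by (intro C0_intros sin_half_C0)
  have dv: "((\<lambda>t. 1 / t ^ Suc m) has_real_derivative - real (Suc m) / t ^ Suc (Suc m)) (at t)" if "t > 0" for t :: real
  proof -
    have "((\<lambda>t. inverse (t ^ Suc m)) has_real_derivative
        - (real (Suc m) * t ^ m * inverse ((t ^ Suc m) ^ Suc (Suc 0)))) (at t)"
      using that DERIV_pow[of "Suc m" t UNIV] by (intro DERIV_inverse_fun) auto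
    moreover have "- (real (Suc m) * t ^ m * inverse ((t ^ Suc m) ^ Suc (Suc 0))) = - real (Suc m) / t ^ Suc (Suc m)"
      using that by (simp add: field_simps)
    ultimately show ?thesis by (simp only: inverse_eq_divide)
  qed
  have "torus_mean d (\<lambda>x. 1 / ?w x ^ Suc m * (?D - weight d x)) =
      - torus_mean d (\<lambda>x. (- real (Suc m) / ?w x ^ Suc (Suc m)) * (\<Sum>j<d. (sin (x j) / 2)\<^sup>2))"
    by (rule weight_fun_divergence[where g="\<lambda>t. 1 / t ^ Suc m" and g'="\<lambda>t. - real (Suc m) / t ^ Suc (Suc m)", OF \<delta> dv])
       (auto intro!: continuous_intros)
  also have "torus_mean d (\<lambda>x. 1 / ?w x ^ Suc m * (?D - weight d x)) = 
      torus_mean d (\<lambda>x. (?D + \<delta>) * (1 / ?w x ^ Suc m) - 1 / ?w x ^ m)"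
  proof (rule torus_mean_cong)
    fix x show "1 / ?w x ^ Suc m * (?D - weight d x) = (?D + \<delta>) * (1 / ?w x ^ Suc m) - 1 / ?w x ^ m"
    proof -
      have "1 / ?w x ^ m = ?w x * (1 / ?w x ^ Suc m)" using wp[of x] by simp
      then show ?thesis by (simp only: left_diff_distrib right_diff_distrib distrib_right mult.commute)
    qed
  qed
  also have "\<dots> = (?D + \<delta>) * torus_mean d (\<lambda>x. 1 / ?w x ^ Suc m) - torus_mean d (\<lambda>x. 1 / ?w x ^ m)"
    by (subst torus_mean_diff) (intro C0_intros mem, intro mem, simp only: torus_mean_cmult)
  finally have "(?D + \<delta>) * torus_mean d (\<lambda>x. 1 / ?w x ^ Suc m) = torus_mean d (\<lambda>x. 1 / ?w x ^ m)
     - torus_mean d (\<lambda>x. (- real (Suc m) / ?w x ^ Suc (Suc m)) * (\<Sum>j<d. (sin (x j) / 2)\<^sup>2))"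
    by linarith
  also have "\<dots> = torus_mean d (\<lambda>x. 1 / ?w x ^ m)
     + torus_mean d (\<lambda>x. (real (Suc m) / ?w x ^ Suc (Suc m)) * (\<Sum>j<d. (sin (x j) / 2)\<^sup>2))"
    using torus_mean_minus[of d "\<lambda>x. (real (Suc m) / ?w x ^ Suc (Suc m)) * (\<Sum>j<d. (sin (x j) / 2)\<^sup>2)"]
    by (simp del: of_nat_Suc power_Suc)
  also have "torus_mean d (\<lambda>x. (real (Suc m) / ?w x ^ Suc (Suc m)) * (\<Sum>j<d. (sin (x j) / 2)\<^sup>2))
     \<le> torus_mean d (\<lambda>x. real (Suc m) * (1 / ?w x ^ Suc m))"
  proof (rule torus_mean_mono)
    fix x
    have "(\<Sum>j<d. (sin (x j) / 2)\<^sup>2) \<le> ?w x"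
      using grad_weight_sq_le[of x d] \<delta> by linarith
    then have "(real (Suc m) / ?w x ^ Suc (Suc m)) * (\<Sum>j<d. (sin (x j) / 2)\<^sup>2) \<le> (real (Suc m) / ?w x ^ Suc (Suc m)) * ?w x"
      using wp[of x] by (intro mult_left_mono) auto
    also have "\<dots> = real (Suc m) * (1 / ?w x ^ Suc m)"
    proof -
      have "a / (v * p) * v = a * (1 / p)" if "v > 0" for a v p :: real
        using that by simp
      from this[OF wp[of x]] show ?thesis unfolding power_Suc[of "?w x" "Suc m"] .
    qed
    finally show "(real (Suc m) / ?w x ^ Suc (Suc m)) * (\<Sum>j<d. (sin (x j) / 2)\<^sup>2) \<le> real (Suc m) * (1 / ?w x ^ Suc m)" .
  qed (intro C0_intros mem memG)+
  finally have "(?D + \<delta> - real (Suc m)) * torus_mean d (\<lambda>x. 1 / ?w x ^ Suc m) \<le> torus_mean d (\<lambda>x. 1 / ?w x ^ m)"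
    unfolding torus_mean_cmult by (simp only: left_diff_distrib) linarith
  also have "\<dots> \<le> 1 / (?D - real m) ^ m" using Suc by simp
  also have "\<dots> \<le> 1 / (?D - real (Suc m)) ^ m"
    using Suc.prems by (intro divide_left_mono power_mono mult_pos_pos zero_less_power) auto
  finally have "(?D + \<delta> - real (Suc m)) * torus_mean d (\<lambda>x. 1 / ?w x ^ Suc m) \<le> 1 / (?D - real (Suc m)) ^ m" .
  moreover have "(?D - real (Suc m)) * torus_mean d (\<lambda>x. 1 / ?w x ^ Suc m) 
      \<le> (?D + \<delta> - real (Suc m)) * torus_mean d (\<lambda>x. 1 / ?w x ^ Suc m)"
    using \<delta> wp by (intro mult_right_mono torus_mean_nonneg) (auto intro!: mult_nonneg_nonneg less_imp_le)
  ultimately have "(?D - real (Suc m)) * torus_mean d (\<lambda>x. 1 / ?w x ^ Suc m) \<le> 1 / (?D - real (Suc m)) ^ m" by linarith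
  moreover have "X \<le> 1 / c ^ Suc m" if "c > 0" "c * X \<le> 1 / c ^ m" for c X :: real
    using that by (simp add: pos_le_divide_eq mult.assoc[symmetric]) (simp add: mult_ac)
  ultimately show ?case using Suc.prems by simp
qed simp

text \<open>
  Expanding the square leaves moments of the orders \<open>\<gamma> + 1\<close>, \<open>1\<close> and \<open>1 - \<gamma>\<close>.  Divided by
  \<open>(d / 2) ^ (\<gamma> + 1)\<close> they tend to \<open>1 - 2 + 1 = 0\<close>.
\<close>
lemma weight_concentration:
  assumes "\<eta> > 0"
  shows "\<forall>\<^sub>F d in sequentially. \<forall>\<delta>. 0 < \<delta> \<longrightarrow> \<delta> \<le> 1 \<longrightarrow>
    torus_mean d (\<lambda>x. ((weight d x + \<delta>) ^ \<gamma> - (real d / 2) ^ \<gamma>)\<^sup>2 * ((weight d x + \<delta>) / (weight d x + \<delta>) ^ \<gamma>))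
      \<le> \<eta> * (real d / 2) ^ Suc \<gamma>"
proof (cases \<gamma>)
  case 0
  then show ?thesis using assms by simp
next
  case (Suc g)
  \<comment> \<open>The moment bounds, divided by \<open>(d / 2) ^ (\<gamma> + 1)\<close>; here \<open>g = \<gamma> - 1\<close>\<close>
  define q where "q = (\<lambda>d. (1 + (1 + real (Suc \<gamma>)) / (real d / 2)) ^ Suc \<gamma> - 2 + (1 / (1 - real g / (real d / 2))) ^ g)"
  have lim: "(\<lambda>d. c / (real d / 2)) \<longlonglongrightarrow> 0" for c
    using lim_const_over_n[of "2 * c"] by (simp add: mult.commute)
  have "q \<longlonglongrightarrow> (1 + 0) ^ Suc \<gamma> - 2 + (1 / (1 - 0)) ^ g"
    unfolding q_def by (intro tendsto_intros lim) simp
  then have "q \<longlonglongrightarrow> 0" by simp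
  then have "\<forall>\<^sub>F d in sequentially. q d < \<eta>"
    using assms by (rule order_tendstoD)
  moreover have "\<forall>\<^sub>F d in sequentially. d > 2 * g + 2"
    by (rule eventually_gt_at_top)
  ultimately show ?thesis
  proof eventually_elim
    case (elim d)
    define D where "D = real d / 2"
    have D: "D > real g + 1" using elim(2) by (simp add: D_def)
    show ?case
    proof (intro allI impI)
      fix \<delta> :: real assume \<delta>: "0 < \<delta>" "\<delta> \<le> 1"
      let ?w = "\<lambda>x. weight d x + \<delta>"
      have wp: "?w x > 0" for x by (rule shifted_weight_pos[OF \<delta>(1)])
      have mem: "(\<lambda>x. c / ?w x ^ n) \<in> C_torus d 0" for n c
        using wp by (intro C_torus_0_divide C0_intros) (auto simp: less_imp_neq[symmetric])
      have "torus_mean d (\<lambda>x. (?w x ^ \<gamma> - D ^ \<gamma>)\<^sup>2 * (?w x / ?w x ^ \<gamma>)) = 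
         torus_mean d (\<lambda>x. (?w x ^ Suc \<gamma> - 2 * D ^ \<gamma> * ?w x) + D ^ (2 * \<gamma>) * (1 / ?w x ^ g))"
      proof (rule torus_mean_cong)
        fix x
        have "(v ^ \<gamma> - D ^ \<gamma>)\<^sup>2 * (v / v ^ \<gamma>) = (v ^ Suc \<gamma> - 2 * D ^ \<gamma> * v) + D ^ (2 * \<gamma>) * (1 / v ^ g)"
          if "v > 0" for v :: real
        proof -
          have aux: "(v * p - b)\<^sup>2 * (1 / p) = (v * (v * p) - 2 * b * v) + b\<^sup>2 * (1 / p)"
            if "p > 0" for p b :: real
            using that by (simp add: power2_eq_square field_simps)
          have "v / v ^ \<gamma> = 1 / v ^ g" using that Suc by simp
          moreover have "D ^ (2 * \<gamma>) = (D ^ \<gamma>)\<^sup>2" by (simp add: power_mult[symmetric] mult.commute)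
          ultimately show ?thesis using aux[of "v ^ g" "D ^ \<gamma>"] that Suc by simp
        qed
        from this[OF wp[of x]] show "(?w x ^ \<gamma> - D ^ \<gamma>)\<^sup>2 * (?w x / ?w x ^ \<gamma>) = 
          (?w x ^ Suc \<gamma> - 2 * D ^ \<gamma> * ?w x) + D ^ (2 * \<gamma>) * (1 / ?w x ^ g)" .
      qed
      also have "\<dots> = torus_mean d (\<lambda>x. ?w x ^ Suc \<gamma>) - 2 * D ^ \<gamma> * (D + \<delta>) + D ^ (2 * \<gamma>) * torus_mean d (\<lambda>x. 1 / ?w x ^ g)"
        by (subst torus_mean_add torus_mean_diff torus_mean_cmult torus_mean_const torus_mean_weight
            | (intro C0_intros mem)[1] | simp add: D_def del: power_Suc)+
      also have "\<dots> \<le> (D + 1 + real (Suc \<gamma>)) ^ Suc \<gamma> - 2 * D ^ \<gamma> * D + D ^ (2 * \<gamma>) * (1 / (D - real g) ^ g)"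
        using D \<delta> unfolding D_def
        by (intro add_mono diff_mono mult_left_mono weight_moment_le weight_negative_moment_le) auto
      also have "\<dots> = D ^ Suc \<gamma> * q d"
      proof -
        have Dn: "D \<noteq> 0" "D - real g \<noteq> 0" using D by auto
        have "(1 + (1 + real (Suc \<gamma>)) / D) ^ Suc \<gamma> * D ^ Suc \<gamma> = (D + 1 + real (Suc \<gamma>)) ^ Suc \<gamma>"
        proof -
          have "(1 + (1 + real (Suc \<gamma>)) / D) * D = D + 1 + real (Suc \<gamma>)" using Dn by (simp add: field_simps)
          then show ?thesis unfolding power_mult_distrib[symmetric] by simp
        qed
        moreover have "(1 / (1 - real g / D)) ^ g * D ^ Suc \<gamma> = D ^ (2 * \<gamma>) * (1 / (D - real g) ^ g)"
        proof -
          have "1 / (1 - real g / D) = D / (D - real g)" using Dn by (simp add: field_simps)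
          moreover have "D ^ (2 * \<gamma>) = D ^ g * D ^ Suc \<gamma>"
            unfolding power_add[symmetric] using Suc by (simp add: mult_2)
          ultimately show ?thesis by (simp add: power_divide)
        qed
        moreover have "D ^ Suc \<gamma> * q d = (1 + (1 + real (Suc \<gamma>)) / D) ^ Suc \<gamma> * D ^ Suc \<gamma>
            - 2 * D ^ Suc \<gamma> + (1 / (1 - real g / D)) ^ g * D ^ Suc \<gamma>"
          unfolding q_def D_def[symmetric] by (simp only: distrib_left right_diff_distrib mult.commute)
        ultimately show ?thesis by (simp only: power_Suc mult.assoc mult.commute[of "D ^ \<gamma>" D])
      qed
      also have "\<dots> \<le> D ^ Suc \<gamma> * \<eta>"
        using elim(1) D by (intro mult_left_mono) auto
      finally show "torus_mean d (\<lambda>x. (?w x ^ \<gamma> - (real d / 2) ^ \<gamma>)\<^sup>2 * (?w x / ?w x ^ \<gamma>)) \<le> \<eta> * (real d / 2) ^ Suc \<gamma>"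
        unfolding D_def by (simp add: mult.commute)
    qed
  qed
qed

section \<open>The Hardy inequality\<close>

text \<open>
  Cauchy-Schwarz for the sum followed by Young's inequality with parameter \<open>\<theta>\<close>; it is used with
  \<open>b = \<nabla>w\<close> and \<open>W = w\<close>.
\<close>
lemma cross_term_bound:
  fixes a \<theta> W :: real and p b :: "nat \<Rightarrow> real"
  assumes b: "(\<Sum>j<d. (b j)\<^sup>2) \<le> W" and \<theta>: "\<theta> > 0"
  shows "2 * \<bar>a * (\<Sum>j<d. p j * b j)\<bar> \<le> \<theta> * (W * (\<Sum>j<d. (p j)\<^sup>2)) + a\<^sup>2 / \<theta>"
proof (rule power2_le_imp_le)
  let ?S = "\<Sum>j<d. p j * b j" and ?P = "\<Sum>j<d. (p j)\<^sup>2"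
  have W: "0 \<le> W" using b sum_nonneg[of "{..<d}" "\<lambda>j. (b j)\<^sup>2"] by simp
  have P: "0 \<le> ?P" by (intro sum_nonneg) auto
  have S: "?S\<^sup>2 \<le> ?P * W"
    by (rule order_trans[OF Cauchy_Schwarz_ineq_sum]) (intro mult_left_mono b P)
  have "(2 * \<bar>a * ?S\<bar>)\<^sup>2 = 4 * (a\<^sup>2 * ?S\<^sup>2)" by (simp add: power_mult_distrib)
  also have "\<dots> \<le> 4 * (a\<^sup>2 * (?P * W))" by (intro mult_left_mono S) auto
  also have "\<dots> = 4 * ((\<theta> * (W * ?P)) * (a\<^sup>2 / \<theta>))" using \<theta> by (simp add: field_simps)
  also have "\<dots> \<le> (\<theta> * (W * ?P) + a\<^sup>2 / \<theta>)\<^sup>2"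
  proof -
    have "4 * (x * y) \<le> (x + y)\<^sup>2" for x y :: real
      using zero_le_power2[of "x - y"] by (simp add: power2_eq_square algebra_simps)
    then show ?thesis .
  qed
  finally show "(2 * \<bar>a * ?S\<bar>)\<^sup>2 \<le> (\<theta> * (W * ?P) + a\<^sup>2 / \<theta>)\<^sup>2" .
  show "0 \<le> \<theta> * (W * ?P) + a\<^sup>2 / \<theta>" using W P \<theta> by simp
qed

text \<open>
  The positive shift keeps \<open>w ^ \<gamma> / w\<close> (singular for \<open>\<gamma> = 0\<close>) and \<open>sqrt w\<close> smooth across the zero of
  the weight.  All estimates are uniform in \<open>\<delta>\<close>, which is sent to zero at the very end.
\<close>
locale shifted_weight =
  fixes d :: nat and \<delta> :: real
  assumes \<delta>_pos: "0 < \<delta>"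
begin

definition w :: "(nat \<Rightarrow> real) \<Rightarrow> real" where "w x = weight d x + \<delta>"

definition dw :: "nat \<Rightarrow> (nat \<Rightarrow> real) \<Rightarrow> real" where "dw j x = sin (x j) / 2"

definition ratio :: "nat \<Rightarrow> (nat \<Rightarrow> real) \<Rightarrow> real" where "ratio \<gamma> x = w x ^ \<gamma> / w x"

lemma w_pos: "0 < w x"
  using shifted_weight_pos[OF \<delta>_pos] by (simp add: w_def)

lemma w_nz: "w x \<noteq> 0"
  using w_pos[of x] by simp

lemma ratio_pos: "0 < ratio \<gamma> x"
  using w_pos by (simp add: ratio_def)

lemma ratio_mult: "ratio \<gamma> x * w x = w x ^ \<gamma>"
  using w_nz by (simp add: ratio_def)

lemma dw_sq: "(\<Sum>j<d. (dw j x)\<^sup>2) \<le> w x"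
  using grad_weight_sq_le[of x d] \<delta>_pos by (simp add: dw_def w_def)

lemma w_C0: "w \<in> C_torus d 0"
  unfolding w_def[abs_def] by (intro C0_intros)

lemma dw_C0: "dw j \<in> C_torus d 0"
  unfolding dw_def[abs_def] by (rule sin_half_C0)

lemma ratio_C0: "ratio \<gamma> \<in> C_torus d 0"
  unfolding ratio_def[abs_def] by (intro C_torus_0_divide C0_intros w_C0 w_nz)

lemma torus_diff_fun_w:
  assumes "\<And>t. t > 0 \<Longrightarrow> (g has_real_derivative g' t) (at t)" "continuous_on {0<..} g'"
  shows "torus_diff d (\<lambda>x. g (w x)) (\<lambda>j x. g' (w x) * dw j x)"
  unfolding w_def dw_def by (rule torus_diff_fun_weight[OF \<delta>_pos assms])

lemma torus_diff_ratio: "torus_diff d (ratio \<gamma>) (\<lambda>j x. (real \<gamma> - 1) * (ratio \<gamma> x / w x) * dw j x)"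
proof -
  have "((\<lambda>t. t ^ \<gamma> / t) has_real_derivative (real \<gamma> - 1) * (t ^ \<gamma> / t / t)) (at t)" if "t > 0" for t :: real
  proof (cases \<gamma>)
    case 0
    then show ?thesis using that by (auto intro!: derivative_eq_intros simp: field_simps)
  next
    case (Suc n)
    have dn: "((\<lambda>t. t ^ n) has_real_derivative (real \<gamma> - 1) * (t ^ \<gamma> / t / t)) (at t)"
      using DERIV_pow[of n t UNIV] that Suc by (cases n) auto
    have ev: "\<forall>\<^sub>F s in nhds t. s ^ n = s ^ \<gamma> / s"
    proof (rule eventually_mono)
      show "\<forall>\<^sub>F s in nhds t. s \<in> {0<..}" using that by (intro eventually_nhds_in_open) auto
      show "s ^ n = s ^ \<gamma> / s" if "s \<in> {0<..}" for s :: real using that Suc by simp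
    qed
    show ?thesis
      by (rule DERIV_cong_ev[OF refl ev refl, THEN iffD1, OF dn])
  qed
  then show ?thesis
    unfolding ratio_def[abs_def]
    by (intro torus_diff_fun_w[where g="\<lambda>t. t ^ \<gamma> / t" and g'="\<lambda>t. (real \<gamma> - 1) * (t ^ \<gamma> / t / t)"])
       (auto intro!: continuous_intros)
qed

lemma torus_diff_sqrt_power:
  "torus_diff d (\<lambda>x. sqrt (w x) ^ \<gamma>) (\<lambda>j x. (real \<gamma> / 2) * (sqrt (w x) ^ \<gamma> / w x) * dw j x)"
proof -
  have "((\<lambda>t. sqrt t ^ \<gamma>) has_real_derivative (real \<gamma> / 2) * (sqrt t ^ \<gamma> / t)) (at t)" if "t > 0" for t :: real
  proof -
    have "((\<lambda>t. sqrt t ^ \<gamma>) has_real_derivative real \<gamma> * (inverse (sqrt t) / 2 * sqrt t ^ (\<gamma> - Suc 0))) (at t)"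
      by (rule DERIV_power[OF DERIV_real_sqrt[OF that]])
    also have "real \<gamma> * (inverse (sqrt t) / 2 * sqrt t ^ (\<gamma> - Suc 0)) = (real \<gamma> / 2) * (sqrt t ^ \<gamma> / t)"
    proof (cases \<gamma>)
      case (Suc n)
      have "sqrt t / t = inverse (sqrt t)" using that by (simp add: field_simps)
      then have "sqrt t ^ \<gamma> / t = sqrt t ^ n * inverse (sqrt t)"
        using Suc by (metis power_Suc2 times_divide_eq_right)
      then show ?thesis using Suc by simp
    qed simp
    finally show ?thesis .
  qed
  then show ?thesis
    by (intro torus_diff_fun_w[where g="\<lambda>t. sqrt t ^ \<gamma>" and g'="\<lambda>t. (real \<gamma> / 2) * (sqrt t ^ \<gamma> / t)"])
       (auto intro!: continuous_intros)
qed

text \<open>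
  The divergence formula for \<open>F = \<psi>\<^sup>2 w ^ \<gamma> / w\<close>.  Differentiating the weight produces
  \<open>(\<gamma> - 1) \<psi>\<^sup>2 |\<nabla>w|\<^sup>2 w ^ \<gamma> / w\<^sup>2\<close>, which enters with a favourable sign for \<open>\<gamma> \<ge> 1\<close> and is bounded by
  \<open>\<psi>\<^sup>2 w ^ \<gamma> / w\<close> for \<open>\<gamma> = 0\<close>.  Compared with the left-hand side the last term is smaller by a
  factor of order \<open>1 / d\<close>.
\<close>
lemma hardy_radial:
  assumes \<psi>: "torus_diff d \<psi> \<psi>'" and \<theta>: "\<theta> > 0"
  shows "real d / 2 * torus_mean d (\<lambda>x. ratio \<gamma> x * (\<psi> x)\<^sup>2)
    \<le> torus_mean d (\<lambda>x. ratio \<gamma> x * (w x * (\<psi> x)\<^sup>2))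
      + \<theta> * torus_mean d (\<lambda>x. ratio \<gamma> x * (w x * (\<Sum>j<d. (\<psi>' j x)\<^sup>2)))
      + (1 / \<theta> + 1) * torus_mean d (\<lambda>x. ratio \<gamma> x * (\<psi> x)\<^sup>2)"
proof -
  note p0 = torus_diff_C0[OF \<psi>] and p1 = torus_diff_C0'[OF \<psi>]
  define B where "B = (\<lambda>x. ratio \<gamma> x * (\<psi> x)\<^sup>2)"
  define U where "U = (\<lambda>x. ratio \<gamma> x * (w x * (\<psi> x)\<^sup>2))"
  define A where "A = (\<lambda>x. ratio \<gamma> x * (w x * (\<Sum>j<d. (\<psi>' j x)\<^sup>2)))"
  have c: "B \<in> C_torus d 0" "U \<in> C_torus d 0" "A \<in> C_torus d 0"
    unfolding A_def B_def U_def by (intro C0_intros p0 p1 ratio_C0 w_C0; simp)+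
  define F' where "F' = (\<lambda>j x. (\<psi>' j x * \<psi> x + \<psi> x * \<psi>' j x) * ratio \<gamma> x +
      \<psi> x * \<psi> x * ((real \<gamma> - 1) * (ratio \<gamma> x / w x) * dw j x))"
  have F: "torus_diff d (\<lambda>x. \<psi> x * \<psi> x * ratio \<gamma> x) F'"
    unfolding F'_def by (intro torus_diff_mult \<psi> torus_diff_ratio)
  have cF: "(\<lambda>x. \<Sum>j<d. F' j x * dw j x) \<in> C_torus d 0"
    using torus_diff_C0'[OF F] by (intro C0_intros dw_C0) auto
  have "(real d / 2 + \<delta>) * torus_mean d B = torus_mean d (\<lambda>x. (\<psi> x * \<psi> x * ratio \<gamma> x) * (real d / 2 - weight d x) + U x)"
    unfolding torus_mean_cmult[symmetric]
    by (rule torus_mean_cong) (simp add: B_def U_def w_def power2_eq_square algebra_simps)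
  also have "\<dots> = torus_mean d (\<lambda>x. (\<psi> x * \<psi> x * ratio \<gamma> x) * (real d / 2 - weight d x)) + torus_mean d U"
    by (intro torus_mean_add c C0_intros p0 ratio_C0)
  also have "torus_mean d (\<lambda>x. (\<psi> x * \<psi> x * ratio \<gamma> x) * (real d / 2 - weight d x)) = torus_mean d (\<lambda>x. - (\<Sum>j<d. F' j x * dw j x))"
    unfolding weight_divergence_formula[OF F] torus_mean_minus dw_def ..
  also have "\<dots> \<le> torus_mean d (\<lambda>x. \<theta> * A x + (1 / \<theta> + 1) * B x)"
  proof (rule torus_mean_mono)
    fix x
    let ?S = "\<Sum>j<d. \<psi>' j x * dw j x" and ?T = "\<Sum>j<d. (dw j x)\<^sup>2"
    let ?r = "ratio \<gamma> x"
    have r: "0 \<le> ?r" "0 < w x" using ratio_pos[of \<gamma> x] w_pos[of x] by auto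
    have "(\<Sum>j<d. F' j x * dw j x) = (\<Sum>j<d. ?r * (2 * \<psi> x * (\<psi>' j x * dw j x)) + (real \<gamma> - 1) * (?r / w x) * (\<psi> x)\<^sup>2 * (dw j x)\<^sup>2)"
      unfolding F'_def by (intro sum.cong refl) (simp add: power2_eq_square algebra_simps)
    also have "\<dots> = ?r * (2 * (\<psi> x * ?S)) + (real \<gamma> - 1) * (?r / w x) * (\<psi> x)\<^sup>2 * ?T"
      by (simp add: sum.distrib sum_distrib_left mult.assoc)
    finally have eq: "(\<Sum>j<d. F' j x * dw j x) = ?r * (2 * (\<psi> x * ?S)) + (real \<gamma> - 1) * (?r / w x) * (\<psi> x)\<^sup>2 * ?T" .
    have "- (?r * (2 * (\<psi> x * ?S))) \<le> ?r * (2 * \<bar>\<psi> x * ?S\<bar>)"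
      using r mult_left_mono[of "- (2 * (\<psi> x * ?S))" "2 * \<bar>\<psi> x * ?S\<bar>" ?r] by linarith
    also have "\<dots> \<le> ?r * (\<theta> * (w x * (\<Sum>j<d. (\<psi>' j x)\<^sup>2)) + (\<psi> x)\<^sup>2 / \<theta>)"
      by (intro mult_left_mono cross_term_bound dw_sq \<theta> r)
    also have "\<dots> = \<theta> * A x + 1 / \<theta> * B x" by (simp add: A_def B_def algebra_simps)
    finally have 1: "- (?r * (2 * (\<psi> x * ?S))) \<le> \<theta> * A x + 1 / \<theta> * B x" .
    define Z where "Z = (?r / w x) * (\<psi> x)\<^sup>2 * ?T"
    have Z0: "0 \<le> Z" unfolding Z_def using r by (intro mult_nonneg_nonneg sum_nonneg) auto
    have "Z \<le> (?r / w x) * (\<psi> x)\<^sup>2 * w x" unfolding Z_def using r by (intro mult_left_mono dw_sq) auto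
    also have "\<dots> = B x" using r by (simp add: B_def)
    finally have "Z \<le> B x" .
    moreover have "- ((real \<gamma> - 1) * Z) \<le> Z"
      using mult_nonneg_nonneg[OF of_nat_0_le_iff[of \<gamma>] Z0] by (simp add: algebra_simps)
    ultimately have 2: "- ((real \<gamma> - 1) * (?r / w x) * (\<psi> x)\<^sup>2 * ?T) \<le> B x"
      unfolding Z_def by (simp only: mult.assoc)
    show "- (\<Sum>j<d. F' j x * dw j x) \<le> \<theta> * A x + (1 / \<theta> + 1) * B x"
      unfolding eq using 1 2 by (simp add: distrib_right)
  qed (intro C0_intros c cF)+
  also have "\<dots> = \<theta> * torus_mean d A + (1 / \<theta> + 1) * torus_mean d B"
    by (subst torus_mean_add) (intro C0_intros c, intro C0_intros c, simp only: torus_mean_cmult)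
  finally have "(real d / 2 + \<delta>) * torus_mean d B \<le> \<theta> * torus_mean d A + (1 / \<theta> + 1) * torus_mean d B + torus_mean d U"
    by simp
  moreover have "0 \<le> torus_mean d B"
    unfolding B_def using ratio_pos by (intro torus_mean_nonneg mult_nonneg_nonneg) (auto intro: less_imp_le)
  then have "0 \<le> \<delta> * torus_mean d B" using \<delta>_pos by simp
  ultimately show ?thesis
    unfolding A_def[symmetric] B_def[symmetric] U_def[symmetric] by (simp add: algebra_simps)
qed

text \<open>
  The Poincare inequality for \<open>u = \<psi> w ^ (\<gamma> / 2)\<close>.  Differentiating the factor
  \<open>w ^ (\<gamma> / 2)\<close> costs only multiples of \<open>E \<psi>\<^sup>2 w ^ \<gamma> / w\<close>, since \<open>|\<nabla>w|\<^sup>2 \<le> w\<close>.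
\<close>
lemma hardy_poincare:
  assumes \<psi>: "torus_diff d \<psi> \<psi>'" and \<theta>: "\<theta> > 0"
  shows "torus_mean d (\<lambda>x. ratio \<gamma> x * (w x * (\<psi> x)\<^sup>2))
    \<le> (torus_mean d (\<lambda>x. \<psi> x * sqrt (w x) ^ \<gamma>))\<^sup>2
      + (1 + real \<gamma> / 2 * \<theta>) * torus_mean d (\<lambda>x. ratio \<gamma> x * (w x * (\<Sum>j<d. (\<psi>' j x)\<^sup>2)))
      + (real \<gamma> / (2 * \<theta>) + (real \<gamma>)\<^sup>2 / 4) * torus_mean d (\<lambda>x. ratio \<gamma> x * (\<psi> x)\<^sup>2)"
proof -
  note p0 = torus_diff_C0[OF \<psi>] and p1 = torus_diff_C0'[OF \<psi>]
  define B where "B = (\<lambda>x. ratio \<gamma> x * (\<psi> x)\<^sup>2)"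
  define A where "A = (\<lambda>x. ratio \<gamma> x * (w x * (\<Sum>j<d. (\<psi>' j x)\<^sup>2)))"
  have c: "B \<in> C_torus d 0" "A \<in> C_torus d 0"
    unfolding A_def B_def by (intro C0_intros p0 p1 ratio_C0 w_C0; simp)+
  define u where "u = (\<lambda>x. \<psi> x * sqrt (w x) ^ \<gamma>)"
  define u' where "u' = (\<lambda>j x. \<psi>' j x * sqrt (w x) ^ \<gamma> + \<psi> x * ((real \<gamma> / 2) * (sqrt (w x) ^ \<gamma> / w x) * dw j x))"
  have u: "torus_diff d u u'"
    unfolding u_def u'_def by (intro torus_diff_mult \<psi> torus_diff_sqrt_power)
  have s2: "(sqrt (w x) ^ \<gamma>)\<^sup>2 = ratio \<gamma> x * w x" for x
    using w_pos[of x] by (simp add: ratio_mult power_mult[symmetric] mult.commute[of \<gamma>]) (simp add: power_mult)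
  have "torus_mean d (\<lambda>x. (u x)\<^sup>2) - (torus_mean d u)\<^sup>2 \<le> (\<Sum>j<d. torus_mean d (\<lambda>x. (u' j x)\<^sup>2))"
    by (rule torus_poincare[OF u])
  also have "\<dots> = torus_mean d (\<lambda>x. \<Sum>j<d. (u' j x)\<^sup>2)"
    using torus_diff_C0'[OF u] by (intro torus_mean_sum[symmetric] C0_intros) auto
  also have "\<dots> \<le> torus_mean d (\<lambda>x. (1 + real \<gamma> / 2 * \<theta>) * A x + (real \<gamma> / (2 * \<theta>) + (real \<gamma>)\<^sup>2 / 4) * B x)"
  proof (rule torus_mean_mono)
    fix x
    let ?S = "\<Sum>j<d. \<psi>' j x * dw j x" and ?T = "\<Sum>j<d. (dw j x)\<^sup>2" and ?G = "\<Sum>j<d. (\<psi>' j x)\<^sup>2"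
    let ?r = "ratio \<gamma> x"
    \<comment> \<open>The gradient of \<open>u\<close> is \<open>sqrt w ^ \<gamma> * (\<nabla>\<psi> + \<kappa> \<nabla>w)\<close>\<close>
    define \<kappa> where "\<kappa> = real \<gamma> * \<psi> x / (2 * w x)"
    have r: "0 \<le> ?r" "0 < w x" using ratio_pos[of \<gamma> x] w_pos[of x] by auto
    have "(\<Sum>j<d. (u' j x)\<^sup>2) = (\<Sum>j<d. (sqrt (w x) ^ \<gamma>)\<^sup>2 * (\<psi>' j x + \<kappa> * dw j x)\<^sup>2)"
      unfolding u'_def \<kappa>_def power_mult_distrib[symmetric]
      using r by (intro sum.cong refl arg_cong[where f="\<lambda>y. y\<^sup>2"]) (simp add: field_simps)
    also have "\<dots> = (\<Sum>j<d. ?r * w x * ((\<psi>' j x)\<^sup>2 + 2 * \<kappa> * (\<psi>' j x * dw j x) + \<kappa>\<^sup>2 * (dw j x)\<^sup>2))"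
      unfolding s2 by (intro sum.cong refl) (simp add: power2_eq_square algebra_simps)
    also have "\<dots> = ?r * w x * (?G + 2 * \<kappa> * ?S + \<kappa>\<^sup>2 * ?T)"
      by (simp only: sum.distrib sum_distrib_left[symmetric])
    also have "\<dots> = A x + (real \<gamma> / 2) * (?r * (2 * (\<psi> x * ?S))) + (real \<gamma>)\<^sup>2 / 4 * (?r * ((\<psi> x)\<^sup>2 * (?T / w x)))"
    proof -
      have "r * v * (G + 2 * (g * p / (2 * v)) * S + (g * p / (2 * v))\<^sup>2 * T) = 
          r * (v * G) + (g / 2) * (r * (2 * (p * S))) + g\<^sup>2 / 4 * (r * (p\<^sup>2 * (T / v)))" if "v > 0" for r v G g p S T :: real
        using that by (simp add: field_simps power2_eq_square)
      from this[OF r(2)] show ?thesis unfolding \<kappa>_def A_def .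
    qed
    also have "\<dots> \<le> A x + (real \<gamma> / 2) * (\<theta> * A x + 1 / \<theta> * B x) + (real \<gamma>)\<^sup>2 / 4 * B x"
    proof (intro add_mono mult_left_mono order_refl)
      have "?r * (2 * (\<psi> x * ?S)) \<le> ?r * (2 * \<bar>\<psi> x * ?S\<bar>)"
        using r by (intro mult_left_mono) auto
      also have "\<dots> \<le> ?r * (\<theta> * (w x * ?G) + (\<psi> x)\<^sup>2 / \<theta>)"
        by (intro mult_left_mono cross_term_bound dw_sq \<theta> r)
      also have "\<dots> = \<theta> * A x + 1 / \<theta> * B x" by (simp add: A_def B_def algebra_simps)
      finally show "?r * (2 * (\<psi> x * ?S)) \<le> \<theta> * A x + 1 / \<theta> * B x" .
      have "?T / w x \<le> 1" using dw_sq[of x] r by simp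
      then have "?r * ((\<psi> x)\<^sup>2 * (?T / w x)) \<le> ?r * ((\<psi> x)\<^sup>2 * 1)"
        using r by (intro mult_left_mono) auto
      then show "?r * ((\<psi> x)\<^sup>2 * (?T / w x)) \<le> B x" by (simp add: B_def)
    qed auto
    also have "\<dots> = (1 + real \<gamma> / 2 * \<theta>) * A x + (real \<gamma> / (2 * \<theta>) + (real \<gamma>)\<^sup>2 / 4) * B x"
      using \<theta> by (simp add: field_simps)
    finally show "(\<Sum>j<d. (u' j x)\<^sup>2) \<le> (1 + real \<gamma> / 2 * \<theta>) * A x + (real \<gamma> / (2 * \<theta>) + (real \<gamma>)\<^sup>2 / 4) * B x" .
  next
    show "(\<lambda>x. \<Sum>j<d. (u' j x)\<^sup>2) \<in> C_torus d 0"
      using torus_diff_C0'[OF u] by (intro C0_intros) auto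
  qed (intro C0_intros c)
  also have "\<dots> = (1 + real \<gamma> / 2 * \<theta>) * torus_mean d A + (real \<gamma> / (2 * \<theta>) + (real \<gamma>)\<^sup>2 / 4) * torus_mean d B"
    by (subst torus_mean_add) (intro C0_intros c, intro C0_intros c, simp only: torus_mean_cmult)
  also have "torus_mean d (\<lambda>x. (u x)\<^sup>2) = torus_mean d (\<lambda>x. ratio \<gamma> x * (w x * (\<psi> x)\<^sup>2))"
    by (rule torus_mean_cong) (simp add: u_def power_mult_distrib s2 mult_ac)
  finally show ?thesis
    unfolding A_def[symmetric] B_def[symmetric] u_def[symmetric] by linarith
qed

text \<open>
  Since \<open>\<psi>\<close> has mean zero, \<open>sqrt w ^ \<gamma>\<close> may be replaced by its deviation from the constant
  \<open>sqrt D ^ \<gamma>\<close>, where \<open>D = d / 2\<close>.  Cauchy-Schwarz then separates this deviation from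
  \<open>\<psi>\<close>, and multiplying numerator and denominator by \<open>sqrt w ^ \<gamma> + sqrt D ^ \<gamma>\<close> removes the square roots.
\<close>
lemma hardy_mean_bound:
  assumes \<psi>: "\<psi> \<in> C_torus d 0" and mz: "torus_mean d \<psi> = 0" and d: "0 < d"
  shows "(torus_mean d (\<lambda>x. \<psi> x * sqrt (w x) ^ \<gamma>))\<^sup>2
    \<le> torus_mean d (\<lambda>x. (w x ^ \<gamma> - (real d / 2) ^ \<gamma>)\<^sup>2 * (w x / w x ^ \<gamma>)) / (real d / 2) ^ \<gamma>
      * torus_mean d (\<lambda>x. ratio \<gamma> x * (\<psi> x)\<^sup>2)"
proof -
  define D where "D = real d / 2"
  have D: "D > 0" using d by (simp add: D_def)
  define r where "r = sqrt D"
  have r: "r > 0" using D by (simp add: r_def)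
  have r2: "(r ^ \<gamma>)\<^sup>2 = D ^ \<gamma>"
    using D unfolding r_def by (metis less_imp_le power_mult mult.commute real_sqrt_pow2)
  let ?s = "\<lambda>x. sqrt (w x)"
  have s: "?s x > 0" for x using w_pos by simp
  have s2: "(?s x ^ \<gamma>)\<^sup>2 = w x ^ \<gamma>" for x
    using w_pos[of x] by (metis less_imp_le power_mult mult.commute real_sqrt_pow2)
  have sC: "(\<lambda>x. ?s x) \<in> C_torus d 0" by (intro C_torus_0_sqrt w_C0)
  define f where "f = (\<lambda>x. (?s x ^ \<gamma> - r ^ \<gamma>) * (?s x / ?s x ^ \<gamma>))"
  define g where "g = (\<lambda>x. \<psi> x * (?s x ^ \<gamma> / ?s x))"
  have fC: "f \<in> C_torus d 0" unfolding f_def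
    using s by (intro C0_intros C_torus_0_divide sC) (auto simp: less_imp_neq[symmetric])
  have gC: "g \<in> C_torus d 0" unfolding g_def
    using s by (intro C0_intros C_torus_0_divide sC \<psi>) (auto simp: less_imp_neq[symmetric])
  have m1: "(\<lambda>x. \<psi> x * ?s x ^ \<gamma>) \<in> C_torus d 0" "(\<lambda>x. r ^ \<gamma> * \<psi> x) \<in> C_torus d 0"
    by (intro C0_intros \<psi> sC)+
  have "torus_mean d (\<lambda>x. \<psi> x * ?s x ^ \<gamma>) = torus_mean d (\<lambda>x. \<psi> x * ?s x ^ \<gamma> - r ^ \<gamma> * \<psi> x)"
    using mz by (simp add: torus_mean_diff[OF m1] torus_mean_cmult)
  also have "\<dots> = torus_mean d (\<lambda>x. f x * g x)"
  proof (rule torus_mean_cong)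
    fix x
    have "(a - b) * (v / a) * (p * (a / v)) = p * a - b * p" if "a > 0" "v > 0" for a b v p :: real
      using that by (simp add: field_simps)
    from this[OF zero_less_power[OF s[of x]] s[of x]]
    show "\<psi> x * ?s x ^ \<gamma> - r ^ \<gamma> * \<psi> x = f x * g x" unfolding f_def g_def by (rule sym)
  qed
  finally have "(torus_mean d (\<lambda>x. \<psi> x * ?s x ^ \<gamma>))\<^sup>2 \<le> torus_mean d (\<lambda>x. (f x)\<^sup>2) * torus_mean d (\<lambda>x. (g x)\<^sup>2)"
    using torus_mean_Cauchy_Schwarz[OF fC gC] by simp
  also have "torus_mean d (\<lambda>x. (g x)\<^sup>2) = torus_mean d (\<lambda>x. ratio \<gamma> x * (\<psi> x)\<^sup>2)"
    using w_pos by (intro torus_mean_cong) (simp add: g_def power_mult_distrib power_divide s2 ratio_def mult.commute less_imp_le)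
  also have "torus_mean d (\<lambda>x. (f x)\<^sup>2) \<le> torus_mean d (\<lambda>x. (w x ^ \<gamma> - D ^ \<gamma>)\<^sup>2 * (w x / w x ^ \<gamma>) / D ^ \<gamma>)"
  proof (rule torus_mean_mono)
    fix x
    let ?a = "?s x ^ \<gamma>" and ?b = "r ^ \<gamma>"
    have ab: "0 < ?a" "0 < ?b" using s r by auto
    have "(?a - ?b)\<^sup>2 * D ^ \<gamma> \<le> (?a - ?b)\<^sup>2 * (?a + ?b)\<^sup>2"
      unfolding r2[symmetric] using ab by (intro mult_left_mono power_mono) auto
    also have "\<dots> = (w x ^ \<gamma> - D ^ \<gamma>)\<^sup>2"
      unfolding s2[symmetric] r2[symmetric] power_mult_distrib[symmetric]
      by (intro arg_cong[where f="\<lambda>y. y\<^sup>2"]) (simp add: power2_eq_square algebra_simps)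
    finally have "(?a - ?b)\<^sup>2 \<le> (w x ^ \<gamma> - D ^ \<gamma>)\<^sup>2 / D ^ \<gamma>"
      using D by (simp add: pos_le_divide_eq)
    then have "(?a - ?b)\<^sup>2 * (w x / w x ^ \<gamma>) \<le> (w x ^ \<gamma> - D ^ \<gamma>)\<^sup>2 / D ^ \<gamma> * (w x / w x ^ \<gamma>)"
      using w_pos[of x] by (intro mult_right_mono) auto
    moreover have "(f x)\<^sup>2 = (?a - ?b)\<^sup>2 * (w x / w x ^ \<gamma>)"
      using w_pos[of x] by (simp add: f_def power_mult_distrib power_divide s2 less_imp_le)
    ultimately show "(f x)\<^sup>2 \<le> (w x ^ \<gamma> - D ^ \<gamma>)\<^sup>2 * (w x / w x ^ \<gamma>) / D ^ \<gamma>" by (simp add: mult_ac)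
  next
    show "(\<lambda>x. (w x ^ \<gamma> - D ^ \<gamma>)\<^sup>2 * (w x / w x ^ \<gamma>) / D ^ \<gamma>) \<in> C_torus d 0"
      using w_pos D by (intro C_torus_0_divide C0_intros w_C0) (auto simp: less_imp_neq[symmetric])
  qed (intro C0_intros fC)
  also have "\<dots> = torus_mean d (\<lambda>x. (w x ^ \<gamma> - D ^ \<gamma>)\<^sup>2 * (w x / w x ^ \<gamma>)) / D ^ \<gamma>"
    by (rule torus_mean_divide)
  finally show ?thesis
    unfolding D_def using ratio_pos by (simp add: mult_right_mono torus_mean_nonneg less_imp_le)
qed

end

lemma eventually_le_cmult_nat:
  fixes c M :: real
  assumes "c > 0" shows "\<forall>\<^sub>F d in sequentially. M \<le> c * (real d / 2)"
proof -
  have "filterlim (\<lambda>d. (c / 2) * real d) at_top sequentially"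
    using assms by (intro filterlim_tendsto_pos_mult_at_top[OF tendsto_const] filterlim_real_sequentially) auto
  then have "\<forall>\<^sub>F d in sequentially. M \<le> (c / 2) * real d"
    by (simp add: filterlim_at_top)
  then show ?thesis by (simp add: field_simps)
qed

text \<open>
  The sum of \<open>hardy_radial\<close>, \<open>hardy_poincare\<close> and \<open>hardy_mean_bound\<close>: all multiples of
  \<open>B = E \<psi>\<^sup>2 w ^ \<gamma> / w\<close> on the right-hand side are \<open>o(d) B\<close> and can be absorbed on the left, and the
  gradient term has a coefficient close to \<open>1\<close> when \<open>\<theta>\<close> is small.
\<close>
proposition hardy_inequality_asymptotic:
  assumes \<epsilon>: "0 < \<epsilon>"
  shows "\<forall>\<^sub>F d in sequentially. \<forall>\<delta> \<psi> \<psi>'. 0 < \<delta> \<longrightarrow> \<delta> \<le> 1 \<longrightarrow> torus_diff d \<psi> \<psi>' \<longrightarrow> torus_mean d \<psi> = 0 \<longrightarrow>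
    (1 - \<epsilon>) * (real d / 2) * torus_mean d (\<lambda>x. (\<psi> x)\<^sup>2 * ((weight d x + \<delta>) ^ \<gamma> / (weight d x + \<delta>)))
      \<le> torus_mean d (\<lambda>x. (\<Sum>j<d. (\<psi>' j x)\<^sup>2) * (weight d x + \<delta>) ^ \<gamma>)"
proof -
  \<comment> \<open>The coefficient of the gradient term becomes \<open>1 + \<epsilon> / 2\<close>; the remaining terms get \<open>\<epsilon> / 2\<close> of the left-hand side\<close>
  define \<theta> where "\<theta> = \<epsilon> / (2 + real \<gamma>)"
  have \<theta>: "\<theta> > 0" "(1 + real \<gamma> / 2) * \<theta> = \<epsilon> / 2" using \<epsilon> by (auto simp: \<theta>_def field_simps)
  define \<eta> where "\<eta> = \<epsilon> / 4"
  have \<eta>: "\<eta> > 0" using \<epsilon> by (simp add: \<eta>_def)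
  define M where "M = real \<gamma> / (2 * \<theta>) + (real \<gamma>)\<^sup>2 / 4 + (1 / \<theta> + 1)"
  have "\<forall>\<^sub>F d in sequentially. M \<le> \<eta> * (real d / 2)"
    by (rule eventually_le_cmult_nat[OF \<eta>])
  then show ?thesis
    using weight_concentration[OF \<eta>, of \<gamma>] eventually_gt_at_top[of 0]
  proof eventually_elim
    case (elim d)
    show ?case
    proof (intro allI impI)
      fix \<delta> :: real and \<psi> \<psi>'
      assume \<delta>: "0 < \<delta>" "\<delta> \<le> 1" and \<psi>: "torus_diff d \<psi> \<psi>'" and mz: "torus_mean d \<psi> = 0"
      interpret shifted_weight d \<delta> by standard (rule \<delta>)
      define D where "D = real d / 2"
      have D: "D > 0" using elim(3) by (simp add: D_def)
      define A where "A = torus_mean d (\<lambda>x. ratio \<gamma> x * (w x * (\<Sum>j<d. (\<psi>' j x)\<^sup>2)))"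
      define B where "B = torus_mean d (\<lambda>x. ratio \<gamma> x * (\<psi> x)\<^sup>2)"
      define U where "U = torus_mean d (\<lambda>x. ratio \<gamma> x * (w x * (\<psi> x)\<^sup>2))"
      define m where "m = torus_mean d (\<lambda>x. \<psi> x * sqrt (w x) ^ \<gamma>)"
      have B0: "0 \<le> B" unfolding B_def
        using ratio_pos by (intro torus_mean_nonneg mult_nonneg_nonneg) (auto intro: less_imp_le)
      have A0: "0 \<le> A" unfolding A_def
        using ratio_pos w_pos by (intro torus_mean_nonneg mult_nonneg_nonneg sum_nonneg) (auto intro: less_imp_le)
      have 1: "D * B \<le> U + \<theta> * A + (1 / \<theta> + 1) * B"
        using hardy_radial[OF \<psi> \<theta>(1), of \<gamma>] by (simp only: A_def B_def U_def D_def)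
      have 2: "U \<le> m\<^sup>2 + (1 + real \<gamma> / 2 * \<theta>) * A + (real \<gamma> / (2 * \<theta>) + (real \<gamma>)\<^sup>2 / 4) * B"
        using hardy_poincare[OF \<psi> \<theta>(1), of \<gamma>] by (simp only: A_def B_def U_def m_def)
      have "torus_mean d (\<lambda>x. (w x ^ \<gamma> - D ^ \<gamma>)\<^sup>2 * (w x / w x ^ \<gamma>)) / D ^ \<gamma> \<le> \<eta> * D ^ Suc \<gamma> / D ^ \<gamma>"
        using elim(2) \<delta> D unfolding D_def w_def by (intro divide_right_mono) auto
      also have "\<dots> = \<eta> * D" using D by simp
      finally have "m\<^sup>2 \<le> \<eta> * D * B"
        using hardy_mean_bound[OF torus_diff_C0[OF \<psi>] mz elim(3), of \<gamma>] mult_right_mono[OF _ B0]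
        unfolding m_def B_def D_def by (meson order_trans)
      moreover have "M * B \<le> \<eta> * D * B"
        using elim(1) B0 unfolding D_def by (intro mult_right_mono) auto
      moreover have "D * B \<le> m\<^sup>2 + (1 + (1 + real \<gamma> / 2) * \<theta>) * A + M * B"
        using 1 2 unfolding M_def by (simp add: algebra_simps)
      ultimately have "D * B \<le> (1 + \<epsilon> / 2) * A + \<epsilon> / 2 * (D * B)"
        unfolding \<theta>(2) \<eta>_def by (simp add: algebra_simps)
      then have "(1 - \<epsilon> / 2) * (D * B) \<le> (1 + \<epsilon> / 2) * A" by (simp add: algebra_simps)
      moreover have "(1 + \<epsilon> / 2) * ((1 - \<epsilon>) * (D * B)) \<le> (1 - \<epsilon> / 2) * (D * B)"
      proof -
        have "(1 + \<epsilon> / 2) * (1 - \<epsilon>) \<le> 1 - \<epsilon> / 2" by (simp add: algebra_simps)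
        then show ?thesis using D B0 by (simp only: mult.assoc[symmetric]) (intro mult_right_mono, auto)
      qed
      ultimately have "(1 + \<epsilon> / 2) * ((1 - \<epsilon>) * (D * B)) \<le> (1 + \<epsilon> / 2) * A" by linarith
      then have "(1 - \<epsilon>) * (D * B) \<le> A" using \<epsilon> by (simp add: mult_le_cancel_left_pos)
      moreover have "A = torus_mean d (\<lambda>x. (\<Sum>j<d. (\<psi>' j x)\<^sup>2) * (weight d x + \<delta>) ^ \<gamma>)"
        unfolding A_def mult.assoc[symmetric] ratio_mult by (simp only: w_def mult.commute)
      moreover have "B = torus_mean d (\<lambda>x. (\<psi> x)\<^sup>2 * ((weight d x + \<delta>) ^ \<gamma> / (weight d x + \<delta>)))"
        unfolding B_def ratio_def w_def by (simp only: mult.commute)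
      ultimately show "(1 - \<epsilon>) * (real d / 2) * torus_mean d (\<lambda>x. (\<psi> x)\<^sup>2 * ((weight d x + \<delta>) ^ \<gamma> / (weight d x + \<delta>)))
        \<le> torus_mean d (\<lambda>x. (\<Sum>j<d. (\<psi>' j x)\<^sup>2) * (weight d x + \<delta>) ^ \<gamma>)"
        unfolding D_def by (simp only: mult.assoc)
    qed
  qed
qed

section \<open>The Rellich inequality and its iteration\<close>

text \<open>
  Integrating \<open>|\<nabla>\<psi>|\<^sup>2 w ^ g\<close> by parts gives \<open>- \<psi> \<Delta>\<psi> w ^ g\<close> and a term with \<open>\<nabla>w\<close>.  Young's
  inequality with parameter \<open>\<mu>\<close> bounds the former by \<open>(\<Delta>\<psi>)\<^sup>2 w ^ (g + 1) / (2 \<mu>)\<close> and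
  \<open>\<mu> / 2\<close> times \<open>\<psi>\<^sup>2 w ^ g / w\<close>, and the Hardy inequality absorbs the latter into half of the left-hand
  side.  For the Laplacian to carry the power \<open>\<gamma> = 1\<close> the Hardy inequality is needed for the weight
  \<open>w ^ 0\<close>, that is with \<open>1 / w\<close> on its left-hand side.
\<close>
lemma (in shifted_weight) rellich_from_hardy:
  assumes \<psi>: "torus_diff d \<psi> \<psi>'" and \<psi>': "\<And>j. j < d \<Longrightarrow> torus_diff d (\<psi>' j) (\<psi>'' j)"
    and \<mu>: "\<mu> > 0" and \<theta>: "\<theta> > 0"
    and hardy: "\<mu> * torus_mean d (\<lambda>x. ratio g x * (\<psi> x)\<^sup>2) \<le> torus_mean d (\<lambda>x. (\<Sum>j<d. (\<psi>' j x)\<^sup>2) * w x ^ g)"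
  shows "\<mu> * (1 - real g * \<theta> - real g / (\<theta> * \<mu>)) * torus_mean d (\<lambda>x. (\<Sum>j<d. (\<psi>' j x)\<^sup>2) * w x ^ g)
    \<le> torus_mean d (\<lambda>x. (\<Sum>j<d. \<psi>'' j j x)\<^sup>2 * w x ^ Suc g)"
proof -
  note p0 = torus_diff_C0[OF \<psi>] and p1 = torus_diff_C0'[OF \<psi>]
  have p2: "\<psi>'' j j \<in> C_torus d 0" if "j < d" for j by (rule torus_diff_C0'[OF \<psi>'[OF that] that])
  define L where "L = (\<lambda>x. \<Sum>j<d. \<psi>'' j j x)"
  define G where "G = (\<lambda>x. \<Sum>j<d. (\<psi>' j x)\<^sup>2)"
  define A where "A = (\<lambda>x. (L x)\<^sup>2 * w x ^ Suc g)"
  define B where "B = (\<lambda>x. G x * w x ^ g)"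
  define C where "C = (\<lambda>x. ratio g x * (\<psi> x)\<^sup>2)"
  have c: "L \<in> C_torus d 0" "G \<in> C_torus d 0" "A \<in> C_torus d 0" "B \<in> C_torus d 0" "C \<in> C_torus d 0"
    unfolding A_def B_def C_def L_def G_def by (intro C0_intros p0 p1 p2 ratio_C0 w_C0; simp)+
  have "((\<lambda>t. t ^ g) has_real_derivative real g * (t ^ g / t)) (at t)" if "t > 0" for t :: real
    using DERIV_pow[of g t UNIV] that by (cases g) auto
  then have wg: "torus_diff d (\<lambda>x. w x ^ g) (\<lambda>j x. real g * (w x ^ g / w x) * dw j x)"
    by (intro torus_diff_fun_w[where g="\<lambda>t. t ^ g" and g'="\<lambda>t. real g * (t ^ g / t)"])
       (auto intro!: continuous_intros)
  \<comment> \<open>\<open>F j\<close> is the derivative of \<open>\<psi> * w ^ g * \<psi>' j\<close> in the direction \<open>j\<close>, so it has mean zero\<close>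
  define F where "F = (\<lambda>j x. (\<psi>' j x * w x ^ g + \<psi> x * (real g * (w x ^ g / w x) * dw j x)) * \<psi>' j x + \<psi> x * w x ^ g * \<psi>'' j j x)"
  have tF: "torus_diff d (\<lambda>x. \<psi> x * w x ^ g * \<psi>' j x)
     (\<lambda>i x. (\<psi>' i x * w x ^ g + \<psi> x * (real g * (w x ^ g / w x) * dw i x)) * \<psi>' j x + \<psi> x * w x ^ g * \<psi>'' j i x)"
    if "j < d" for j
    by (intro torus_diff_mult \<psi> wg \<psi>' that)
  have F: "F j \<in> C_torus d 0" "torus_mean d (F j) = 0" if "j < d" for j
    unfolding F_def using torus_diff_C0'[OF tF[OF that] that] torus_mean_derivative[OF tF[OF that] that] by auto
  have "torus_mean d B = torus_mean d B - torus_mean d (\<lambda>x. \<Sum>j<d. F j x)"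
    by (subst torus_mean_sum) (use F in auto)
  also have "\<dots> = torus_mean d (\<lambda>x. B x - (\<Sum>j<d. F j x))"
    using F by (intro torus_mean_diff[symmetric] C0_intros c) auto
  also have "\<dots> \<le> torus_mean d (\<lambda>x. (real g * \<theta> / 2) * B x + (real g / (2 * \<theta>) + \<mu> / 2) * C x + 1 / (2 * \<mu>) * A x)"
  proof (rule torus_mean_mono)
    fix x
    let ?S = "\<Sum>j<d. \<psi>' j x * dw j x" and ?r = "ratio g x"
    have r: "0 \<le> ?r" "0 < w x" using ratio_pos[of g x] w_pos[of x] by auto
    have "(\<Sum>j<d. F j x) = (\<Sum>j<d. w x ^ g * (\<psi>' j x)\<^sup>2 + real g * ?r * \<psi> x * (\<psi>' j x * dw j x) + \<psi> x * w x ^ g * \<psi>'' j j x)"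
      unfolding F_def ratio_def by (intro sum.cong refl) (simp add: power2_eq_square distrib_right distrib_left mult_ac)
    also have "\<dots> = w x ^ g * G x + real g * ?r * \<psi> x * ?S + \<psi> x * w x ^ g * L x"
      by (simp only: sum.distrib sum_distrib_left[symmetric] G_def L_def)
    finally have eq: "B x - (\<Sum>j<d. F j x) = (real g / 2) * (- (?r * (2 * (\<psi> x * ?S)))) - ?r * w x * (\<psi> x * L x)"
      unfolding B_def ratio_mult by (simp add: algebra_simps)
    have "- (?r * (2 * (\<psi> x * ?S))) \<le> ?r * (2 * \<bar>\<psi> x * ?S\<bar>)"
      using r mult_left_mono[of "- (2 * (\<psi> x * ?S))" "2 * \<bar>\<psi> x * ?S\<bar>" ?r] by linarith
    also have "\<dots> \<le> ?r * (\<theta> * (w x * (\<Sum>j<d. (\<psi>' j x)\<^sup>2)) + (\<psi> x)\<^sup>2 / \<theta>)"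
      by (intro mult_left_mono cross_term_bound dw_sq \<theta> r)
    also have "\<dots> = \<theta> * B x + 1 / \<theta> * C x"
      unfolding B_def C_def ratio_mult[symmetric] G_def by (simp add: algebra_simps)
    finally have 1: "(real g / 2) * (- (?r * (2 * (\<psi> x * ?S)))) \<le> (real g / 2) * (\<theta> * B x + 1 / \<theta> * C x)"
      by (intro mult_left_mono) auto
    have young: "- (v * (p * l)) \<le> 1 / (2 * \<mu>) * (l\<^sup>2 * (v * v)) + \<mu> / 2 * p\<^sup>2" for v p l
    proof -
      have "0 \<le> (l * v + \<mu> * p)\<^sup>2 / (2 * \<mu>)" using \<mu> by simp
      also have "\<dots> = 1 / (2 * \<mu>) * (l\<^sup>2 * (v * v)) + \<mu> / 2 * p\<^sup>2 + v * (p * l)"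
        using \<mu> by (simp add: power2_eq_square field_simps)
      finally show ?thesis by linarith
    qed
    have "- (?r * w x * (\<psi> x * L x)) = ?r * (- (w x * (\<psi> x * L x)))" by simp
    also have "\<dots> \<le> ?r * (1 / (2 * \<mu>) * ((L x)\<^sup>2 * (w x * w x)) + \<mu> / 2 * (\<psi> x)\<^sup>2)"
      by (intro mult_left_mono young r)
    also have "\<dots> = 1 / (2 * \<mu>) * A x + \<mu> / 2 * C x"
      unfolding A_def C_def power_Suc ratio_mult[symmetric] by (simp add: algebra_simps)
    finally have 2: "- (?r * w x * (\<psi> x * L x)) \<le> 1 / (2 * \<mu>) * A x + \<mu> / 2 * C x" .
    have "(real g / 2) * (\<theta> * B x + 1 / \<theta> * C x) + (1 / (2 * \<mu>) * A x + \<mu> / 2 * C x)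
        = (real g * \<theta> / 2) * B x + (real g / (2 * \<theta>) + \<mu> / 2) * C x + 1 / (2 * \<mu>) * A x"
      using \<theta> \<mu> by (simp add: field_simps)
    then show "B x - (\<Sum>j<d. F j x) \<le> (real g * \<theta> / 2) * B x + (real g / (2 * \<theta>) + \<mu> / 2) * C x + 1 / (2 * \<mu>) * A x"
      unfolding eq using 1 2 by linarith
  next
    show "(\<lambda>x. B x - (\<Sum>j<d. F j x)) \<in> C_torus d 0" using F by (intro C0_intros c) auto
  qed (intro C0_intros c)
  also have "\<dots> = (real g * \<theta> / 2) * torus_mean d B + (real g / (2 * \<theta>) + \<mu> / 2) * torus_mean d C + 1 / (2 * \<mu>) * torus_mean d A"
    by (subst torus_mean_add torus_mean_cmult | (intro C0_intros c)[1])+ simp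
  also have "(real g / (2 * \<theta>) + \<mu> / 2) * torus_mean d C \<le> (real g / (2 * \<theta>) + \<mu> / 2) * (torus_mean d B / \<mu>)"
    using hardy \<mu> \<theta> by (intro mult_left_mono) (auto simp: B_def C_def G_def pos_le_divide_eq mult.commute)
  finally have "torus_mean d B \<le> (real g * \<theta> / 2) * torus_mean d B + (real g / (2 * \<theta>) + \<mu> / 2) * (torus_mean d B / \<mu>) + 1 / (2 * \<mu>) * torus_mean d A"
    by simp
  then have "2 * \<mu> * torus_mean d B \<le> 2 * \<mu> * ((real g * \<theta> / 2) * torus_mean d B + (real g / (2 * \<theta>) + \<mu> / 2) * (torus_mean d B / \<mu>) + 1 / (2 * \<mu>) * torus_mean d A)"
    using \<mu> by (intro mult_left_mono) auto
  also have "\<dots> = \<mu> * (real g * \<theta> + real g / (\<theta> * \<mu>) + 1) * torus_mean d B + torus_mean d A"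
    using \<mu> \<theta> by (simp add: field_simps)
  finally have fin: "2 * \<mu> * torus_mean d B \<le> \<mu> * (real g * \<theta> + real g / (\<theta> * \<mu>) + 1) * torus_mean d B + torus_mean d A" .
  have "m * (1 - a - b) * X \<le> Y" if "2 * m * X \<le> m * (a + b + 1) * X + Y" for m a b X Y :: real
    using that by (simp add: algebra_simps)
  from this[OF fin] show ?thesis
    unfolding A_def B_def L_def G_def .
qed

proposition rellich_inequality_asymptotic:
  assumes \<epsilon>: "0 < \<epsilon>" "\<epsilon> < 1"
  shows "\<forall>\<^sub>F d in sequentially. \<forall>\<delta> \<psi> \<psi>' \<psi>''. 0 < \<delta> \<longrightarrow> \<delta> \<le> 1 \<longrightarrow> torus_diff d \<psi> \<psi>' \<longrightarrow>
    (\<forall>j<d. torus_diff d (\<psi>' j) (\<psi>'' j)) \<longrightarrow> torus_mean d \<psi> = 0 \<longrightarrow>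
    (1 - \<epsilon>) * (real d / 2) * torus_mean d (\<lambda>x. (\<Sum>j<d. (\<psi>' j x)\<^sup>2) * (weight d x + \<delta>) ^ g)
      \<le> torus_mean d (\<lambda>x. (\<Sum>j<d. \<psi>'' j j x)\<^sup>2 * (weight d x + \<delta>) ^ Suc g)"
proof -
  \<comment> \<open>One third of \<open>\<epsilon>\<close> is spent on each of the Hardy constant, the \<open>\<theta>\<close> term and the \<open>1 / \<theta>\<close> term\<close>
  define \<theta> where "\<theta> = \<epsilon> / (3 * (real g + 1))"
  have \<theta>: "\<theta> > 0" "real g * \<theta> \<le> \<epsilon> / 3" using \<epsilon> by (auto simp: \<theta>_def field_simps)
  have e3: "\<epsilon> / 3 > 0" using \<epsilon> by simp
  have "\<forall>\<^sub>F d in sequentially. 3 * real g / (\<theta> * \<epsilon>) \<le> (1 - \<epsilon> / 3) * (real d / 2)"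
    using \<epsilon> by (intro eventually_le_cmult_nat) auto
  then show ?thesis
    using hardy_inequality_asymptotic[OF e3, of g] eventually_gt_at_top[of 0]
  proof eventually_elim
    case (elim d)
    show ?case
    proof (intro allI impI)
      fix \<delta> :: real and \<psi> \<psi>' \<psi>''
      assume \<delta>: "0 < \<delta>" "\<delta> \<le> 1" and \<psi>: "torus_diff d \<psi> \<psi>'"
        and \<psi>': "\<forall>j<d. torus_diff d (\<psi>' j) (\<psi>'' j)" and mz: "torus_mean d \<psi> = 0"
      interpret shifted_weight d \<delta> by standard (rule \<delta>)
      define \<mu> where "\<mu> = (1 - \<epsilon> / 3) * (real d / 2)"
      have \<mu>: "\<mu> > 0" using elim(3) \<epsilon> by (simp add: \<mu>_def)
      let ?B = "torus_mean d (\<lambda>x. (\<Sum>j<d. (\<psi>' j x)\<^sup>2) * w x ^ g)"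
      have "\<mu> * torus_mean d (\<lambda>x. ratio g x * (\<psi> x)\<^sup>2) \<le> ?B"
        using elim(2)[rule_format, OF \<delta> \<psi> mz] unfolding \<mu>_def ratio_def w_def by (simp only: mult.commute)
      from rellich_from_hardy[OF \<psi> \<psi>'[rule_format] \<mu> \<theta>(1) this]
      have R: "\<mu> * (1 - real g * \<theta> - real g / (\<theta> * \<mu>)) * ?B \<le> torus_mean d (\<lambda>x. (\<Sum>j<d. \<psi>'' j j x)\<^sup>2 * w x ^ Suc g)" .
      have "3 * real g \<le> \<mu> * (\<theta> * \<epsilon>)"
        using elim(1) \<theta> \<epsilon> unfolding \<mu>_def[symmetric] by (simp add: pos_divide_le_eq)
      then have "real g / (\<theta> * \<mu>) \<le> \<epsilon> / 3" using \<theta> \<mu> by (simp add: field_simps)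
      then have "(1 - \<epsilon>) * (real d / 2) \<le> \<mu> * (1 - real g * \<theta> - real g / (\<theta> * \<mu>))"
      proof -
        assume a: "real g / (\<theta> * \<mu>) \<le> \<epsilon> / 3"
        have "(1 - \<epsilon>) * (real d / 2) \<le> ((1 - \<epsilon> / 3) * (1 - 2 * \<epsilon> / 3)) * (real d / 2)"
          by (intro mult_right_mono) (auto simp: algebra_simps)
        also have "\<dots> = \<mu> * (1 - 2 * \<epsilon> / 3)" by (simp add: \<mu>_def)
        also have "\<dots> \<le> \<mu> * (1 - real g * \<theta> - real g / (\<theta> * \<mu>))"
        proof (rule mult_left_mono)
          show "1 - 2 * \<epsilon> / 3 \<le> 1 - real g * \<theta> - real g / (\<theta> * \<mu>)" using a \<theta>(2) by linarith
        qed (use \<mu> in simp)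
        finally show ?thesis .
      qed
      then have "(1 - \<epsilon>) * (real d / 2) * ?B \<le> \<mu> * (1 - real g * \<theta> - real g / (\<theta> * \<mu>)) * ?B"
        using w_pos by (intro mult_right_mono torus_mean_nonneg mult_nonneg_nonneg sum_nonneg) (auto intro: less_imp_le)
      with R show "(1 - \<epsilon>) * (real d / 2) * torus_mean d (\<lambda>x. (\<Sum>j<d. (\<psi>' j x)\<^sup>2) * (weight d x + \<delta>) ^ g)
          \<le> torus_mean d (\<lambda>x. (\<Sum>j<d. \<psi>'' j j x)\<^sup>2 * (weight d x + \<delta>) ^ Suc g)"
        unfolding w_def by linarith
    qed
  qed
qed

lemma norm_D_sq_even: "(norm_D d (2 * m) f x)\<^sup>2 = ((laplacian d ^^ m) f x)\<^sup>2"
  by (simp add: norm_D_def)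

lemma norm_D_sq_odd: "(norm_D d (Suc (2 * m)) f x)\<^sup>2 = (\<Sum>j<d. (pderiv_at j ((laplacian d ^^ m) f) x)\<^sup>2)"
  by (simp add: norm_D_def L2_set_def gradient_def sum_nonneg)

lemma laplacian_pow_C_torus:
  "f \<in> C_torus d (2 * m + k) \<Longrightarrow> (laplacian d ^^ m) f \<in> C_torus d k"
proof (induction m arbitrary: k)
  case (Suc m)
  have "(laplacian d ^^ m) f \<in> C_torus d (Suc (Suc k))"
    using Suc.prems by (intro Suc.IH) simp
  then show ?case by (simp add: C_torus_laplacian)
qed simp

lemma laplacian_pow_mean:
  assumes "f \<in> C_torus d (2 * m)" "torus_mean d f = 0"
  shows "torus_mean d ((laplacian d ^^ m) f) = 0"
proof (cases m)
  case (Suc n)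
  then show ?thesis
    using torus_mean_laplacian[of "(laplacian d ^^ n) f" d 0] laplacian_pow_C_torus[of f d n 2] assms
    by (simp add: numeral_2_eq_2)
qed (use assms in simp)

lemma parity_cases:
  obtains m where "j = 2 * m" | m where "j = Suc (2 * m)"
  by (metis evenE oddE Suc_eq_plus1)

lemma norm_D_sq_C0:
  assumes f: "f \<in> C_torus d k" and j: "j \<le> k"
  shows "(\<lambda>x. (norm_D d j f x)\<^sup>2) \<in> C_torus d 0"
proof (cases j rule: parity_cases)
  case (1 m)
  have "(laplacian d ^^ m) f \<in> C_torus d 0"
    by (rule laplacian_pow_C_torus) (rule C_torus_mono[OF f], use 1 j in simp)
  then show ?thesis unfolding 1 norm_D_sq_even by (rule C_torus_0_power)
next
  case (2 m)
  have "(laplacian d ^^ m) f \<in> C_torus d (Suc 0)"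
    by (rule laplacian_pow_C_torus) (rule C_torus_mono[OF f], use 2 j in simp)
  then show ?thesis unfolding 2 norm_D_sq_odd
    by (intro C0_intros C_torus_pderiv) auto
qed

text \<open>
  The passage from \<open>D\<^sup>j\<close> to \<open>D\<^bsup>j+1\<^esup>\<close>, which is an instance of the Hardy or of the Rellich
  inequality according to the parity of \<open>j\<close>.
\<close>
definition one_step_bound :: "real \<Rightarrow> nat \<Rightarrow> nat \<Rightarrow> bool" where
  "one_step_bound c d m \<longleftrightarrow> (\<forall>\<delta> k f j. 0 < \<delta> \<longrightarrow> \<delta> \<le> 1 \<longrightarrow> f \<in> C_torus d k \<longrightarrow> torus_mean d f = 0 \<longrightarrow> j < k \<longrightarrow>
     c * torus_mean d (\<lambda>x. (norm_D d j f x)\<^sup>2 * (weight d x + \<delta>) ^ m)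
       \<le> torus_mean d (\<lambda>x. (norm_D d (Suc j) f x)\<^sup>2 * (weight d x + \<delta>) ^ Suc m))"

lemma eventually_one_step_bound:
  assumes \<epsilon>: "0 < \<epsilon>" "\<epsilon> < 1"
  shows "\<forall>\<^sub>F d in sequentially. one_step_bound ((1 - \<epsilon>) * (real d / 2)) d m"
  using hardy_inequality_asymptotic[OF \<epsilon>(1), of "Suc m"] rellich_inequality_asymptotic[OF \<epsilon>, of m]
proof eventually_elim
  case (elim d)
  show ?case
    unfolding one_step_bound_def
  proof (intro allI impI)
    fix \<delta> :: real and k f j
    assume \<delta>: "0 < \<delta>" "\<delta> \<le> 1" and f: "f \<in> C_torus d k" and mz: "torus_mean d f = 0" and j: "j < k"
    have w: "weight d x + \<delta> \<noteq> 0" for x using shifted_weight_pos[OF \<delta>(1), of d x] by simp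
    show "(1 - \<epsilon>) * (real d / 2) * torus_mean d (\<lambda>x. (norm_D d j f x)\<^sup>2 * (weight d x + \<delta>) ^ m)
       \<le> torus_mean d (\<lambda>x. (norm_D d (Suc j) f x)\<^sup>2 * (weight d x + \<delta>) ^ Suc m)"
    proof (cases j rule: parity_cases)
      case (1 n)
      let ?g = "(laplacian d ^^ n) f"
      have g: "?g \<in> C_torus d (Suc 0)"
        by (rule laplacian_pow_C_torus) (rule C_torus_mono[OF f], use 1 j in simp)
      have gm: "torus_mean d ?g = 0"
        by (rule laplacian_pow_mean[OF _ mz]) (rule C_torus_mono[OF f], use 1 j in simp)
      have q: "(weight d x + \<delta>) ^ Suc m / (weight d x + \<delta>) = (weight d x + \<delta>) ^ m" for x
        using w[of x] by simp
      show ?thesis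
        using elim(1)[rule_format, OF \<delta> C_torus_torus_diff[OF g] gm]
        unfolding 1 norm_D_sq_even norm_D_sq_odd q .
    next
      case (2 n)
      let ?g = "(laplacian d ^^ n) f"
      have g: "?g \<in> C_torus d (Suc (Suc 0))"
        by (rule laplacian_pow_C_torus) (rule C_torus_mono[OF f], use 2 j in simp)
      have gm: "torus_mean d ?g = 0"
        by (rule laplacian_pow_mean[OF _ mz]) (rule C_torus_mono[OF f], use 2 j in simp)
      have j2: "Suc (Suc (2 * n)) = 2 * Suc n" by simp
      have "(1 - \<epsilon>) * (real d / 2) * torus_mean d (\<lambda>x. (\<Sum>j<d. (pderiv_at j ?g x)\<^sup>2) * (weight d x + \<delta>) ^ m)
          \<le> torus_mean d (\<lambda>x. (\<Sum>j<d. pderiv_at j (pderiv_at j ?g) x)\<^sup>2 * (weight d x + \<delta>) ^ Suc m)"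
      proof -
        have t1: "torus_diff d ?g (\<lambda>j. pderiv_at j ?g)"
          by (rule C_torus_torus_diff[OF C_torus_SucD[OF g]])
        have t2: "\<forall>j<d. torus_diff d (pderiv_at j ?g) (\<lambda>i. pderiv_at i (pderiv_at j ?g))"
          by (intro allI impI) (rule C_torus_torus_diff[OF C_torus_pderiv[OF g]])
        from elim(2)[THEN spec[of _ \<delta>], THEN spec[of _ ?g], THEN spec[of _ "\<lambda>j. pderiv_at j ?g"],
          THEN spec[of _ "\<lambda>j i. pderiv_at i (pderiv_at j ?g)"]] \<delta> t1 t2 gm
        show ?thesis by simp
      qed
      then show ?thesis
        unfolding 2 j2 norm_D_sq_even norm_D_sq_odd by (simp only: funpow.simps o_apply laplacian_def)
    qed
  qed
qed

lemma iterated_bound: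
  assumes step: "\<And>m. m < M \<Longrightarrow> one_step_bound c d m" and c: "0 \<le> c"
    and \<delta>: "0 < \<delta>" "\<delta> \<le> 1" and f: "f \<in> C_torus d k" and mz: "torus_mean d f = 0"
    and "l + i \<le> k" "m + i \<le> M"
  shows "c ^ i * torus_mean d (\<lambda>x. (norm_D d l f x)\<^sup>2 * (weight d x + \<delta>) ^ m)
    \<le> torus_mean d (\<lambda>x. (norm_D d (l + i) f x)\<^sup>2 * (weight d x + \<delta>) ^ (m + i))"
  using assms(7,8)
proof (induction i)
  case (Suc i)
  have "c ^ Suc i * torus_mean d (\<lambda>x. (norm_D d l f x)\<^sup>2 * (weight d x + \<delta>) ^ m)
      = c * (c ^ i * torus_mean d (\<lambda>x. (norm_D d l f x)\<^sup>2 * (weight d x + \<delta>) ^ m))" by simp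
  also have "\<dots> \<le> c * torus_mean d (\<lambda>x. (norm_D d (l + i) f x)\<^sup>2 * (weight d x + \<delta>) ^ (m + i))"
    using Suc c by (intro mult_left_mono) auto
  also have "\<dots> \<le> torus_mean d (\<lambda>x. (norm_D d (Suc (l + i)) f x)\<^sup>2 * (weight d x + \<delta>) ^ Suc (m + i))"
    using step[of "m + i"] Suc.prems \<delta> f mz unfolding one_step_bound_def by auto
  finally show ?case by (simp only: add_Suc_right)
qed simp

lemma shifted_weight_limit:
  assumes N: "N \<in> C_torus d 0"
  shows "(\<lambda>n. torus_mean d (\<lambda>x. N x * (weight d x + inverse (real (Suc n))) ^ m)) \<longlonglongrightarrow> torus_mean d (\<lambda>x. N x * weight d x ^ m)"
  unfolding torus_mean_def
proof (rule integral_dominated_convergence)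
  show "(\<lambda>x. N x * weight d x ^ m) \<in> borel_measurable (torus_measure d)"
    by (intro C_torus_0_measurable C0_intros N)
  show "(\<lambda>x. N x * (weight d x + inverse (real (Suc n))) ^ m) \<in> borel_measurable (torus_measure d)" for n
    by (intro C_torus_0_measurable C0_intros N)
  show "integrable (torus_measure d) (\<lambda>x. \<bar>N x\<bar> * (real d + 1) ^ m)"
    by (intro C_torus_0_integrable C0_intros N)
  show "AE x in torus_measure d. (\<lambda>n. N x * (weight d x + inverse (real (Suc n))) ^ m) \<longlonglongrightarrow> N x * weight d x ^ m"
  proof (rule AE_I2)
    fix x
    have "(\<lambda>n. N x * (weight d x + inverse (real (Suc n))) ^ m) \<longlonglongrightarrow> N x * (weight d x + 0) ^ m"
      by (intro tendsto_intros LIMSEQ_inverse_real_of_nat)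
    then show "(\<lambda>n. N x * (weight d x + inverse (real (Suc n))) ^ m) \<longlonglongrightarrow> N x * weight d x ^ m" by simp
  qed
  show "AE x in torus_measure d. norm (N x * (weight d x + inverse (real (Suc n))) ^ m) \<le> \<bar>N x\<bar> * (real d + 1) ^ m" for n
  proof (rule AE_I2)
    fix x
    have "(weight d x + inverse (real (Suc n))) ^ m \<le> (real d + 1) ^ m"
      using weight_le[of d x] by (intro power_mono add_mono) (auto simp: inverse_eq_divide)
    moreover have "0 \<le> (weight d x + inverse (real (Suc n))) ^ m" by simp
    ultimately show "norm (N x * (weight d x + inverse (real (Suc n))) ^ m) \<le> \<bar>N x\<bar> * (real d + 1) ^ m"
      by (simp add: abs_mult mult_left_mono del: of_nat_Suc)
  qed
qed

text \<open>
  Each of the \<open>i\<close> steps raises the power of the shifted weight by one and the order of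
  differentiation by one.  The shift is removed at the end, by dominated convergence.
\<close>
lemma hardy_rellich_lower_bound:
  assumes \<epsilon>: "0 < \<epsilon>" "\<epsilon> < 1"
  shows "\<forall>\<^sub>F d in sequentially. \<forall>f\<in>C_torus d (l + i). torus_mean d f = 0 \<longrightarrow>
    ((1 - \<epsilon>) * (real d / 2)) ^ i * torus_mean d (\<lambda>x. (norm_D d l f x)\<^sup>2 * weight d x ^ m)
      \<le> torus_mean d (\<lambda>x. (norm_D d (l + i) f x)\<^sup>2 * weight d x ^ (m + i))"
proof -
  have "\<forall>\<^sub>F d in sequentially. \<forall>n\<in>{..<m + i}. one_step_bound ((1 - \<epsilon>) * (real d / 2)) d n"
    using eventually_one_step_bound[OF \<epsilon>] by (intro eventually_ball_finite) auto
  then show ?thesis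
  proof eventually_elim
    case (elim d)
    show ?case
    proof (intro ballI impI)
      fix f assume f: "f \<in> C_torus d (l + i)" and mz: "torus_mean d f = 0"
      let ?c = "(1 - \<epsilon>) * (real d / 2)"
      let ?I = "\<lambda>j m n. torus_mean d (\<lambda>x. (norm_D d j f x)\<^sup>2 * (weight d x + inverse (real (Suc n))) ^ m)"
      have le: "?c ^ i * ?I l m n \<le> ?I (l + i) (m + i) n" for n
        using elim \<epsilon> by (intro iterated_bound[where M="m + i" and k="l + i"] f mz) (auto simp: inverse_eq_divide)
      have 1: "(\<lambda>n. ?c ^ i * ?I l m n) \<longlonglongrightarrow> ?c ^ i * torus_mean d (\<lambda>x. (norm_D d l f x)\<^sup>2 * weight d x ^ m)"
        by (intro tendsto_mult_left shifted_weight_limit norm_D_sq_C0[OF f]) auto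
      have 2: "?I (l + i) (m + i) \<longlonglongrightarrow> torus_mean d (\<lambda>x. (norm_D d (l + i) f x)\<^sup>2 * weight d x ^ (m + i))"
        by (intro shifted_weight_limit norm_D_sq_C0[OF f]) auto
      show "?c ^ i * torus_mean d (\<lambda>x. (norm_D d l f x)\<^sup>2 * weight d x ^ m)
        \<le> torus_mean d (\<lambda>x. (norm_D d (l + i) f x)\<^sup>2 * weight d x ^ (m + i))"
        by (rule LIMSEQ_le[OF 1 2]) (use le in auto)
    qed
  qed
qed

section \<open>The test function and the best constant\<close>

text \<open>
  The divergence formula for \<open>h(x\<^sub>0) \<omega> ^ m\<close>.  Only one partial derivative of \<open>h(x\<^sub>0)\<close> is
  nonzero, therefore the error is smaller than the main terms by a factor of order \<open>1 / d\<close>.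
\<close>
lemma weighted_moment_step:
  assumes h: "\<And>t. (h has_real_derivative h' t) (at t)" and c: "continuous_on UNIV h'"
    and per: "\<And>t. h (t + 2 * pi) = h t" "\<And>t. h' (t + 2 * pi) = h' t"
    and b: "\<And>t. \<bar>h t\<bar> \<le> 1" "\<And>t. \<bar>h' t\<bar> \<le> 1"
  shows "\<bar>torus_mean d (\<lambda>x. h (x 0) * weight d x ^ Suc m) - real d / 2 * torus_mean d (\<lambda>x. h (x 0) * weight d x ^ m)\<bar>
     \<le> (1 + real m) * real d ^ m"
proof -
  define G' where "G' = (\<lambda>(j::nat) (x::nat \<Rightarrow> real). if j = 0 then h' (x 0) else 0)"
  have H: "torus_diff d (\<lambda>x. h (x 0)) G'"
    unfolding G'_def by (rule torus_diff_coordinate[OF h c per])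
  have W: "torus_diff d (weight d) (\<lambda>j x. sin (x j) / 2)"
    using torus_diff_weight[of d 0] by simp
  have P: "torus_diff d (\<lambda>x. weight d x ^ m) (\<lambda>j x. real m * weight d x ^ (m - 1) * (sin (x j) / 2))"
    by (rule torus_diff_comp[OF W, where g="\<lambda>t. t ^ m" and g'="\<lambda>t. real m * t ^ (m - 1)"])
       (use DERIV_pow[of m] in \<open>auto intro!: C0_intros\<close>)
  define F' where "F' = (\<lambda>j x. G' j x * weight d x ^ m + h (x 0) * (real m * weight d x ^ (m - 1) * (sin (x j) / 2)))"
  have F: "torus_diff d (\<lambda>x. h (x 0) * weight d x ^ m) F'"
    unfolding F'_def by (rule torus_diff_mult[OF H P])
  define E where "E = (\<lambda>x. \<Sum>j<d. F' j x * (sin (x j) / 2))"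
  have cE: "E \<in> C_torus d 0"
    unfolding E_def using torus_diff_C0'[OF F] by (intro C0_intros sin_half_C0) auto
  have hC: "(\<lambda>x. h (x 0)) \<in> C_torus d 0" by (rule torus_diff_C0[OF H])
  have "real d / 2 * torus_mean d (\<lambda>x. h (x 0) * weight d x ^ m) - torus_mean d (\<lambda>x. h (x 0) * weight d x ^ Suc m)
      = torus_mean d (\<lambda>x. real d / 2 * (h (x 0) * weight d x ^ m) - h (x 0) * weight d x ^ Suc m)"
    unfolding torus_mean_cmult[symmetric] by (intro torus_mean_diff[symmetric] C0_intros hC)
  also have "\<dots> = torus_mean d (\<lambda>x. h (x 0) * weight d x ^ m * (real d / 2 - weight d x))"
    by (rule torus_mean_cong) (simp add: algebra_simps)
  also have "\<dots> = - torus_mean d E"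
    unfolding E_def by (rule weight_divergence_formula[OF F])
  finally have eq: "torus_mean d (\<lambda>x. h (x 0) * weight d x ^ Suc m) - real d / 2 * torus_mean d (\<lambda>x. h (x 0) * weight d x ^ m) = torus_mean d E"
    by simp
  have "\<bar>E x\<bar> \<le> (1 + real m) * real d ^ m" for x
  proof -
    have w: "0 \<le> weight d x" "weight d x \<le> real d" by (simp, rule weight_le)
    have wp: "weight d x ^ m \<le> real d ^ m" using w by (intro power_mono) auto
    have "E x = (\<Sum>j<d. weight d x ^ m * (G' j x * (sin (x j) / 2)) + h (x 0) * real m * weight d x ^ (m - 1) * (sin (x j) / 2)\<^sup>2)"
      unfolding E_def F'_def by (intro sum.cong refl) (simp add: power2_eq_square algebra_simps)
    also have "\<dots> = weight d x ^ m * (\<Sum>j<d. G' j x * (sin (x j) / 2)) + h (x 0) * real m * weight d x ^ (m - 1) * (\<Sum>j<d. (sin (x j) / 2)\<^sup>2)"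
      by (simp only: sum.distrib sum_distrib_left[symmetric])
    finally have E: "E x = weight d x ^ m * (\<Sum>j<d. G' j x * (sin (x j) / 2)) + h (x 0) * (real m * weight d x ^ (m - 1) * (\<Sum>j<d. (sin (x j) / 2)\<^sup>2))"
      by (simp only: mult.assoc)
    have "\<bar>\<Sum>j<d. G' j x * (sin (x j) / 2)\<bar> \<le> 1"
    proof (cases "d = 0")
      case False
      have "(\<Sum>j<d. G' j x * (sin (x j) / 2)) = (\<Sum>j<d. if j = 0 then h' (x 0) * (sin (x 0) / 2) else 0)"
        unfolding G'_def by (intro sum.cong) auto
      also have "\<dots> = h' (x 0) * (sin (x 0) / 2)" using False by simp
      finally have "\<bar>\<Sum>j<d. G' j x * (sin (x j) / 2)\<bar> = \<bar>h' (x 0)\<bar> * (\<bar>sin (x 0)\<bar> / 2)"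
        by (simp only: abs_mult abs_divide abs_numeral)
      also have "\<dots> \<le> 1 * 1"
      proof (intro mult_mono b)
        show "\<bar>sin (x 0)\<bar> / 2 \<le> 1" using abs_sin_le_one[of "x 0"] by linarith
      qed auto
      finally show ?thesis by simp
    qed simp
    then have 1: "\<bar>weight d x ^ m * (\<Sum>j<d. G' j x * (sin (x j) / 2))\<bar> \<le> real d ^ m * 1"
      unfolding abs_mult using wp w by (intro mult_mono) auto
    have "real m * weight d x ^ (m - 1) * (\<Sum>j<d. (sin (x j) / 2)\<^sup>2) \<le> real m * real d ^ m"
    proof (cases m)
      case (Suc n)
      have "weight d x ^ n * (\<Sum>j<d. (sin (x j) / 2)\<^sup>2) \<le> weight d x ^ n * weight d x"
        by (intro mult_left_mono grad_weight_sq_le) auto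
      also have "\<dots> \<le> real d ^ m" using wp Suc by (simp add: mult.commute)
      finally show ?thesis using Suc by (simp add: mult.assoc mult_left_mono del: of_nat_Suc power_Suc)
    qed simp
    then have "\<bar>h (x 0)\<bar> * \<bar>real m * weight d x ^ (m - 1) * (\<Sum>j<d. (sin (x j) / 2)\<^sup>2)\<bar> \<le> 1 * (real m * real d ^ m)"
      by (intro mult_mono b) (auto simp: abs_mult sum_nonneg)
    then have 2: "\<bar>h (x 0) * (real m * weight d x ^ (m - 1) * (\<Sum>j<d. (sin (x j) / 2)\<^sup>2))\<bar> \<le> real m * real d ^ m"
      by (simp only: abs_mult mult_1_left)
    show ?thesis unfolding E using 1 2 by (simp add: distrib_right)
  qed
  then have "\<bar>torus_mean d E\<bar> \<le> (1 + real m) * real d ^ m"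
    unfolding torus_mean_def by (intro torus_d.abs_mean_le C_torus_0_measurable cE)
  then show ?thesis unfolding eq .
qed

lemma weighted_moment_limit:
  assumes h: "\<And>t. (h has_real_derivative h' t) (at t)" and c: "continuous_on UNIV h'"
    and per: "\<And>t. h (t + 2 * pi) = h t" "\<And>t. h' (t + 2 * pi) = h' t"
    and b: "\<And>t. \<bar>h t\<bar> \<le> 1" "\<And>t. \<bar>h' t\<bar> \<le> 1"
    and lim: "(\<lambda>d. torus_mean d (\<lambda>x. h (x 0))) \<longlonglongrightarrow> a"
  shows "(\<lambda>d. torus_mean d (\<lambda>x. h (x 0) * weight d x ^ m) / real d ^ m) \<longlonglongrightarrow> a / 2 ^ m"
proof (induction m)
  case 0
  then show ?case using lim by simp
next
  case (Suc m)
  let ?A = "\<lambda>m d. torus_mean d (\<lambda>x. h (x 0) * weight d x ^ m) / real d ^ m"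
  have "(\<lambda>d. ?A (Suc m) d - 1 / 2 * ?A m d) \<longlonglongrightarrow> 0"
  proof (rule Lim_null_comparison)
    show "(\<lambda>d. (1 + real m) / real d) \<longlonglongrightarrow> 0" by (rule lim_const_over_n)
    show "\<forall>\<^sub>F d in sequentially. norm (?A (Suc m) d - 1 / 2 * ?A m d) \<le> (1 + real m) / real d"
      using eventually_gt_at_top[of 0]
    proof eventually_elim
      case (elim d)
      have "\<bar>?A (Suc m) d - 1 / 2 * ?A m d\<bar> = 
          \<bar>(torus_mean d (\<lambda>x. h (x 0) * weight d x ^ Suc m) - real d / 2 * torus_mean d (\<lambda>x. h (x 0) * weight d x ^ m)) / real d ^ Suc m\<bar>"
        using elim by (intro arg_cong[where f=abs]) (simp add: diff_divide_distrib)
      also have "\<dots> \<le> (1 + real m) * real d ^ m / real d ^ Suc m"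
        unfolding abs_divide using weighted_moment_step[OF h c per b, of d m] elim
        by (simp add: divide_right_mono del: power_Suc)
      also have "\<dots> = (1 + real m) / real d" using elim by simp
      finally show ?case by simp
    qed
  qed
  from tendsto_add[OF this tendsto_mult_left[OF Suc, of "1 / 2"]]
  show ?case by simp
qed

lemma torus_mean_sin_cos:
  assumes d: "0 < d"
  shows "torus_mean d (\<lambda>x. sin (x 0)) = 0"
    and "torus_mean d (\<lambda>x. (sin (x 0))\<^sup>2) = 1 / 2"
    and "torus_mean d (\<lambda>x. (cos (x 0))\<^sup>2) = 1 / 2"
proof -
  have s: "torus_diff d (\<lambda>x. - cos (x 0)) (\<lambda>j x. if j = 0 then sin (x 0) else 0)"
    by (rule torus_diff_coordinate[where g="\<lambda>t. - cos t" and g'=sin])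
       (auto intro!: derivative_eq_intros continuous_intros)
  from torus_mean_derivative[OF s d] show "torus_mean d (\<lambda>x. sin (x 0)) = 0" by simp
  have sc: "torus_diff d (\<lambda>x. sin (x 0) * cos (x 0)) (\<lambda>j x. if j = 0 then (cos (x 0))\<^sup>2 - (sin (x 0))\<^sup>2 else 0)"
    by (rule torus_diff_coordinate[where g="\<lambda>t. sin t * cos t" and g'="\<lambda>t. (cos t)\<^sup>2 - (sin t)\<^sup>2"])
       (auto intro!: derivative_eq_intros continuous_intros simp: power2_eq_square)
  have C: "(\<lambda>x. (cos (x 0))\<^sup>2) \<in> C_torus d 0" "(\<lambda>x. (sin (x 0))\<^sup>2) \<in> C_torus d 0"
    by (rule C_torus_0_coordinate; auto intro!: continuous_intros)+
  have "torus_mean d (\<lambda>x. (cos (x 0))\<^sup>2) - torus_mean d (\<lambda>x. (sin (x 0))\<^sup>2) = 0"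
    using torus_mean_derivative[OF sc d] by (simp add: torus_mean_diff[OF C])
  moreover have "torus_mean d (\<lambda>x. (cos (x 0))\<^sup>2) + torus_mean d (\<lambda>x. (sin (x 0))\<^sup>2) = 1"
    unfolding torus_mean_add[OF C, symmetric] by simp
  ultimately show "torus_mean d (\<lambda>x. (sin (x 0))\<^sup>2) = 1 / 2" "torus_mean d (\<lambda>x. (cos (x 0))\<^sup>2) = 1 / 2"
    by linarith+
qed

lemma pderiv_at_sin_cos:
  "pderiv_at j (\<lambda>x. a * sin (x 0) + b * cos (x 0)) =
    (\<lambda>x. (if j = 0 then - b else 0) * sin (x 0) + (if j = 0 then a else 0) * cos (x 0))"
proof
  fix x :: "nat \<Rightarrow> real"
  have "((\<lambda>t. a * sin t + b * cos t) has_real_derivative a * cos (x 0) - b * sin (x 0)) (at (x 0))"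
    by (auto intro!: derivative_eq_intros)
  then show "pderiv_at j (\<lambda>x. a * sin (x 0) + b * cos (x 0)) x =
    (if j = 0 then - b else 0) * sin (x 0) + (if j = 0 then a else 0) * cos (x 0)"
    by (cases "j = 0") (auto simp: pderiv_at_def DERIV_imp_deriv)
qed

lemma C_k_sin_cos: "C_k d k (\<lambda>x. a * sin (x 0) + b * cos (x 0))"
proof (induction k arbitrary: a b)
  case 0
  show ?case by (auto intro!: continuous_intros continuous_on_coordinate)
next
  case (Suc k)
  have "(\<lambda>t. a * sin ((x(j := t)) 0) + b * cos ((x(j := t)) 0)) differentiable (at (x j))" for x :: "nat \<Rightarrow> real" and j
  proof (cases "j = 0")
    case True
    have "((\<lambda>t. a * sin t + b * cos t) has_real_derivative a * cos (x 0) - b * sin (x 0)) (at (x 0))"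
      by (auto intro!: derivative_eq_intros)
    then show ?thesis using True real_differentiable_def by auto
  qed simp
  then show ?case
    using Suc by (simp add: pderiv_at_sin_cos) (auto intro!: continuous_intros continuous_on_coordinate)
qed

lemma sin_C_torus: "(\<lambda>x. sin (x 0)) \<in> C_torus d k"
  using C_k_sin_cos[of d k 1 0] by (auto simp: C_torus_def)

lemma laplacian_sin:
  assumes "0 < d" shows "laplacian d (\<lambda>x. c * sin (x 0)) = (\<lambda>x. - c * sin (x 0))"
proof
  fix x :: "nat \<Rightarrow> real"
  have "laplacian d (\<lambda>x. c * sin (x 0)) x = (\<Sum>j<d. if j = 0 then - c * sin (x 0) else 0)"
    unfolding laplacian_def
    using pderiv_at_sin_cos[of _ c 0] pderiv_at_sin_cos[of _ 0 c] pderiv_at_sin_cos[of _ 0 0]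
    by (intro sum.cong refl) simp
  then show "laplacian d (\<lambda>x. c * sin (x 0)) x = - c * sin (x 0)" using assms by simp
qed

lemma norm_D_sin:
  assumes d: "0 < d"
  shows "(norm_D d j (\<lambda>x. sin (x 0)) x)\<^sup>2 = (if even j then (sin (x 0))\<^sup>2 else (cos (x 0))\<^sup>2)"
proof -
  have L: "(laplacian d ^^ m) (\<lambda>x. sin (x 0)) = (\<lambda>x. (-1) ^ m * sin (x 0))" for m
    using laplacian_sin[OF d] by (induction m) auto
  show ?thesis
  proof (cases j rule: parity_cases)
    case (1 m)
    show ?thesis unfolding 1 norm_D_sq_even L by (simp add: power_mult_distrib power_mult[symmetric] mult.commute)
  next
    case (2 m)
    have "(\<Sum>i<d. (pderiv_at i (\<lambda>x. (-1) ^ m * sin (x 0)) x)\<^sup>2) = (\<Sum>i<d. if i = 0 then ((-1) ^ m * cos (x 0))\<^sup>2 else 0)"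
      using pderiv_at_sin_cos[of _ "(-1) ^ m" 0] by (intro sum.cong refl) simp
    also have "\<dots> = (cos (x 0))\<^sup>2" using d by (simp add: power_mult_distrib power_mult[symmetric] mult.commute)
    finally show ?thesis unfolding 2 norm_D_sq_odd L by simp
  qed
qed

lemma norm_D_sin_moment_limit:
  "(\<lambda>d. torus_mean d (\<lambda>x. (norm_D d j (\<lambda>x. sin (x 0)) x)\<^sup>2 * weight d x ^ m) / real d ^ m) \<longlonglongrightarrow> (1 / 2) / 2 ^ m"
proof -
  define h where "h = (\<lambda>t::real. if even j then (sin t)\<^sup>2 else (cos t)\<^sup>2)"
  define h' where "h' = (\<lambda>t::real. if even j then sin (2 * t) else - sin (2 * t))"
  have "(\<lambda>d. torus_mean d (\<lambda>x. h (x 0) * weight d x ^ m) / real d ^ m) \<longlonglongrightarrow> (1 / 2) / 2 ^ m"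
  proof (rule weighted_moment_limit)
    show "(h has_real_derivative h' t) (at t)" for t
      unfolding h_def h'_def by (cases "even j") (auto intro!: derivative_eq_intros simp: sin_double)
    show "continuous_on UNIV h'" unfolding h'_def by (cases "even j") (auto intro!: continuous_intros)
    show "h (t + 2 * pi) = h t" for t by (simp add: h_def)
    show "h' (t + 2 * pi) = h' t" for t 
      using sin_periodic[of "2 * t + 2 * pi"] sin_periodic[of "2 * t"] by (simp add: h'_def distrib_left algebra_simps)
    show "\<bar>h t\<bar> \<le> 1" for t by (simp add: h_def abs_square_le_1)
    show "\<bar>h' t\<bar> \<le> 1" for t by (simp add: h'_def)
    have "\<forall>\<^sub>F d in sequentially. 1 / 2 = torus_mean d (\<lambda>x. h (x 0))"
      using eventually_gt_at_top[of 0] by eventually_elim (cases "even j"; simp add: h_def torus_mean_sin_cos)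
    then show "(\<lambda>d. torus_mean d (\<lambda>x. h (x 0))) \<longlonglongrightarrow> 1 / 2"
      by (rule Lim_transform_eventually[OF tendsto_const])
  qed
  moreover have "\<forall>\<^sub>F d in sequentially. torus_mean d (\<lambda>x. h (x 0) * weight d x ^ m) / real d ^ m = 
     torus_mean d (\<lambda>x. (norm_D d j (\<lambda>x. sin (x 0)) x)\<^sup>2 * weight d x ^ m) / real d ^ m"
    using eventually_gt_at_top[of 0] by eventually_elim (simp add: h_def norm_D_sin)
  ultimately show ?thesis by (rule Lim_transform_eventually)
qed

text \<open>
  The normalising factor of the integrals cancels, and the integer exponents become
  natural numbers.
\<close>
lemma hardy_rellich_iff:
  "hardy_rellich d (l + i) l (int (m + i)) C \<longleftrightarrow>
    (\<forall>f\<in>C_torus d (l + i). torus_mean d f = 0 \<longrightarrow>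
       C * torus_mean d (\<lambda>x. (norm_D d l f x)\<^sup>2 * weight d x ^ m)
         \<le> torus_mean d (\<lambda>x. (norm_D d (l + i) f x)\<^sup>2 * weight d x ^ (m + i)))"
proof -
  have e: "int (m + i) - int (l + i) + int l = int m" by simp
  have mz: "torus_integral d f = 0 \<longleftrightarrow> torus_mean d f = 0" if "f \<in> C_torus d (l + i)" for f
    using torus_integral_eq_mean[OF C_torus_0_measurable[OF C_torus_mono[OF that, of 0]]] by simp
  have ti: "torus_integral d (\<lambda>x. (norm_D d j f x)\<^sup>2 * weight d x ^ n) = (2 * pi) ^ d * torus_mean d (\<lambda>x. (norm_D d j f x)\<^sup>2 * weight d x ^ n)"
    if "f \<in> C_torus d (l + i)" "j \<le> l + i" for f j n
    by (intro torus_integral_eq_mean C_torus_0_measurable C0_intros norm_D_sq_C0[OF that])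
  have p: "(0::real) < (2 * pi) ^ d" by simp
  have le: "C * ((2 * pi) ^ d * X) \<le> (2 * pi) ^ d * Y \<longleftrightarrow> C * X \<le> Y" for X Y :: real
    using p mult_le_cancel_left_pos[OF p, of "C * X" Y] by (simp only: mult.left_commute)
  show ?thesis
    unfolding hardy_rellich_def e power_int_of_nat C_torus_mean_zero_def
    using mz ti le by (auto simp: le)
qed

text \<open>
  The set of admissible constants is closed under suprema, because it is described by
  inequalities that are linear in the constant.  Hence a nonempty bounded set of this kind has a greatest
  element, and \<^const>\<open>best_const\<close> is its supremum.
\<close>
lemma best_const_bounds:
  assumes lo: "hardy_rellich d (l + i) l (int (m + i)) c"
    and up: "\<And>C. hardy_rellich d (l + i) l (int (m + i)) C \<Longrightarrow> C \<le> R"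
  shows "c \<le> best_const d (l + i) l (int (m + i)) \<and> best_const d (l + i) l (int (m + i)) \<le> R"
proof -
  let ?S = "{C. hardy_rellich d (l + i) l (int (m + i)) C}"
  have bdd: "bdd_above ?S" by (rule bdd_aboveI[where M=R]) (rule up, simp only: mem_Collect_eq)
  have ne: "?S \<noteq> {}" using lo by auto
  have "hardy_rellich d (l + i) l (int (m + i)) (Sup ?S)"
  proof (rule hardy_rellich_iff[THEN iffD2], intro ballI impI)
    fix f assume f: "f \<in> C_torus d (l + i)" and mz: "torus_mean d f = 0"
    let ?X = "torus_mean d (\<lambda>x. (norm_D d l f x)\<^sup>2 * weight d x ^ m)"
    let ?Y = "torus_mean d (\<lambda>x. (norm_D d (l + i) f x)\<^sup>2 * weight d x ^ (m + i))"
    have le: "C * ?X \<le> ?Y" if "C \<in> ?S" for C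
      using that f mz unfolding hardy_rellich_iff by auto
    have X: "0 \<le> ?X" and Y: "0 \<le> ?Y" by (auto intro!: torus_mean_nonneg)
    show "Sup ?S * ?X \<le> ?Y"
    proof (cases "?X = 0")
      case False
      then have "Sup ?S \<le> ?Y / ?X"
        using le X by (intro cSup_least ne) (simp add: pos_le_divide_eq)
      then show ?thesis using False X by (simp add: pos_le_divide_eq)
    qed (use Y in simp)
  qed
  then have "best_const d (l + i) l (int (m + i)) = Sup ?S"
    unfolding best_const_def using bdd by (intro Greatest_equality) (auto intro: cSup_upper)
  then show ?thesis using lo up bdd ne by (auto intro!: cSup_upper cSup_least)
qed

lemma best_const_limit:
  "(\<lambda>d. best_const d (l + i) l (int (m + i)) / real d ^ i) \<longlonglongrightarrow> 1 / 2 ^ i"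
proof -
  let ?N = "\<lambda>j n d. torus_mean d (\<lambda>x. (norm_D d j (\<lambda>x. sin (x 0)) x)\<^sup>2 * weight d x ^ n)"
  let ?X = "\<lambda>d. ?N l m d / real d ^ m" and ?Y = "\<lambda>d. ?N (l + i) (m + i) d / real d ^ (m + i)"
  have Xlim: "?X \<longlonglongrightarrow> (1 / 2) / 2 ^ m" and Ylim: "?Y \<longlonglongrightarrow> (1 / 2) / 2 ^ (m + i)"
    by (rule norm_D_sin_moment_limit)+
  have Rlim: "(\<lambda>d. ?Y d / ?X d) \<longlonglongrightarrow> 1 / 2 ^ i"
    using tendsto_divide[OF Ylim Xlim] by (simp add: power_add)
  have Xpos: "\<forall>\<^sub>F d in sequentially. 0 < ?X d"
    by (rule order_tendstoD(1)[OF Xlim]) simp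
  \<comment> \<open>Lower bound from the iterated inequality, upper bound by testing with \<open>sin x\<^sub>0\<close>\<close>
  have bounds: "\<forall>\<^sub>F d in sequentially. ((1 - \<epsilon>) / 2) ^ i \<le> best_const d (l + i) l (int (m + i)) / real d ^ i
      \<and> best_const d (l + i) l (int (m + i)) / real d ^ i \<le> ?Y d / ?X d" if \<epsilon>: "0 < \<epsilon>" "\<epsilon> < 1" for \<epsilon>
    using hardy_rellich_lower_bound[OF \<epsilon>, of l i m] Xpos eventually_gt_at_top[of 0]
  proof eventually_elim
    case (elim d)
    have X: "0 < ?N l m d" using elim(2,3) by (simp add: zero_less_divide_iff)
    have "((1 - \<epsilon>) * (real d / 2)) ^ i \<le> best_const d (l + i) l (int (m + i)) \<and>
        best_const d (l + i) l (int (m + i)) \<le> ?N (l + i) (m + i) d / ?N l m d"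
    proof (rule best_const_bounds)
      show "hardy_rellich d (l + i) l (int (m + i)) (((1 - \<epsilon>) * (real d / 2)) ^ i)"
        unfolding hardy_rellich_iff by (rule elim(1))
      fix C assume "hardy_rellich d (l + i) l (int (m + i)) C"
      then have "C * ?N l m d \<le> ?N (l + i) (m + i) d"
        unfolding hardy_rellich_iff using sin_C_torus torus_mean_sin_cos(1)[OF elim(3)] by blast
      then show "C \<le> ?N (l + i) (m + i) d / ?N l m d" using X by (simp add: pos_le_divide_eq)
    qed
    then have b1: "((1 - \<epsilon>) * (real d / 2)) ^ i \<le> best_const d (l + i) l (int (m + i))"
      and b2: "best_const d (l + i) l (int (m + i)) \<le> ?N (l + i) (m + i) d / ?N l m d"
      by blast+
    have "((1 - \<epsilon>) * (real d / 2)) ^ i / real d ^ i \<le> best_const d (l + i) l (int (m + i)) / real d ^ i"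
      and "best_const d (l + i) l (int (m + i)) / real d ^ i \<le> ?N (l + i) (m + i) d / ?N l m d / real d ^ i"
      by (rule divide_right_mono[OF b1], simp, rule divide_right_mono[OF b2], simp)
    moreover have "((1 - \<epsilon>) * (real d / 2)) ^ i / real d ^ i = ((1 - \<epsilon>) / 2) ^ i"
      unfolding power_divide[symmetric] using elim(3) by simp
    moreover have "?N (l + i) (m + i) d / ?N l m d / real d ^ i = ?Y d / ?X d"
      using elim(3) X by (simp add: power_add)
    ultimately show ?case by simp
  qed
  show ?thesis
  proof (rule order_tendstoI)
    fix a :: real assume a: "1 / 2 ^ i < a"
    have half: "(0::real) < 1 / 2" "(1 / 2 :: real) < 1" by auto
    have "\<forall>\<^sub>F d in sequentially. ?Y d / ?X d < a"
      using Rlim a by (rule order_tendstoD)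
    then show "\<forall>\<^sub>F d in sequentially. best_const d (l + i) l (int (m + i)) / real d ^ i < a"
      using bounds[OF half] by eventually_elim linarith
  next
    fix a :: real assume a: "a < 1 / 2 ^ i"
    have "((\<lambda>\<epsilon>. ((1 - \<epsilon>) / 2) ^ i) \<longlongrightarrow> ((1 - 0) / 2) ^ i) (at_right (0::real))"
      by (intro tendsto_intros) auto
    then have "\<forall>\<^sub>F \<epsilon> in at_right (0::real). a < ((1 - \<epsilon>) / 2) ^ i"
      using a by (intro order_tendstoD(1)) (simp_all add: power_divide)
    moreover have "\<forall>\<^sub>F \<epsilon> in at_right (0::real). \<epsilon> \<in> {0<..<1}"
      by (rule eventually_at_right_real) simp
    ultimately have "\<forall>\<^sub>F \<epsilon> in at_right (0::real). a < ((1 - \<epsilon>) / 2) ^ i \<and> \<epsilon> \<in> {0<..<1}"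
      by (rule eventually_conj)
    then obtain \<epsilon> :: real where e: "a < ((1 - \<epsilon>) / 2) ^ i" "0 < \<epsilon>" "\<epsilon> < 1"
      using eventually_happens'[of "at_right (0::real)"] by auto
    from bounds[OF e(2,3)] show "\<forall>\<^sub>F d in sequentially. a < best_const d (l + i) l (int (m + i)) / real d ^ i"
      by eventually_elim (use e(1) in linarith)
  qed
qed

theorem theorem1p3:
  fixes l k :: nat and \<gamma> :: int
  assumes "0 < int k - int l" and "int k - int l \<le> \<gamma>"
  shows "(\<lambda>d. best_const d k l \<gamma> / real d ^ (k - l)) \<longlonglongrightarrow> 2 powi (int l - int k)"
proof -
  define i where "i = k - l"
  define m where "m = nat \<gamma> - i"
  have k: "k = l + i" and g: "\<gamma> = int (m + i)" using assms by (auto simp: i_def m_def)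
  have "(2::real) powi (int l - int k) = 1 / 2 ^ i"
    unfolding k by (simp add: power_int_minus inverse_eq_divide)
  then show ?thesis using best_const_limit[of l i m] unfolding k g by simp
qed

end
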